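(* Let $\epsilon\in\{-1,1\}$ and let $(M^{2n},\mathcal J^\epsilon,g)$ be a curvature invariant $\epsilon$-Kähler submanifold of a locally symmetric para-quaternionic Kähler manifold $(\widetilde M^{4n},Q,\widetilde g)$ with $\nu\neq0$. Then the tensor field $[C,C]=R^{TT}-R$ belongs (at each point) to the space $\mathcal R(\mathfrak u^\epsilon_{p,q})$ and satisfies the second Bianchi identity $$\mathrm{cycl}\ \nabla_Z[C_X,C_Y]=0 .$$
   Context: An almost para-quaternionic structure on $\widetilde M$ is a rank 3 subbundle $Q\subset \mathrm{End}\,T\widetilde M$ locally generated by three anticommuting fields of endomorphisms $J_1,J_2,J_3=J_1J_2$ with $J_\alpha^2=\epsilon_\alpha Id$, where $(\epsilon_1,\epsilon_2,\epsilon_3)$ is a permutation of $(-1,1,1)$. A para-quaternionic Kähler manifold $(\widetilde M^{4n},Q,\widetilde g)$ is a pseudo-Riemannian manifold (of dimension $4n$, neutral signature) with such a $Q$ consisting of $\widetilde g$-skew-symmetric endomorphisms and preserved by the Levi-Civita connection $\widetilde\nabla$; in dimension 4 ($n=1$) one requires in addition that $\widetilde R=\nu R_0+W$, with $R_0(X,Y)=\frac12\sum_\alpha\epsilon_\alpha\widetilde g(J_\alpha X,Y)J_\alpha+\frac14(X\wedge Y-\sum_\alpha\epsilon_\alpha J_\alpha X\wedge J_\alpha Y)$, $(X\wedge Y)Z=\widetilde g(Y,Z)X-\widetilde g(X,Z)Y$, and $W$ a trace-free $Q$-invariant algebraic curvature tensor. $\nu=scal/(4n(n+2))$ is the reduced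 scalar curvature. Locally symmetric means $\widetilde\nabla\widetilde R=0$. A $\widetilde g$-non-degenerate submanifold $M\subset\widetilde M$ is an almost $\epsilon$-Hermitian submanifold if there is a section $J^\epsilon:M\to Q|_M$ with $J^\epsilon TM=TM$ and $(J^\epsilon)^2=\epsilon Id$; put $g=\widetilde g|_M$, $\mathcal J^\epsilon=J^\epsilon|_{TM}$. It is $\epsilon$-Kähler if $F=g\circ\mathcal J^\epsilon$ is parallel for the Levi-Civita connection $\nabla$ of $g$. An adapted basis is a local frame $(J_1,J_2,J_3)$ of $Q$ with $J_1|_M=J^\epsilon$, $J_1^2=\epsilon Id$, $J_2^2=Id$, $J_3=J_1J_2=-J_2J_1$. $M^{2n}$ is totally $\epsilon$-complex ($J_2T_xM\perp T_xM$), so $T_x\widetilde M=T_xM\oplus J_2T_xM$. $M$ is curvature invariant if $\widetilde R_{XY}Z\in TM$ for all $X,Y,Z\in TM$. $h$ is the second fundamental form, $C_XY=J_2h(X,Y)\in TM$ the shape tensor, and $[C,C]$ is the $\mathrm{End}(TM)$-valued 2-form $[C,C](X,Y)=[C_X,C_Y]$ (globally defined on $M$). $R$ is the curvature tensor of $g$; $R^{TT}_{XY}\in\mathrm{End}(TM)$, for $X,Y\in TM$, is the tangential part of $\widetilde R_{XY}$ (restricted to $TM$ and projected orthogonally to $TM$). For a subspace $\mathcal G\subset\mathrm{End}(T_xM)$, $\mathcal R(\mathcal G)=\{R\in\mathcal G\otimes\Lambda^2T_x^*M:\ \mathrm{cycl}\,R(X,Y)Z=0\ \forall X,Y,Z\in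 T_xM\}$, where cycl is the sum over cyclic permutations of $X,Y,Z$. $\mathfrak u^\epsilon_{p,q}$ is the Lie algebra of the unitary group of $(\mathcal J^\epsilon,g)$, i.e. the endomorphisms of $T_xM$ that are $g$-skew-symmetric and commute with $\mathcal J^\epsilon$ ($(p,q)$ refers to the signature of $g$). In the second Bianchi identity $\nabla_Z[C_X,C_Y]$ denotes $(\nabla_Z[C,C])(X,Y)$.
   Formalization: For n = 1 the section J^ε is in addition assumed parallel along M for the ambient Levi-Civita connection; with only F parallel the claim fails, e.g. for umbilical, not totally geodesic surfaces in a 4-dimensional space of constant nonzero curvature. *)

theory Defs
  imports "HOL-Analysis.Analysis"
begin

section \<open>Smooth maps and smooth manifolds\<close>

abbreviation fder :: "('a::euclidean_space \<Rightarrow> 'b::real_normed_vector) \<Rightarrow> 'a \<Rightarrow> 'a \<Rightarrow> 'b" where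
  "fder f x u \<equiv> frechet_derivative f (at x) u"

text \<open>All sets on which smoothness is required below are open.\<close>

primrec times_differentiable_on ::
  "nat \<Rightarrow> 'a::euclidean_space set \<Rightarrow> ('a \<Rightarrow> 'b::real_normed_vector) \<Rightarrow> bool" where
  "times_differentiable_on 0 S f \<longleftrightarrow> continuous_on S f"
| "times_differentiable_on (Suc k) S f \<longleftrightarrow>
     (\<forall>x\<in>S. f differentiable (at x)) \<and>
     (\<forall>v. times_differentiable_on k S (\<lambda>x. fder f x v))"

definition smooth_on :: "'a::euclidean_space set \<Rightarrow> ('a \<Rightarrow> 'b::real_normed_vector) \<Rightarrow> bool" where
  "smooth_on S f \<longleftrightarrow> (\<forall>k. times_differentiable_on k S f)"

type_synonym ('p, 'a) chart = "'p set \<times> ('p \<Rightarrow> 'a)"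

abbreviation cdom :: "('p, 'a) chart \<Rightarrow> 'p set" where "cdom c \<equiv> fst c"
abbreviation cmap :: "('p, 'a) chart \<Rightarrow> 'p \<Rightarrow> 'a" where "cmap c \<equiv> snd c"
abbreviation cinv :: "('p, 'a) chart \<Rightarrow> 'a \<Rightarrow> 'p" where "cinv c \<equiv> inv_into (cdom c) (cmap c)"
abbreviation cimg :: "('p, 'a) chart \<Rightarrow> 'a set" where "cimg c \<equiv> cmap c ` cdom c"

definition overlap :: "('p, 'a) chart \<Rightarrow> ('p, 'a) chart \<Rightarrow> 'a set" where
  "overlap c d = cmap c ` (cdom c \<inter> cdom d)"

definition transition :: "('p, 'a) chart \<Rightarrow> ('p, 'a) chart \<Rightarrow> 'a \<Rightarrow> 'a" where
  "transition c d = (\<lambda>x. cmap d (cinv c x))"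

definition smooth_atlas ::
  "('p::{t2_space, second_countable_topology}, 'a::euclidean_space) chart set \<Rightarrow> bool" where
  "smooth_atlas A \<longleftrightarrow>
     (\<forall>c\<in>A. open (cdom c) \<and> open (cimg c) \<and> homeomorphism (cdom c) (cimg c) (cmap c) (cinv c)) \<and>
     (\<Union>c\<in>A. cdom c) = UNIV \<and>
     (\<forall>c\<in>A. \<forall>d\<in>A. smooth_on (overlap c d) (transition c d))"

section \<open>Pseudo-Riemannian geometry in a chart\<close>

text \<open>
  A tensor field on a manifold is given by its local expressions in the charts of the atlas,
  subject to the transformation law under changes of charts. The operations of this section
  act on such local expressions: \<open>g x\<close> is the metric at the point with coordinates \<open>x\<close>, and
  tangent vectors are represented in the model space, which is also identified with the
  vector fields having constant coefficients in the chart.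
\<close>

definition nondegenerate :: "('a::euclidean_space \<Rightarrow> 'a \<Rightarrow> real) \<Rightarrow> bool" where
  "nondegenerate b \<longleftrightarrow> (\<forall>u. (\<forall>v. b u v = 0) \<longrightarrow> u = 0)"

definition neutral :: "('a::euclidean_space \<Rightarrow> 'a \<Rightarrow> real) \<Rightarrow> bool" where
  "neutral b \<longleftrightarrow>
     (\<exists>P N. subspace P \<and> subspace N \<and> 2 * dim P = DIM('a) \<and> 2 * dim N = DIM('a) \<and>
        (\<forall>u\<in>P. u \<noteq> 0 \<longrightarrow> b u u > 0) \<and> (\<forall>u\<in>N. u \<noteq> 0 \<longrightarrow> b u u < 0))"

definition metric_on :: "'a::euclidean_space set \<Rightarrow> ('a \<Rightarrow> 'a \<Rightarrow> 'a \<Rightarrow> real) \<Rightarrow> bool" where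
  "metric_on S g \<longleftrightarrow>
     (\<forall>x\<in>S. bilinear (g x) \<and> (\<forall>u v. g x u v = g x v u) \<and> nondegenerate (g x)) \<and>
     (\<forall>u v. smooth_on S (\<lambda>x. g x u v))"

text \<open>
  The Levi-Civita connection is written \<open>\<nabla>\<^sub>u Y = DY(u) + \<Gamma>(u, Y)\<close>; the two conditions on \<open>\<Gamma>\<close> say
  that it is torsion-free and that \<open>g\<close> is parallel.
\<close>

definition levi_civita :: "('a::euclidean_space \<Rightarrow> 'a \<Rightarrow> 'a \<Rightarrow> real) \<Rightarrow> 'a \<Rightarrow> 'a \<Rightarrow> 'a \<Rightarrow> 'a" where
  "levi_civita g x =
     (THE \<Gamma>. bilinear \<Gamma> \<and> (\<forall>u v. \<Gamma> u v = \<Gamma> v u) \<and>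
        (\<forall>w u v. fder (\<lambda>y. g y u v) x w = g x (\<Gamma> w u) v + g x u (\<Gamma> w v)))"

text \<open>\<open>R(X,Y) = \<nabla>\<^sub>X \<nabla>\<^sub>Y - \<nabla>\<^sub>Y \<nabla>\<^sub>X - \<nabla>\<^bsub>[X,Y]\<^esub>\<close>, evaluated on constant fields.\<close>

definition riemann :: "('a::euclidean_space \<Rightarrow> 'a \<Rightarrow> 'a \<Rightarrow> real) \<Rightarrow> 'a \<Rightarrow> 'a \<Rightarrow> 'a \<Rightarrow> 'a \<Rightarrow> 'a" where
  "riemann g x X Y Z =
     (let \<Gamma> = levi_civita g in
        fder (\<lambda>y. \<Gamma> y Y Z) x X - fder (\<lambda>y. \<Gamma> y X Z) x Y + \<Gamma> x X (\<Gamma> x Y Z) - \<Gamma> x Y (\<Gamma> x X Z))"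

text \<open>Covariant derivatives of a bilinear form, of an endomorphism field and of an
  endomorphism-valued 2-form; the first vector argument is the direction of differentiation.\<close>

definition cov_form :: "('a::euclidean_space \<Rightarrow> 'a \<Rightarrow> 'a \<Rightarrow> 'a) \<Rightarrow> ('a \<Rightarrow> 'a \<Rightarrow> 'a \<Rightarrow> real) \<Rightarrow>
    'a \<Rightarrow> 'a \<Rightarrow> 'a \<Rightarrow> 'a \<Rightarrow> real" where
  "cov_form \<Gamma> F x w u v = fder (\<lambda>y. F y u v) x w - F x (\<Gamma> x w u) v - F x u (\<Gamma> x w v)"

definition cov_endo :: "('a::euclidean_space \<Rightarrow> 'a \<Rightarrow> 'a \<Rightarrow> 'a) \<Rightarrow> ('a \<Rightarrow> 'a \<Rightarrow> 'a) \<Rightarrow>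
    'a \<Rightarrow> 'a \<Rightarrow> 'a \<Rightarrow> 'a" where
  "cov_endo \<Gamma> A x w u = fder (\<lambda>y. A y u) x w + \<Gamma> x w (A x u) - A x (\<Gamma> x w u)"

definition cov_curv :: "('a::euclidean_space \<Rightarrow> 'a \<Rightarrow> 'a \<Rightarrow> 'a) \<Rightarrow> ('a \<Rightarrow> 'a \<Rightarrow> 'a \<Rightarrow> 'a \<Rightarrow> 'a) \<Rightarrow>
    'a \<Rightarrow> 'a \<Rightarrow> 'a \<Rightarrow> 'a \<Rightarrow> 'a \<Rightarrow> 'a" where
  "cov_curv \<Gamma> T x W X Y Z =
     fder (\<lambda>y. T y X Y Z) x W + \<Gamma> x W (T x X Y Z)
     - T x (\<Gamma> x W X) Y Z - T x X (\<Gamma> x W Y) Z - T x X Y (\<Gamma> x W Z)"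

definition tr :: "('a::euclidean_space \<Rightarrow> 'a) \<Rightarrow> real" where
  "tr A = (\<Sum>b\<in>Basis. A b \<bullet> b)"

definition ricci :: "('a::euclidean_space \<Rightarrow> 'a \<Rightarrow> 'a \<Rightarrow> real) \<Rightarrow> 'a \<Rightarrow> 'a \<Rightarrow> 'a \<Rightarrow> real" where
  "ricci g x Y Z = tr (\<lambda>X. riemann g x X Y Z)"

definition scal :: "('a::euclidean_space \<Rightarrow> 'a \<Rightarrow> 'a \<Rightarrow> real) \<Rightarrow> 'a \<Rightarrow> real" where
  "scal g x = tr (THE A. linear A \<and> (\<forall>Y Z. g x (A Y) Z = ricci g x Y Z))"

definition so_alg :: "('a::euclidean_space \<Rightarrow> 'a \<Rightarrow> real) \<Rightarrow> ('a \<Rightarrow> 'a) set" where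
  "so_alg b = {A. linear A \<and> (\<forall>u v. b (A u) v = - b u (A v))}"

definition u_alg :: "('a::euclidean_space \<Rightarrow> 'a \<Rightarrow> real) \<Rightarrow> ('a \<Rightarrow> 'a) \<Rightarrow> ('a \<Rightarrow> 'a) set" where
  "u_alg b J = {A \<in> so_alg b. \<forall>u. A (J u) = J (A u)}"

text \<open>The space \<open>\<R>(\<G>)\<close> of curvature tensors of type \<open>\<G>\<close>.\<close>

definition curvature_space ::
    "('a::euclidean_space \<Rightarrow> 'a) set \<Rightarrow> ('a \<Rightarrow> 'a \<Rightarrow> 'a \<Rightarrow> 'a) set" where
  "curvature_space \<G> =
     {R. (\<forall>Z. bilinear (\<lambda>X Y. R X Y Z)) \<and> (\<forall>X Y Z. R X Y Z = - R Y X Z) \<and>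
         (\<forall>X Y. R X Y \<in> \<G>) \<and> (\<forall>X Y Z. R X Y Z + R Y Z X + R Z X Y = 0)}"

section \<open>Para-quaternionic Kaehler manifolds\<close>

definition endo_span3 :: "('b::real_vector \<Rightarrow> 'b) \<Rightarrow> ('b \<Rightarrow> 'b) \<Rightarrow> ('b \<Rightarrow> 'b) \<Rightarrow> ('b \<Rightarrow> 'b) set" where
  "endo_span3 J1 J2 J3 = {A. \<exists>a b c. A = (\<lambda>v. a *\<^sub>R J1 v + b *\<^sub>R J2 v + c *\<^sub>R J3 v)}"

definition pq_basis :: "real \<Rightarrow> real \<Rightarrow> real \<Rightarrow> ('b::euclidean_space \<Rightarrow> 'b) set \<Rightarrow>
    ('b \<Rightarrow> 'b) \<Rightarrow> ('b \<Rightarrow> 'b) \<Rightarrow> ('b \<Rightarrow> 'b) \<Rightarrow> bool" where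
  "pq_basis e1 e2 e3 Q J1 J2 J3 \<longleftrightarrow>
     (e1, e2, e3) \<in> {(-1, 1, 1), (1, -1, 1), (1, 1, -1)} \<and>
     linear J1 \<and> linear J2 \<and> linear J3 \<and>
     (\<forall>v. J1 (J1 v) = e1 *\<^sub>R v) \<and> (\<forall>v. J2 (J2 v) = e2 *\<^sub>R v) \<and> (\<forall>v. J3 (J3 v) = e3 *\<^sub>R v) \<and>
     (\<forall>v. J3 v = J1 (J2 v)) \<and>
     (\<forall>v. J1 (J2 v) = - J2 (J1 v)) \<and> (\<forall>v. J2 (J3 v) = - J3 (J2 v)) \<and>
     (\<forall>v. J3 (J1 v) = - J1 (J3 v)) \<and>
     Q = endo_span3 J1 J2 J3"

text \<open>
  The metric and the bundle \<open>Q\<close> of a manifold with atlas \<open>A\<close> are families of local expressions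
  \<open>G c x\<close>, \<open>Q c x\<close> indexed by the charts \<open>c \<in> A\<close>.
\<close>

definition neutral_metric ::
    "('q::{t2_space, second_countable_topology}, 'b::euclidean_space) chart set \<Rightarrow>
     (('q, 'b) chart \<Rightarrow> 'b \<Rightarrow> 'b \<Rightarrow> 'b \<Rightarrow> real) \<Rightarrow> bool" where
  "neutral_metric A G \<longleftrightarrow>
     (\<forall>c\<in>A. metric_on (cimg c) (G c) \<and> (\<forall>x\<in>cimg c. neutral (G c x))) \<and>
     (\<forall>c\<in>A. \<forall>d\<in>A. \<forall>x\<in>overlap c d. \<forall>u v.
        G c x u v = G d (transition c d x) (fder (transition c d) x u) (fder (transition c d) x v))"

definition almost_pq_structure ::
    "('q::{t2_space, second_countable_topology}, 'b::euclidean_space) chart set \<Rightarrow>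
     (('q, 'b) chart \<Rightarrow> 'b \<Rightarrow> ('b \<Rightarrow> 'b) set) \<Rightarrow> bool" where
  "almost_pq_structure A Q \<longleftrightarrow>
     (\<forall>c\<in>A. \<forall>x\<in>cimg c. \<exists>V J1 J2 J3 e1 e2 e3. open V \<and> x \<in> V \<and> V \<subseteq> cimg c \<and>
        (\<forall>v. smooth_on V (\<lambda>y. J1 y v) \<and> smooth_on V (\<lambda>y. J2 y v) \<and> smooth_on V (\<lambda>y. J3 y v)) \<and>
        (\<forall>y\<in>V. pq_basis e1 e2 e3 (Q c y) (J1 y) (J2 y) (J3 y))) \<and>
     (\<forall>c\<in>A. \<forall>d\<in>A. \<forall>x\<in>overlap c d.
        Q d (transition c d x) =
          {B. linear B \<and> (\<exists>A\<in>Q c x. \<forall>u. B (fder (transition c d) x u) = fder (transition c d) x (A u))})"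

definition bundle_parallel ::
    "'b::euclidean_space set \<Rightarrow> ('b \<Rightarrow> 'b \<Rightarrow> 'b \<Rightarrow> real) \<Rightarrow> ('b \<Rightarrow> ('b \<Rightarrow> 'b) set) \<Rightarrow> bool" where
  "bundle_parallel S g Q \<longleftrightarrow>
     (\<forall>V A. open V \<and> V \<subseteq> S \<and> (\<forall>v. smooth_on V (\<lambda>y. A y v)) \<and> (\<forall>y\<in>V. A y \<in> Q y) \<longrightarrow>
        (\<forall>x\<in>V. \<forall>w. cov_endo (levi_civita g) A x w \<in> Q x))"

definition wedge_op :: "('b::euclidean_space \<Rightarrow> 'b \<Rightarrow> real) \<Rightarrow> 'b \<Rightarrow> 'b \<Rightarrow> 'b \<Rightarrow> 'b" where
  "wedge_op b X Y Z = b Y Z *\<^sub>R X - b X Z *\<^sub>R Y"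

definition R0 :: "('b::euclidean_space \<Rightarrow> 'b \<Rightarrow> real) \<Rightarrow> real \<Rightarrow> real \<Rightarrow> real \<Rightarrow>
    ('b \<Rightarrow> 'b) \<Rightarrow> ('b \<Rightarrow> 'b) \<Rightarrow> ('b \<Rightarrow> 'b) \<Rightarrow> 'b \<Rightarrow> 'b \<Rightarrow> 'b \<Rightarrow> 'b" where
  "R0 b e1 e2 e3 J1 J2 J3 X Y Z =
     (1/2) *\<^sub>R ((e1 * b (J1 X) Y) *\<^sub>R J1 Z + (e2 * b (J2 X) Y) *\<^sub>R J2 Z + (e3 * b (J3 X) Y) *\<^sub>R J3 Z) +
     (1/4) *\<^sub>R (wedge_op b X Y Z
        - (e1 *\<^sub>R wedge_op b (J1 X) (J1 Y) Z + e2 *\<^sub>R wedge_op b (J2 X) (J2 Y) Z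
           + e3 *\<^sub>R wedge_op b (J3 X) (J3 Y) Z))"

definition reduced_scal :: "nat \<Rightarrow> ('b::euclidean_space \<Rightarrow> 'b \<Rightarrow> 'b \<Rightarrow> real) \<Rightarrow> 'b \<Rightarrow> real" where
  "reduced_scal n g x = scal g x / (4 * real n * (real n + 2))"

text \<open>The endomorphisms in \<open>Q\<close> act on tensors as derivations.\<close>

definition Q_invariant :: "('b::euclidean_space \<Rightarrow> 'b) set \<Rightarrow> ('b \<Rightarrow> 'b \<Rightarrow> 'b \<Rightarrow> 'b) \<Rightarrow> bool" where
  "Q_invariant Q W \<longleftrightarrow>
     (\<forall>A\<in>Q. \<forall>X Y Z. A (W X Y Z) - W (A X) Y Z - W X (A Y) Z - W X Y (A Z) = 0)"

text \<open>For \<open>W\<close> with values in \<open>so_alg\<close> the vanishing of the Ricci contraction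
  makes all metric traces vanish.\<close>

definition trace_free :: "('b::euclidean_space \<Rightarrow> 'b \<Rightarrow> 'b \<Rightarrow> 'b) \<Rightarrow> bool" where
  "trace_free W \<longleftrightarrow> (\<forall>Y Z. tr (\<lambda>X. W X Y Z) = 0)"

definition pq_kaehler :: "nat \<Rightarrow>
    ('q::{t2_space, second_countable_topology}, 'b::euclidean_space) chart set \<Rightarrow>
    (('q, 'b) chart \<Rightarrow> 'b \<Rightarrow> ('b \<Rightarrow> 'b) set) \<Rightarrow>
    (('q, 'b) chart \<Rightarrow> 'b \<Rightarrow> 'b \<Rightarrow> 'b \<Rightarrow> real) \<Rightarrow> bool" where
  "pq_kaehler n A Q G \<longleftrightarrow>
     DIM('b) = 4 * n \<and> smooth_atlas A \<and> neutral_metric A G \<and> almost_pq_structure A Q \<and>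
     (\<forall>c\<in>A. (\<forall>x\<in>cimg c. Q c x \<subseteq> so_alg (G c x)) \<and> bundle_parallel (cimg c) (G c) (Q c)) \<and>
     (n = 1 \<longrightarrow> (\<forall>c\<in>A. \<forall>x\<in>cimg c. \<exists>e1 e2 e3 J1 J2 J3 W.
        pq_basis e1 e2 e3 (Q c x) J1 J2 J3 \<and>
        W \<in> curvature_space (so_alg (G c x)) \<and> trace_free W \<and> Q_invariant (Q c x) W \<and>
        (\<forall>X Y Z. riemann (G c) x X Y Z =
           reduced_scal n (G c) x *\<^sub>R R0 (G c x) e1 e2 e3 J1 J2 J3 X Y Z + W X Y Z)))"

definition locally_symmetric ::
    "('q::{t2_space, second_countable_topology}, 'b::euclidean_space) chart set \<Rightarrow>
     (('q, 'b) chart \<Rightarrow> 'b \<Rightarrow> 'b \<Rightarrow> 'b \<Rightarrow> real) \<Rightarrow> bool" where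
  "locally_symmetric A G \<longleftrightarrow>
     (\<forall>c\<in>A. \<forall>x\<in>cimg c. \<forall>W X Y Z.
        cov_curv (levi_civita (G c)) (riemann (G c)) x W X Y Z = 0)"

section \<open>Submanifolds\<close>

text \<open>
  A submanifold is a manifold with atlas \<open>B\<close> together with an injective immersion \<open>f\<close>.
  For a chart \<open>c\<close> of the submanifold and a chart \<open>d\<close> of the ambient manifold, \<open>local_rep f c d\<close>
  is the expression \<open>\<phi>\<close> of \<open>f\<close> in coordinates, with domain \<open>local_dom f c d\<close>. The vectors
  tangent to the submanifold at \<open>\<phi> x\<close> are the \<open>fder \<phi> x u\<close>, represented by \<open>u\<close> in the chart \<open>c\<close>.
\<close>

definition local_dom :: "('p \<Rightarrow> 'q) \<Rightarrow> ('p, 'a) chart \<Rightarrow> ('q, 'b) chart \<Rightarrow> 'a set" where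
  "local_dom f c d = cmap c ` (cdom c \<inter> f -` cdom d)"

definition local_rep :: "('p \<Rightarrow> 'q) \<Rightarrow> ('p, 'a) chart \<Rightarrow> ('q, 'b) chart \<Rightarrow> 'a \<Rightarrow> 'b" where
  "local_rep f c d = (\<lambda>x. cmap d (f (cinv c x)))"

definition induced_metric :: "('b::euclidean_space \<Rightarrow> 'b \<Rightarrow> 'b \<Rightarrow> real) \<Rightarrow> ('a::euclidean_space \<Rightarrow> 'b) \<Rightarrow>
    'a \<Rightarrow> 'a \<Rightarrow> 'a \<Rightarrow> real" where
  "induced_metric gt \<phi> x u v = gt (\<phi> x) (fder \<phi> x u) (fder \<phi> x v)"

definition tan_part :: "('b::euclidean_space \<Rightarrow> 'b \<Rightarrow> 'b \<Rightarrow> real) \<Rightarrow> ('a::euclidean_space \<Rightarrow> 'b) \<Rightarrow>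
    'a \<Rightarrow> 'b \<Rightarrow> 'a" where
  "tan_part gt \<phi> x w = (THE u. \<forall>v. gt (\<phi> x) (w - fder \<phi> x u) (fder \<phi> x v) = 0)"

definition nor_part :: "('b::euclidean_space \<Rightarrow> 'b \<Rightarrow> 'b \<Rightarrow> real) \<Rightarrow> ('a::euclidean_space \<Rightarrow> 'b) \<Rightarrow>
    'a \<Rightarrow> 'b \<Rightarrow> 'b" where
  "nor_part gt \<phi> x w = w - fder \<phi> x (tan_part gt \<phi> x w)"

text \<open>\<open>h(X, Y)\<close> is the normal part of the ambient derivative of \<open>Y\<close> along \<open>X\<close>, here for \<open>X\<close>, \<open>Y\<close>
  constant in the chart of the submanifold.\<close>

definition second_fundamental_form ::
    "('b::euclidean_space \<Rightarrow> 'b \<Rightarrow> 'b \<Rightarrow> real) \<Rightarrow> ('a::euclidean_space \<Rightarrow> 'b) \<Rightarrow> 'a \<Rightarrow> 'a \<Rightarrow> 'a \<Rightarrow> 'b" where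
  "second_fundamental_form gt \<phi> x X Y =
     nor_part gt \<phi> x
       (fder (\<lambda>y. fder \<phi> y Y) x X + levi_civita gt (\<phi> x) (fder \<phi> x X) (fder \<phi> x Y))"

definition nondegenerate_submanifold ::
    "('p::{t2_space, second_countable_topology}, 'a::euclidean_space) chart set \<Rightarrow>
     ('q::{t2_space, second_countable_topology}, 'b::euclidean_space) chart set \<Rightarrow>
     (('q, 'b) chart \<Rightarrow> 'b \<Rightarrow> 'b \<Rightarrow> 'b \<Rightarrow> real) \<Rightarrow> ('p \<Rightarrow> 'q) \<Rightarrow> bool" where
  "nondegenerate_submanifold B A G f \<longleftrightarrow>
     smooth_atlas B \<and> inj f \<and> continuous_on UNIV f \<and>
     (\<forall>c\<in>B. \<forall>d\<in>A. smooth_on (local_dom f c d) (local_rep f c d) \<and>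
        (\<forall>x\<in>local_dom f c d. inj (fder (local_rep f c d) x) \<and>
           nondegenerate (induced_metric (G d) (local_rep f c d) x)))"

text \<open>The endomorphism of the tangent space of the submanifold obtained by restricting \<open>J x\<close>,
  which is defined if \<open>J x\<close> preserves that space.\<close>

definition restrict_endo :: "('a::euclidean_space \<Rightarrow> 'b::euclidean_space) \<Rightarrow> ('a \<Rightarrow> 'b \<Rightarrow> 'b) \<Rightarrow>
    'a \<Rightarrow> 'a \<Rightarrow> 'a" where
  "restrict_endo \<phi> J x u = (THE w. fder \<phi> x w = J x (fder \<phi> x u))"

text \<open>A section \<open>J\<close> of \<open>Q\<close> along \<open>f\<close> is given by its local expressions \<open>J d p\<close>, endomorphisms of
  the tangent space at \<open>f p\<close> in the ambient chart \<open>d\<close>.\<close>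

definition almost_eps_hermitian :: "real \<Rightarrow>
    ('p::{t2_space, second_countable_topology}, 'a::euclidean_space) chart set \<Rightarrow>
    ('q::{t2_space, second_countable_topology}, 'b::euclidean_space) chart set \<Rightarrow>
    (('q, 'b) chart \<Rightarrow> 'b \<Rightarrow> ('b \<Rightarrow> 'b) set) \<Rightarrow> (('q, 'b) chart \<Rightarrow> 'b \<Rightarrow> 'b \<Rightarrow> 'b \<Rightarrow> real) \<Rightarrow>
    ('p \<Rightarrow> 'q) \<Rightarrow> (('q, 'b) chart \<Rightarrow> 'p \<Rightarrow> 'b \<Rightarrow> 'b) \<Rightarrow> bool" where
  "almost_eps_hermitian \<epsilon> B A Q G f J \<longleftrightarrow>
     nondegenerate_submanifold B A G f \<and>
     (\<forall>d\<in>A. \<forall>d'\<in>A. \<forall>p. f p \<in> cdom d \<inter> cdom d' \<longrightarrow>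
        (\<forall>v. J d' p (fder (transition d d') (cmap d (f p)) v)
             = fder (transition d d') (cmap d (f p)) (J d p v))) \<and>
     (\<forall>c\<in>B. \<forall>d\<in>A.
        (\<forall>v. smooth_on (local_dom f c d) (\<lambda>x. J d (cinv c x) v)) \<and>
        (\<forall>x\<in>local_dom f c d.
           J d (cinv c x) \<in> Q d (local_rep f c d x) \<and>
           (\<forall>v. J d (cinv c x) (J d (cinv c x) v) = \<epsilon> *\<^sub>R v) \<and>
           J d (cinv c x) ` range (fder (local_rep f c d) x) = range (fder (local_rep f c d) x)))"

definition eps_kaehler_submanifold :: "real \<Rightarrow>
    ('p::{t2_space, second_countable_topology}, 'a::euclidean_space) chart set \<Rightarrow>
    ('q::{t2_space, second_countable_topology}, 'b::euclidean_space) chart set \<Rightarrow>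
    (('q, 'b) chart \<Rightarrow> 'b \<Rightarrow> ('b \<Rightarrow> 'b) set) \<Rightarrow> (('q, 'b) chart \<Rightarrow> 'b \<Rightarrow> 'b \<Rightarrow> 'b \<Rightarrow> real) \<Rightarrow>
    ('p \<Rightarrow> 'q) \<Rightarrow> (('q, 'b) chart \<Rightarrow> 'p \<Rightarrow> 'b \<Rightarrow> 'b) \<Rightarrow> bool" where
  "eps_kaehler_submanifold \<epsilon> B A Q G f J \<longleftrightarrow>
     almost_eps_hermitian \<epsilon> B A Q G f J \<and>
     (\<forall>c\<in>B. \<forall>d\<in>A.
        let \<phi> = local_rep f c d;
            g = induced_metric (G d) \<phi>;
            \<J> = restrict_endo \<phi> (\<lambda>x. J d (cinv c x));
            F = (\<lambda>x u v. g x (\<J> x u) v)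
        in \<forall>x\<in>local_dom f c d. \<forall>w u v. cov_form (levi_civita g) F x w u v = 0)"

definition curvature_invariant ::
    "('p, 'a::euclidean_space) chart set \<Rightarrow> ('q, 'b::euclidean_space) chart set \<Rightarrow>
     (('q, 'b) chart \<Rightarrow> 'b \<Rightarrow> 'b \<Rightarrow> 'b \<Rightarrow> real) \<Rightarrow> ('p \<Rightarrow> 'q) \<Rightarrow> bool" where
  "curvature_invariant B A G f \<longleftrightarrow>
     (\<forall>c\<in>B. \<forall>d\<in>A.
        let \<phi> = local_rep f c d
        in \<forall>x\<in>local_dom f c d. \<forall>X Y Z.
             riemann (G d) (\<phi> x) (fder \<phi> x X) (fder \<phi> x Y) (fder \<phi> x Z) \<in> range (fder \<phi> x))"

text \<open>The section \<open>J\<close> along \<open>f\<close> is parallel for the ambient Levi-Civita connection in the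
  directions tangent to the submanifold. For a surface in a 4-manifold the form \<open>F\<close> is always
  parallel, so there this has to be required in addition; otherwise umbilical surfaces
  in spaces of constant curvature would count as Kaehler, with a bracket \<open>[C, C]\<close> that is not skew.\<close>

definition parallel_section ::
    "('p, 'a::euclidean_space) chart set \<Rightarrow> ('q, 'b::euclidean_space) chart set \<Rightarrow>
     (('q, 'b) chart \<Rightarrow> 'b \<Rightarrow> 'b \<Rightarrow> 'b \<Rightarrow> real) \<Rightarrow> ('p \<Rightarrow> 'q) \<Rightarrow>
     (('q, 'b) chart \<Rightarrow> 'p \<Rightarrow> 'b \<Rightarrow> 'b) \<Rightarrow> bool" where
  "parallel_section B A G f J \<longleftrightarrow>
     (\<forall>c\<in>B. \<forall>d\<in>A.
        let \<phi> = local_rep f c d; \<Gamma> = levi_civita (G d)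
        in \<forall>x\<in>local_dom f c d. \<forall>u v.
             fder (\<lambda>y. J d (cinv c y) v) x u + \<Gamma> (\<phi> x) (fder \<phi> x u) (J d (cinv c x) v)
               - J d (cinv c x) (\<Gamma> (\<phi> x) (fder \<phi> x u) v) = 0)"

text \<open>An adapted basis over the open set \<open>V\<close> of the submanifold, where \<open>J\<close> is the local expression
  of the given section and \<open>Qx x\<close> the fibre of \<open>Q\<close> over the point \<open>x \<in> V\<close>. Such bases exist near every point.\<close>

definition adapted_basis_on :: "real \<Rightarrow> 'a::euclidean_space set \<Rightarrow>
    ('a \<Rightarrow> ('b::euclidean_space \<Rightarrow> 'b) set) \<Rightarrow> ('a \<Rightarrow> 'b \<Rightarrow> 'b) \<Rightarrow>
    ('a \<Rightarrow> 'b \<Rightarrow> 'b) \<Rightarrow> ('a \<Rightarrow> 'b \<Rightarrow> 'b) \<Rightarrow> ('a \<Rightarrow> 'b \<Rightarrow> 'b) \<Rightarrow> bool" where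
  "adapted_basis_on \<epsilon> V Qx J J1 J2 J3 \<longleftrightarrow>
     (\<forall>v. smooth_on V (\<lambda>x. J1 x v) \<and> smooth_on V (\<lambda>x. J2 x v) \<and> smooth_on V (\<lambda>x. J3 x v)) \<and>
     (\<forall>x\<in>V. J1 x = J x \<and> Qx x = endo_span3 (J1 x) (J2 x) (J3 x) \<and>
        (\<forall>v. J1 x (J1 x v) = \<epsilon> *\<^sub>R v \<and> J2 x (J2 x v) = v \<and>
             J3 x v = J1 x (J2 x v) \<and> J3 x v = - J2 x (J1 x v)))"

definition shape_tensor ::
    "('b::euclidean_space \<Rightarrow> 'b \<Rightarrow> 'b \<Rightarrow> real) \<Rightarrow> ('a::euclidean_space \<Rightarrow> 'b) \<Rightarrow> ('a \<Rightarrow> 'b \<Rightarrow> 'b) \<Rightarrow>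
     'a \<Rightarrow> 'a \<Rightarrow> 'a \<Rightarrow> 'a" where
  "shape_tensor gt \<phi> J2 x X Y =
     (THE w. fder \<phi> x w = J2 x (second_fundamental_form gt \<phi> x X Y))"

definition shape_bracket ::
    "('b::euclidean_space \<Rightarrow> 'b \<Rightarrow> 'b \<Rightarrow> real) \<Rightarrow> ('a::euclidean_space \<Rightarrow> 'b) \<Rightarrow> ('a \<Rightarrow> 'b \<Rightarrow> 'b) \<Rightarrow>
     'a \<Rightarrow> 'a \<Rightarrow> 'a \<Rightarrow> 'a \<Rightarrow> 'a" where
  "shape_bracket gt \<phi> J2 x X Y Z =
     (let C = shape_tensor gt \<phi> J2 x in C X (C Y Z) - C Y (C X Z))"

definition R_tan ::
    "('b::euclidean_space \<Rightarrow> 'b \<Rightarrow> 'b \<Rightarrow> real) \<Rightarrow> ('a::euclidean_space \<Rightarrow> 'b) \<Rightarrow>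
     'a \<Rightarrow> 'a \<Rightarrow> 'a \<Rightarrow> 'a \<Rightarrow> 'a" where
  "R_tan gt \<phi> x X Y Z =
     tan_part gt \<phi> x (riemann gt (\<phi> x) (fder \<phi> x X) (fder \<phi> x Y) (fder \<phi> x Z))"

end

theory Submission
  imports Defs
begin

text \<open>
  Everything is local, so let \<open>\<phi>\<close> be the expression of the immersion in charts, \<open>T\<close> the tangent
  space of the submanifold at a point, and \<open>J\<^sub>1, J\<^sub>2, J\<^sub>3\<close> an adapted basis. Fields along \<open>\<phi>\<close> are
  differentiated with the pulled-back ambient connection: \<open>DD\<close> for vector fields, \<open>DE\<close> for
  endomorphism fields. The derivative of a section of \<open>Q\<close> is a section of \<open>Q\<close>, and the
  curvature of \<open>DD\<close> is the ambient curvature \<open>R\<close>.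

  \<^bold>\<open>\<open>J\<^sub>1\<close> is parallel.\<close> That the Kaehler form is parallel says exactly that \<open>P = DE J\<^sub>1\<close>, a
  combination of \<open>J\<^sub>2\<close> and \<open>J\<^sub>3\<close>, maps \<open>T\<close> into its orthogonal complement. Suppose that \<open>P \<noteq> 0\<close> at some
  point, hence on a neighbourhood. There \<open>J\<^sub>2 T\<close> and \<open>J\<^sub>3 T\<close> are orthogonal to \<open>T\<close>: if \<open>P\<close> is not null, \<open>P\<close>
  and \<open>J\<^sub>1 P\<close> span the same plane as \<open>J\<^sub>2\<close> and \<open>J\<^sub>3\<close>; if it is null, the commutator \<open>[J\<^sub>1, R(X, Y)]\<close> is
  a multiple of \<open>P\<close> and preserves \<open>T\<close> by curvature invariance. So it vanishes on \<open>T\<close>, where \<open>P\<close>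
  does not, and the factor, which measures the failure of orthogonality, is zero
  (\<open>totally_complex_if_not_parallel\<close>). Differentiating the orthogonality yields a 1-form \<open>c\<close>, a
  component of \<open>P\<close>, whose product with the Kaehler form vanishes. In dimension at least 4
  this forces \<open>c = 0\<close>, so \<open>P = 0\<close> after all (\<open>J1_parallel\<close>). For surfaces parallelism is a hypothesis.

  \<^bold>\<open>The submanifold is totally complex.\<close> As \<open>J\<^sub>1\<close> is parallel, \<open>[J\<^sub>1, R(X, Y)] = 0\<close> for tangent
  vectors. On a para-quaternionic Kaehler manifold of dimension \<open>4n > 4\<close> this commutator is
  \<open>\<lambda> (g(X, J\<^sub>2 Y) J\<^sub>3 - g(X, J\<^sub>3 Y) J\<^sub>2)\<close> with \<open>\<lambda>\<close> a nonzero multiple of the scalar curvature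
  (\<open>riemann_commutator\<close>, from a purely algebraic argument about curvature tensors normalizing
  \<open>Q\<close>). Hence \<open>J\<^sub>2 T\<close> is orthogonal to \<open>T\<close>; for surfaces this is automatic (\<open>totally_complex\<close>).

  \<^bold>\<open>The bracket.\<close> Now \<open>h = J\<^sub>2 C\<close> with \<open>C\<close> symmetric and tangent. Differentiating \<open>J\<^sub>2 T \<bottom> T\<close> and
  \<open>J\<^sub>3 T \<bottom> T\<close> shows that each \<open>C\<^sub>X\<close> is self-adjoint and anticommutes with the complex structure, so
  \<open>[C\<^sub>X, C\<^sub>Y]\<close> is skew and commutes with it; the first Bianchi identity is the symmetry of \<open>C\<close>.
  Expanding the second derivatives of a tangent field and splitting \<open>R(X, Y) Z\<close> into its parts
  in \<open>T\<close> and \<open>J\<^sub>2 T\<close> gives the Gauss equation \<open>R\<^sup>T\<^sup>T = R + [C, C]\<close>, and, as the second part vanishes by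
  curvature invariance, the Codazzi equation
  \<open>(\<nabla>\<^sub>X C)\<^sub>Y - (\<nabla>\<^sub>Y C)\<^sub>X = d(X) \<J> C\<^sub>Y - d(Y) \<J> C\<^sub>X\<close>, where \<open>DE J\<^sub>2 = d J\<^sub>3\<close> (\<open>gauss_codazzi\<close>).
  In the cyclic sum of \<open>\<nabla>\<^sub>Z [C\<^sub>X, C\<^sub>Y]\<close> only these antisymmetrized derivatives occur, each in a
  commutator with \<open>C\<close>, and the resulting terms cancel because \<open>\<J>\<close> anticommutes with \<open>C\<close>.
\<close>

section \<open>Derivatives in several variables\<close>

lemma fder_unique: "(f has_derivative f') (at x) \<Longrightarrow> fder f x u = f' u"
  by (metis frechet_derivative_at)

lemma fder_works: "f differentiable (at x) \<Longrightarrow> (f has_derivative fder f x) (at x)"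
  by (simp add: frechet_derivative_works[symmetric])

lemma fder_cong:
  assumes "open U" "x \<in> U" "\<And>y. y \<in> U \<Longrightarrow> f y = g y"
  shows "fder f x u = fder g x u"
proof -
  have "(f has_derivative f') (at x) \<longleftrightarrow> (g has_derivative f') (at x)" for f'
    using has_derivative_transform_within_open assms by metis
  then show ?thesis by (simp add: frechet_derivative_def)
qed

lemma differentiable_cong_open:
  assumes "open U" "x \<in> U" "\<And>y. y \<in> U \<Longrightarrow> f y = g y" "g differentiable (at x)"
  shows "f differentiable (at x)"
proof -
  obtain D where "(g has_derivative D) (at x)" using assms(4) by (auto simp: differentiable_def)
  then have "(f has_derivative D) (at x)"
    by (rule has_derivative_transform_within_open[OF _ assms(1,2)]) (simp add: assms(3))
  then show ?thesis by (rule differentiableI)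
qed

lemma fder_linear: "f differentiable (at x) \<Longrightarrow> linear (fder f x)"
  by (rule linear_frechet_derivative)

lemma smooth_on_differentiable: "smooth_on S f \<Longrightarrow> x \<in> S \<Longrightarrow> f differentiable (at x)"
  unfolding smooth_on_def by (metis times_differentiable_on.simps(2))

lemma smooth_on_fder: "smooth_on S f \<Longrightarrow> smooth_on S (\<lambda>x. fder f x v)"
  unfolding smooth_on_def by (metis times_differentiable_on.simps(2))

lemma smooth_on_continuous: "smooth_on S f \<Longrightarrow> continuous_on S f"
  unfolding smooth_on_def by (metis times_differentiable_on.simps(1))

lemma times_differentiable_on_subset:
  "times_differentiable_on k S f \<Longrightarrow> T \<subseteq> S \<Longrightarrow> times_differentiable_on k T f"
proof (induction k arbitrary: f)
  case 0 then show ?case using continuous_on_subset by auto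
next
  case (Suc k) then show ?case by auto
qed

lemma smooth_on_subset: "smooth_on S f \<Longrightarrow> T \<subseteq> S \<Longrightarrow> smooth_on T f"
  unfolding smooth_on_def using times_differentiable_on_subset by blast

lemma times_differentiable_on_linear:
  "bounded_linear f \<Longrightarrow> times_differentiable_on k S f"
proof (induction k)
  case 0 then show ?case by (simp add: linear_continuous_on)
next
  case (Suc k)
  have d: "(f has_derivative f) (at x)" for x
    using Suc.prems by (rule bounded_linear_imp_has_derivative)
  have c: "times_differentiable_on k S (\<lambda>x. c)" for c :: 'b
    by (induction k arbitrary: c) auto
  show ?case
    using d c by (auto simp: fder_unique[OF d] differentiable_def)
qed

lemma smooth_on_ident: "smooth_on S (\<lambda>x. x)"
  unfolding smooth_on_def using times_differentiable_on_linear bounded_linear_ident by blast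

lemma smooth_on_const: "smooth_on S (\<lambda>x. c)"
proof -
  have "times_differentiable_on k S (\<lambda>x. c)" for k
    by (induction k arbitrary: c) auto
  then show ?thesis by (simp add: smooth_on_def)
qed

lemma fder_add:
  "f differentiable (at x) \<Longrightarrow> g differentiable (at x) \<Longrightarrow>
    fder (\<lambda>y. f y + g y) x u = fder f x u + fder g x u"
  by (rule fder_unique) (intro has_derivative_add fder_works)

lemma fder_compose:
  "g differentiable (at x) \<Longrightarrow> f differentiable (at (g x)) \<Longrightarrow>
    fder (\<lambda>y. f (g y)) x u = fder f (g x) (fder g x u)"
  by (rule fder_unique) (rule has_derivative_compose[OF fder_works fder_works])

lemma fder_scaleR:
  fixes a :: "'a::euclidean_space \<Rightarrow> real"
  shows "a differentiable (at x) \<Longrightarrow> s differentiable (at x) \<Longrightarrow>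
    fder (\<lambda>y. a y *\<^sub>R s y) x u = a x *\<^sub>R fder s x u + fder a x u *\<^sub>R s x"
  by (rule fder_unique) (intro has_derivative_scaleR fder_works)

lemma fder_inner_left:
  "f differentiable (at x) \<Longrightarrow> fder (\<lambda>y. f y \<bullet> b) x u = fder f x u \<bullet> b"
  by (rule fder_unique) (intro has_derivative_inner_left fder_works)

lemma differentiable_inner_left:
  "f differentiable (at x) \<Longrightarrow> (\<lambda>y. f y \<bullet> b) differentiable (at x)"
  unfolding differentiable_def using has_derivative_inner_left by blast

lemma differentiable_compose_at:
  "g differentiable (at x) \<Longrightarrow> f differentiable (at (g x)) \<Longrightarrow> (\<lambda>y. f (g y)) differentiable (at x)"
  unfolding differentiable_def using has_derivative_compose by blast

text \<open>The mean value theorem, applied once in direction \<open>u\<close> and once in direction \<open>v\<close>, turns the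
  second difference over a parallelogram into a mixed second derivative at some point of it.\<close>

lemma second_difference:
  fixes f :: "'a::euclidean_space \<Rightarrow> real"
  assumes h: "0 < h"
    and d1: "\<And>s t. 0 \<le> s \<Longrightarrow> s \<le> h \<Longrightarrow> 0 \<le> t \<Longrightarrow> t \<le> h \<Longrightarrow> f differentiable (at (x + s *\<^sub>R u + t *\<^sub>R v))"
    and d2: "\<And>s t. 0 \<le> s \<Longrightarrow> s \<le> h \<Longrightarrow> 0 \<le> t \<Longrightarrow> t \<le> h \<Longrightarrow>
      (\<lambda>y. fder f y u) differentiable (at (x + s *\<^sub>R u + t *\<^sub>R v))"
  obtains s t where "0 \<le> s" "s \<le> h" "0 \<le> t" "t \<le> h"
    "f (x + h *\<^sub>R u + h *\<^sub>R v) - f (x + h *\<^sub>R u) - f (x + h *\<^sub>R v) + f x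
      = h * (h * fder (\<lambda>y. fder f y u) (x + s *\<^sub>R u + t *\<^sub>R v) v)"
proof -
  define g where "g s = f (x + s *\<^sub>R u + h *\<^sub>R v) - f (x + s *\<^sub>R u + 0 *\<^sub>R v)" for s
  have line_u: "((\<lambda>s. f (x + s *\<^sub>R u + t *\<^sub>R v)) has_real_derivative fder f (x + s *\<^sub>R u + t *\<^sub>R v) u) (at s)"
    if "0 \<le> s" "s \<le> h" "0 \<le> t" "t \<le> h" for s t
  proof -
    have "((\<lambda>s. x + s *\<^sub>R u + t *\<^sub>R v) has_derivative (\<lambda>r. r *\<^sub>R u)) (at s)"
      by (auto intro!: derivative_eq_intros)
    from has_derivative_compose[OF this fder_works[OF d1[OF that]]]
    have "((\<lambda>s. f (x + s *\<^sub>R u + t *\<^sub>R v)) has_derivative (\<lambda>r. fder f (x + s *\<^sub>R u + t *\<^sub>R v) (r *\<^sub>R u))) (at s)" .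
    moreover have "(\<lambda>r. fder f (x + s *\<^sub>R u + t *\<^sub>R v) (r *\<^sub>R u)) = (*) (fder f (x + s *\<^sub>R u + t *\<^sub>R v) u)"
      using linear_scale[OF fder_linear[OF d1[OF that]]] by auto
    ultimately show ?thesis by (simp add: has_field_derivative_def)
  qed
  have line_v: "((\<lambda>t. fder f (x + s *\<^sub>R u + t *\<^sub>R v) u) has_real_derivative
      fder (\<lambda>y. fder f y u) (x + s *\<^sub>R u + t *\<^sub>R v) v) (at t)"
    if "0 \<le> s" "s \<le> h" "0 \<le> t" "t \<le> h" for s t
  proof -
    have "((\<lambda>t. x + s *\<^sub>R u + t *\<^sub>R v) has_derivative (\<lambda>r. r *\<^sub>R v)) (at t)"
      by (auto intro!: derivative_eq_intros)
    from has_derivative_compose[OF this fder_works[OF d2[OF that]]]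
    have "((\<lambda>t. fder f (x + s *\<^sub>R u + t *\<^sub>R v) u) has_derivative
        (\<lambda>r. fder (\<lambda>y. fder f y u) (x + s *\<^sub>R u + t *\<^sub>R v) (r *\<^sub>R v))) (at t)" .
    moreover have "(\<lambda>r. fder (\<lambda>y. fder f y u) (x + s *\<^sub>R u + t *\<^sub>R v) (r *\<^sub>R v))
        = (*) (fder (\<lambda>y. fder f y u) (x + s *\<^sub>R u + t *\<^sub>R v) v)"
      using linear_scale[OF fder_linear[OF d2[OF that]]] by auto
    ultimately show ?thesis by (simp add: has_field_derivative_def)
  qed
  have "\<exists>s. 0 < s \<and> s < h \<and> g h - g 0 = (h - 0) *
      (fder f (x + s *\<^sub>R u + h *\<^sub>R v) u - fder f (x + s *\<^sub>R u + 0 *\<^sub>R v) u)"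
    unfolding g_def using h by (intro MVT2) (auto intro!: DERIV_diff line_u[of _ h] line_u[of _ 0, simplified])
  then obtain s where s: "0 < s" "s < h" and gs: "g h - g 0 = h *
      (fder f (x + s *\<^sub>R u + h *\<^sub>R v) u - fder f (x + s *\<^sub>R u + 0 *\<^sub>R v) u)" by auto
  have "\<exists>t. 0 < t \<and> t < h \<and> fder f (x + s *\<^sub>R u + h *\<^sub>R v) u - fder f (x + s *\<^sub>R u + 0 *\<^sub>R v) u
      = (h - 0) * fder (\<lambda>y. fder f y u) (x + s *\<^sub>R u + t *\<^sub>R v) v"
    using h s by (intro MVT2) (auto intro!: line_v)
  then obtain t where t: "0 < t" "t < h" and ft: "fder f (x + s *\<^sub>R u + h *\<^sub>R v) u - fder f (x + s *\<^sub>R u + 0 *\<^sub>R v) u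
      = h * fder (\<lambda>y. fder f y u) (x + s *\<^sub>R u + t *\<^sub>R v) v" by auto
  show ?thesis
    using that[of s t] s t gs unfolding ft by (simp add: g_def)
qed

text \<open>The second difference is symmetric in the two directions; shrinking the parallelogram and using
  continuity identifies the two mixed derivatives (Schwarz).\<close>

lemma symmetric_second_derivative_real:
  fixes f :: "'a::euclidean_space \<Rightarrow> real"
  assumes S: "open S" "x \<in> S" and f: "smooth_on S f"
  shows "fder (\<lambda>y. fder f y u) x v = fder (\<lambda>y. fder f y v) x u"
proof -
  define p where "p = (\<lambda>y. fder (\<lambda>y. fder f y u) y v)"
  define q where "q = (\<lambda>y. fder (\<lambda>y. fder f y v) y u)"
  have cont: "isCont p x" "isCont q x"
    using smooth_on_continuous[OF smooth_on_fder[OF smooth_on_fder[OF f]]] S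
    by (auto simp: p_def q_def continuous_on_eq_continuous_at)
  have "\<bar>p x - q x\<bar> \<le> e" if e: "0 < e" for e
  proof -
    obtain d1 where d1: "0 < d1" "\<And>y. dist y x < d1 \<Longrightarrow> dist (p y) (p x) < e/2"
      using cont(1) e unfolding continuous_at_eps_delta by (meson half_gt_zero)
    obtain d2 where d2: "0 < d2" "\<And>y. dist y x < d2 \<Longrightarrow> dist (q y) (q x) < e/2"
      using cont(2) e unfolding continuous_at_eps_delta by (meson half_gt_zero)
    obtain d3 where d3: "0 < d3" "ball x d3 \<subseteq> S"
      using S by (meson open_contains_ball)
    define d where "d = min d1 (min d2 d3)"
    have d: "0 < d" using d1 d2 d3 by (simp add: d_def)
    \<comment> \<open>The side length is chosen so that the parallelogram stays within distance \<open>d\<close> of \<open>x\<close>.\<close>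
    define h where "h = d / (norm u + norm v + 1)"
    have np: "norm u + norm v + 1 > 0" by (smt (verit) norm_ge_zero)
    have h: "0 < h" using d np by (simp add: h_def)
    have near: "dist (x + s *\<^sub>R u + t *\<^sub>R v) x < d" if "0 \<le> s" "s \<le> h" "0 \<le> t" "t \<le> h" for s t
    proof -
      have "dist (x + s *\<^sub>R u + t *\<^sub>R v) x = norm (s *\<^sub>R u + t *\<^sub>R v)" by (simp add: dist_norm)
      also have "\<dots> \<le> s * norm u + t * norm v"
        using that norm_triangle_ineq[of "s *\<^sub>R u" "t *\<^sub>R v"] by simp
      also have "\<dots> \<le> h * norm u + h * norm v" using that by (intro add_mono mult_right_mono) auto
      also have "\<dots> < h * (norm u + norm v + 1)" using h by (simp add: algebra_simps)
      also have "\<dots> = d" using np by (simp add: h_def)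
      finally show ?thesis .
    qed
    have inS: "y \<in> S" if "dist y x < d" for y
      using that d3 by (auto simp: d_def dist_commute)
    have df: "f differentiable (at y)" "(\<lambda>y. fder f y w) differentiable (at y)" if "dist y x < d" for y w
      using smooth_on_differentiable[OF f inS[OF that]] smooth_on_differentiable[OF smooth_on_fder[OF f] inS[OF that]] by auto
    obtain s t where st: "0 \<le> s" "s \<le> h" "0 \<le> t" "t \<le> h" and
      1: "f (x + h *\<^sub>R u + h *\<^sub>R v) - f (x + h *\<^sub>R u) - f (x + h *\<^sub>R v) + f x = h * (h * p (x + s *\<^sub>R u + t *\<^sub>R v))"
      unfolding p_def by (rule second_difference[of h f x u v, OF h df(1)[OF near] df(2)[OF near]])
    have near': "dist (x + s *\<^sub>R v + t *\<^sub>R u) x < d" if "0 \<le> s" "s \<le> h" "0 \<le> t" "t \<le> h" for s t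
      using near[OF that(3,4,1,2)] by (simp add: algebra_simps)
    obtain s' t' where st': "0 \<le> s'" "s' \<le> h" "0 \<le> t'" "t' \<le> h" and
      2: "f (x + h *\<^sub>R v + h *\<^sub>R u) - f (x + h *\<^sub>R v) - f (x + h *\<^sub>R u) + f x = h * (h * q (x + s' *\<^sub>R v + t' *\<^sub>R u))"
      unfolding q_def by (rule second_difference[of h f x v u, OF h df(1)[OF near'] df(2)[OF near']])
    have "x + h *\<^sub>R v + h *\<^sub>R u = x + h *\<^sub>R u + h *\<^sub>R v" by simp
    with 1 2 have "h * (h * p (x + s *\<^sub>R u + t *\<^sub>R v)) = h * (h * q (x + s' *\<^sub>R v + t' *\<^sub>R u))"
      by (smt (verit))
    then have eq: "p (x + s *\<^sub>R u + t *\<^sub>R v) = q (x + s' *\<^sub>R v + t' *\<^sub>R u)" using h by simp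
    have "dist (p (x + s *\<^sub>R u + t *\<^sub>R v)) (p x) < e/2"
      using d1(2) near[OF st] by (simp add: d_def)
    moreover have "dist (q (x + s' *\<^sub>R v + t' *\<^sub>R u)) (q x) < e/2"
      using d2(2) near'[OF st'] by (simp add: d_def)
    ultimately show ?thesis unfolding eq dist_real_def by linarith
  qed
  then have "\<bar>p x - q x\<bar> \<le> 0" by (rule field_le_epsilon[of _ 0, simplified])
  then show ?thesis by (simp add: p_def q_def)
qed

lemma times_differentiable_on_inner:
  fixes f :: "'a::euclidean_space \<Rightarrow> 'b::euclidean_space"
  shows "open S \<Longrightarrow> times_differentiable_on k S f \<Longrightarrow> times_differentiable_on k S (\<lambda>x. f x \<bullet> b)"
proof (induction k arbitrary: f)
  case 0 then show ?case by (auto intro: continuous_intros)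
next
  case (Suc k)
  have cong: "times_differentiable_on k S g" if "times_differentiable_on k S f" "\<And>x. x \<in> S \<Longrightarrow> f x = g x"
    for k and f g :: "'a \<Rightarrow> real"
    using that
  proof (induction k arbitrary: f g)
    case 0 then show ?case by (simp cong: continuous_on_cong)
  next
    case (Suc k)
    have "g differentiable at x" if "x \<in> S" for x
      using Suc.prems differentiable_cong_open[OF \<open>open S\<close> that, of g f] that by auto
    moreover have "times_differentiable_on k S (\<lambda>x. fder g x v)" for v
      using Suc.IH[of "\<lambda>x. fder f x v"] Suc.prems fder_cong[OF \<open>open S\<close>, of _ f g] by auto
    ultimately show ?case by simp
  qed
  have "times_differentiable_on k S (\<lambda>x. fder (\<lambda>x. f x \<bullet> b) x v)" for v
    by (rule cong[of k "\<lambda>x. fder f x v \<bullet> b"]) (use Suc in \<open>auto simp: fder_inner_left\<close>)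
  with Suc show ?case by (auto intro: differentiable_inner_left)
qed

lemma symmetric_second_derivative:
  fixes f :: "'a::euclidean_space \<Rightarrow> 'b::euclidean_space"
  assumes S: "open S" "x \<in> S" and f: "smooth_on S f"
  shows "fder (\<lambda>y. fder f y u) x v = fder (\<lambda>y. fder f y v) x u"
proof (rule euclidean_eqI)
  fix b :: 'b assume "b \<in> Basis"
  have "fder (\<lambda>y. fder f y u) x v \<bullet> b = fder (\<lambda>y. fder (\<lambda>y. f y \<bullet> b) y u) x v" for u v
  proof -
    have "fder (\<lambda>y. fder (\<lambda>y. f y \<bullet> b) y u) x v = fder (\<lambda>y. fder f y u \<bullet> b) x v"
      by (rule fder_cong[OF S]) (simp add: fder_inner_left smooth_on_differentiable[OF f])
    then show ?thesis
      by (simp add: fder_inner_left smooth_on_differentiable[OF smooth_on_fder[OF f] S(2)])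
  qed
  moreover have "smooth_on S (\<lambda>y. f y \<bullet> b)"
    using f S times_differentiable_on_inner unfolding smooth_on_def by blast
  ultimately show "fder (\<lambda>y. fder f y u) x v \<bullet> b = fder (\<lambda>y. fder f y v) x u \<bullet> b"
    using symmetric_second_derivative_real[OF S] by simp
qed

lemma differentiable_scaleR_at:
  fixes a :: "'a::real_normed_vector \<Rightarrow> real"
  shows "a differentiable (at x) \<Longrightarrow> s differentiable (at x) \<Longrightarrow> (\<lambda>y. a y *\<^sub>R s y) differentiable (at x)"
  unfolding differentiable_def using has_derivative_scaleR by blast

lemma linear_basis_expansion:
  fixes L :: "'a::euclidean_space \<Rightarrow> 'b::real_vector"
  assumes "linear L" shows "L u = (\<Sum>i\<in>Basis. (u \<bullet> i) *\<^sub>R L i)"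
  using linear_sum[OF assms, of "\<lambda>i. (u \<bullet> i) *\<^sub>R i" Basis] linear_scale[OF assms]
  by (simp add: euclidean_representation)

text \<open>The product rule for a field of linear maps applied to a vector field. Expanding the argument in
  the standard basis reduces it to the product rule for scalar multiples.\<close>

lemma has_derivative_linear_family:
  fixes A :: "'p::euclidean_space \<Rightarrow> 'a::euclidean_space \<Rightarrow> 'b::real_normed_vector"
  assumes U: "open U" "x \<in> U" and lin: "\<And>y. y \<in> U \<Longrightarrow> linear (A y)"
    and dA: "\<And>a. (\<lambda>y. A y a) differentiable (at x)" and du: "u differentiable (at x)"
  shows "((\<lambda>y. A y (u y)) has_derivative (\<lambda>w. fder (\<lambda>y. A y (u x)) x w + A x (fder u x w))) (at x)"
proof -
  have "((\<lambda>y. \<Sum>i\<in>Basis. (u y \<bullet> i) *\<^sub>R A y i) has_derivative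
      (\<lambda>w. \<Sum>i\<in>Basis. (u x \<bullet> i) *\<^sub>R fder (\<lambda>y. A y i) x w + (fder u x w \<bullet> i) *\<^sub>R A x i)) (at x)"
    by (intro has_derivative_sum has_derivative_scaleR has_derivative_inner_left fder_works dA du)
  then have 1: "((\<lambda>y. A y (u y)) has_derivative
      (\<lambda>w. \<Sum>i\<in>Basis. (u x \<bullet> i) *\<^sub>R fder (\<lambda>y. A y i) x w + (fder u x w \<bullet> i) *\<^sub>R A x i)) (at x)"
    by (rule has_derivative_transform_within_open[OF _ U]) (simp add: linear_basis_expansion[OF lin, symmetric])
  have "((\<lambda>y. \<Sum>i\<in>Basis. (u x \<bullet> i) *\<^sub>R A y i) has_derivative
      (\<lambda>w. \<Sum>i\<in>Basis. (u x \<bullet> i) *\<^sub>R fder (\<lambda>y. A y i) x w)) (at x)"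
    by (intro has_derivative_sum has_derivative_scaleR_right fder_works dA)
  then have 2: "((\<lambda>y. A y (u x)) has_derivative
      (\<lambda>w. \<Sum>i\<in>Basis. (u x \<bullet> i) *\<^sub>R fder (\<lambda>y. A y i) x w)) (at x)"
    by (rule has_derivative_transform_within_open[OF _ U]) (simp add: linear_basis_expansion[OF lin, symmetric])
  show ?thesis using 1
    by (simp add: fder_unique[OF 2] sum.distrib linear_basis_expansion[OF lin[OF U(2)], symmetric])
qed

lemma has_derivative_bilinear_family:
  fixes B :: "'p::euclidean_space \<Rightarrow> 'a::euclidean_space \<Rightarrow> 'c::euclidean_space \<Rightarrow> 'b::real_normed_vector"
  assumes U: "open U" "x \<in> U" and bil: "\<And>y. y \<in> U \<Longrightarrow> bilinear (B y)"
    and dB: "\<And>a b. (\<lambda>y. B y a b) differentiable (at x)"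
    and du: "u differentiable (at x)" and dv: "v differentiable (at x)"
  shows "((\<lambda>y. B y (u y) (v y)) has_derivative
     (\<lambda>w. fder (\<lambda>y. B y (u x) (v x)) x w + B x (fder u x w) (v x) + B x (u x) (fder v x w))) (at x)"
proof -
  have lin: "linear (\<lambda>a. B y a b)" "linear (B y a)" if "y \<in> U" for y a b
    using bil[OF that] by (auto simp: bilinear_def)
  have d1: "((\<lambda>y. B y (u y) b) has_derivative (\<lambda>w. fder (\<lambda>y. B y (u x) b) x w + B x (fder u x w) b)) (at x)" for b
    by (rule has_derivative_linear_family[OF U, of "\<lambda>y a. B y a b"]) (auto intro: lin dB du)
  have "((\<lambda>y. B y (u y) (v y)) has_derivative
      (\<lambda>w. fder (\<lambda>y. B y (u y) (v x)) x w + B x (u x) (fder v x w))) (at x)"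
    by (rule has_derivative_linear_family[OF U, of "\<lambda>y. B y (u y)"])
       (auto intro: lin dv differentiableI[OF d1])
  then show ?thesis by (simp add: fder_unique[OF d1])
qed

lemmas fder_linear_family = fder_unique[OF has_derivative_linear_family]
lemmas fder_bilinear_family = fder_unique[OF has_derivative_bilinear_family]

lemma differentiable_linear_family:
  fixes A :: "'p::euclidean_space \<Rightarrow> 'a::euclidean_space \<Rightarrow> 'b::real_normed_vector"
  assumes "open U" "x \<in> U" "\<And>y. y \<in> U \<Longrightarrow> linear (A y)"
    "\<And>a. (\<lambda>y. A y a) differentiable (at x)" "u differentiable (at x)"
  shows "(\<lambda>y. A y (u y)) differentiable (at x)"
  using has_derivative_linear_family[OF assms] by (rule differentiableI)

lemma differentiable_bilinear_family:
  fixes B :: "'p::euclidean_space \<Rightarrow> 'a::euclidean_space \<Rightarrow> 'c::euclidean_space \<Rightarrow> 'b::real_normed_vector"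
  assumes "open U" "x \<in> U" "\<And>y. y \<in> U \<Longrightarrow> bilinear (B y)"
    "\<And>a b. (\<lambda>y. B y a b) differentiable (at x)" "u differentiable (at x)" "v differentiable (at x)"
  shows "(\<lambda>y. B y (u y) (v y)) differentiable (at x)"
  using has_derivative_bilinear_family[OF assms] by (rule differentiableI)

lemma nondegenerate_representation:
  fixes b :: "'a::euclidean_space \<Rightarrow> 'a \<Rightarrow> real"
  assumes b: "bilinear b" "nondegenerate b" and l: "linear l"
  shows "\<exists>!w. \<forall>v. b w v = l v"
proof -
  define T where "T w = (\<Sum>i\<in>Basis. b w i *\<^sub>R i)" for w
  have linb: "linear (\<lambda>w. b w v)" "linear (b w)" for v w
    using b(1) by (auto simp: bilinear_def)
  have Tv: "T w \<bullet> v = b w v" for w v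
  proof -
    have "T w \<bullet> v = (\<Sum>i\<in>Basis. (v \<bullet> i) *\<^sub>R b w i)"
      by (simp add: T_def inner_sum_left inner_commute[of v] mult.commute)
    then show ?thesis using linear_basis_expansion[OF linb(2), of w v] by simp
  qed
  have linT: "linear T"
    unfolding T_def
    by (auto intro!: linearI simp: linear_add[OF linb(1)] linear_scale[OF linb(1)] sum.distrib algebra_simps scaleR_sum_right)
  have injT: "inj T"
    unfolding linear_injective_0[OF linT]
    using b(2) Tv unfolding nondegenerate_def by (metis inner_zero_left)
  have "surj T" using linear_injective_imp_surjective[OF linT injT refl] .
  define r where "r = (\<Sum>i\<in>Basis. l i *\<^sub>R i)"
  have rv: "r \<bullet> v = l v" for v
    using linear_basis_expansion[OF l, of v] by (simp add: r_def inner_sum_left inner_commute[of v] mult.commute)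
  obtain w where "T w = r" using \<open>surj T\<close> by (metis surj_def)
  then have "\<forall>v. b w v = l v" using Tv rv by metis
  moreover have "w = w'" if "\<forall>v. b w v = l v" "\<forall>v. b w' v = l v" for w w'
    using that Tv injT by (metis injD vector_eq_rdot)
  ultimately show ?thesis by blast
qed

text \<open>Where \<open>k\<close> vanishes, the product with \<open>f\<close> is differentiable even if \<open>f\<close> is merely continuous: the
  increment \<open>(f y - f x) k y\<close> is of lower order.\<close>

lemma differentiable_times_vanishing:
  fixes f :: "'p::euclidean_space \<Rightarrow> real" and k :: "'p \<Rightarrow> 'b::real_normed_vector"
  assumes f: "isCont f x" and k: "k differentiable (at x)" and k0: "k x = 0"
  shows "(\<lambda>y. f y *\<^sub>R k y) differentiable (at x)"
proof -
  have D: "(k has_derivative fder k x) (at x)" by (rule fder_works[OF k])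
  have "((\<lambda>y. f y *\<^sub>R k y) has_derivative (\<lambda>w. f x *\<^sub>R fder k x w)) (at x)"
    unfolding has_derivative_at_within
  proof (intro conjI)
    show "bounded_linear (\<lambda>w. f x *\<^sub>R fder k x w)"
      using has_derivative_bounded_linear[OF has_derivative_scaleR_right[OF D]] .
    obtain C where C: "\<And>w. norm (fder k x w) \<le> norm w * C" "C \<ge> 0"
      using bounded_linear.nonneg_bounded[OF has_derivative_bounded_linear[OF D]] by blast
    have rem: "((\<lambda>y. (1 / norm (y - x)) *\<^sub>R (k y - (k x + fder k x (y - x)))) \<longlongrightarrow> 0) (at x)"
      using D unfolding has_derivative_at_within by (simp add: diff_diff_eq divide_inverse)
    have fl: "(f \<longlongrightarrow> f x) (at x)" using f by (simp add: isCont_def)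
    have t1: "((\<lambda>y. f y *\<^sub>R ((1 / norm (y - x)) *\<^sub>R (k y - (k x + fder k x (y - x))))) \<longlongrightarrow> 0) (at x)"
      using tendsto_scaleR[OF fl rem] by simp
    have t2: "((\<lambda>y. (f y - f x) *\<^sub>R ((1 / norm (y - x)) *\<^sub>R fder k x (y - x))) \<longlongrightarrow> 0) (at x)"
    proof (rule Lim_null_comparison)
      have "((\<lambda>y. \<bar>f y - f x\<bar> * C) \<longlongrightarrow> \<bar>f x - f x\<bar> * C) (at x)"
        by (intro tendsto_intros fl)
      then show "((\<lambda>y. \<bar>f y - f x\<bar> * C) \<longlongrightarrow> 0) (at x)" by simp
      have "norm ((1 / norm (y - x)) *\<^sub>R fder k x (y - x)) \<le> C" if "y \<noteq> x" for y
        using C(1)[of "y - x"] that by (simp add: field_simps)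
      then show "\<forall>\<^sub>F y in at x. norm ((f y - f x) *\<^sub>R ((1 / norm (y - x)) *\<^sub>R fder k x (y - x))) \<le> \<bar>f y - f x\<bar> * C"
        unfolding norm_scaleR[of "f _ - f x"] real_norm_def
        by (intro eventually_at_filter[THEN iffD2] always_eventually allI impI mult_left_mono) auto
    qed
    have eq: "f y *\<^sub>R (c *\<^sub>R (k y - (k x + D))) + (f y - f x) *\<^sub>R (c *\<^sub>R D)
        = c *\<^sub>R (f y *\<^sub>R k y - (f x *\<^sub>R k x + f x *\<^sub>R D))" for y c D
      by (simp add: k0 algebra_simps)
    show "((\<lambda>y. (f y *\<^sub>R k y - f x *\<^sub>R k x - f x *\<^sub>R fder k x (y - x)) /\<^sub>R norm (y - x)) \<longlongrightarrow> 0) (at x)"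
      using tendsto_add[OF t1 t2] unfolding eq by (simp add: diff_diff_eq divide_inverse)
  qed
  then show ?thesis by (rule differentiableI)
qed

text \<open>The solution of a nondegenerate linear system depends differentiably on the point. This makes
  the Levi-Civita connection and the shape tensor, which are defined by such systems,
  differentiable. Multiplying by the inverse of \<open>b x\<close> gives \<open>w = m + E w\<close> with \<open>m\<close>, \<open>E\<close> differentiable and
  \<open>E\<close> vanishing at \<open>x\<close>. A contraction estimate makes \<open>w\<close> continuous at \<open>x\<close>, and then the product \<open>E w\<close> is
  differentiable.\<close>

lemma differentiable_solution:
  fixes b :: "'p::euclidean_space \<Rightarrow> 'a::euclidean_space \<Rightarrow> 'a \<Rightarrow> real"
  assumes U: "open U" "x \<in> U" and bil: "\<And>y. y \<in> U \<Longrightarrow> bilinear (b y)" and nd: "nondegenerate (b x)"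
    and db: "\<And>u v. (\<lambda>y. b y u v) differentiable (at x)"
    and dl: "\<And>v. (\<lambda>y. l y v) differentiable (at x)"
    and sol: "\<And>y v. y \<in> U \<Longrightarrow> b y (w y) v = l y v"
  shows "w differentiable (at x)"
proof -
  have "\<exists>w. \<forall>v. b x w v = j \<bullet> v" for j
    using nondegenerate_representation[OF bil[OF U(2)] nd, of "\<lambda>v. j \<bullet> v"]
      bounded_linear.linear[OF bounded_linear_inner_right] by blast
  then obtain S where S: "\<And>j v. b x (S j) v = j \<bullet> v" by metis
  define Inv where "Inv c = (\<Sum>j\<in>Basis. c j *\<^sub>R S j)" for c :: "'a \<Rightarrow> real"
  have linb: "linear (\<lambda>w. b y w v)" "linear (b y w)" if "y \<in> U" for v w y
    using bil[OF that] by (auto simp: bilinear_def)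
  have bInv: "b x (Inv c) v = (\<Sum>j\<in>Basis. c j * (j \<bullet> v))" for c v
    unfolding Inv_def by (simp add: linear_sum[OF linb(1)[OF U(2)]] linear_scale[OF linb(1)[OF U(2)]] S)
  have Inv_b: "Inv (b x u) = u" for u
  proof -
    have "b x (Inv (b x u) - u) v = 0" for v
    proof -
      have "b x (Inv (b x u)) v = (\<Sum>j\<in>Basis. (v \<bullet> j) *\<^sub>R b x u j)" by (simp add: bInv inner_commute mult.commute)
      then show ?thesis using linear_basis_expansion[OF linb(2)[OF U(2)], of u v]
        by (simp add: linear_diff[OF linb(1)[OF U(2)]])
    qed
    then show ?thesis using nd unfolding nondegenerate_def by (metis eq_iff_diff_eq_0)
  qed
  define m where "m y = Inv (l y)" for y
  define E where "E y i = i - Inv (b y i)" for y i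
  have dm: "m differentiable (at x)"
    unfolding m_def Inv_def by (intro differentiable_sum ballI differentiable_scaleR_at dl) auto
  have dE: "(\<lambda>y. E y i) differentiable (at x)" for i
    unfolding E_def Inv_def by (intro differentiable_diff differentiable_sum ballI differentiable_scaleR_at db) auto
  have E0: "E x i = 0" for i by (simp add: E_def Inv_b)
  have weq: "w y = m y + (\<Sum>i\<in>Basis. (w y \<bullet> i) *\<^sub>R E y i)" if y: "y \<in> U" for y
  proof -
    have "(\<Sum>i\<in>Basis. (w y \<bullet> i) *\<^sub>R Inv (b y i)) = Inv (b y (w y))"
    proof -
      have "(\<Sum>i\<in>Basis. (w y \<bullet> i) *\<^sub>R Inv (b y i)) = (\<Sum>j\<in>Basis. (\<Sum>i\<in>Basis. (w y \<bullet> i) * b y i j) *\<^sub>R S j)"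
        unfolding Inv_def scaleR_sum_right scaleR_sum_left by (subst sum.swap) simp
      also have "\<dots> = Inv (b y (w y))"
        unfolding Inv_def by (rule sum.cong) (use linear_basis_expansion[OF linb(1)[OF y], of "w y"] in auto)
      finally show ?thesis .
    qed
    also have "b y (w y) = l y" using sol[OF y] by blast
    finally show ?thesis
      by (simp add: E_def scaleR_diff_right sum_subtractf euclidean_representation m_def)
  qed
  have wx: "w x = m x" using weq[OF U(2)] E0 by simp
  have contw: "isCont w x"
  proof -
    define k where "k y = (\<Sum>i\<in>Basis. norm (E y i))" for y
    have cE: "isCont (\<lambda>y. E y i) x" for i using dE differentiable_imp_continuous_within by blast
    have cm: "isCont m x" using dm differentiable_imp_continuous_within by blast
    have kt: "(k \<longlongrightarrow> 0) (at x)"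
    proof -
      have "(k \<longlongrightarrow> (\<Sum>i\<in>Basis. norm (E x i))) (at x)"
        unfolding k_def using cE by (intro tendsto_sum tendsto_norm) (simp add: isCont_def)
      then show ?thesis by (simp add: E0)
    qed
    have bound: "norm (w y - m y) \<le> k y * norm (w y)" if "y \<in> U" for y
    proof -
      have "norm (w y - m y) = norm (\<Sum>i\<in>Basis. (w y \<bullet> i) *\<^sub>R E y i)" using weq[OF that] by (metis add_diff_cancel_left')
      also have "\<dots> \<le> (\<Sum>i\<in>Basis. norm ((w y \<bullet> i) *\<^sub>R E y i))" by (rule norm_sum)
      also have "\<dots> \<le> (\<Sum>i\<in>Basis. norm (w y) * norm (E y i))"
        by (intro sum_mono) (auto intro!: mult_right_mono Basis_le_norm)
      finally show ?thesis by (simp add: k_def sum_distrib_left mult.commute)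
    qed
    have inU: "\<forall>\<^sub>F y in at x. y \<in> U" using U by (simp add: eventually_at_in_open')
    have khalf: "\<forall>\<^sub>F y in at x. k y < 1/2" using kt by (rule order_tendstoD) simp
    have k0: "k y \<ge> 0" for y by (simp add: k_def sum_nonneg)
    have "((\<lambda>y. w y - m y) \<longlongrightarrow> 0) (at x)"
    proof (rule Lim_null_comparison)
      show "\<forall>\<^sub>F y in at x. norm (w y - m y) \<le> k y * (2 * norm (m y))"
        using inU khalf
      proof eventually_elim
        case (elim y)
        have "norm (w y) \<le> norm (m y) + norm (w y - m y)" by (metis norm_triangle_sub)
        also have "\<dots> \<le> norm (m y) + 1/2 * norm (w y)"
          using bound[OF elim(1)] mult_right_mono[OF less_imp_le[OF elim(2)] norm_ge_zero[of "w y"]] by linarith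
        finally have "norm (w y) \<le> 2 * norm (m y)" by simp
        then show ?case using bound[OF elim(1)] mult_left_mono[OF _ k0[of y]] by (meson order_trans)
      qed
      have "((\<lambda>y. k y * (2 * norm (m y))) \<longlongrightarrow> 0 * (2 * norm (m x))) (at x)"
        using cm by (intro tendsto_intros kt) (simp add: isCont_def)
      then show "((\<lambda>y. k y * (2 * norm (m y))) \<longlongrightarrow> 0) (at x)" by simp
    qed
    from tendsto_add[OF this, of m "m x"] show ?thesis using cm wx by (simp add: isCont_def)
  qed
  have "(\<lambda>y. m y + (\<Sum>i\<in>Basis. (w y \<bullet> i) *\<^sub>R E y i)) differentiable (at x)"
    by (intro differentiable_add dm differentiable_sum ballI finite_Basis differentiable_times_vanishing
        dE E0 continuous_intros contw)
  then show ?thesis by (intro differentiable_cong_open[OF U, of w "\<lambda>y. m y + (\<Sum>i\<in>Basis. (w y \<bullet> i) *\<^sub>R E y i)"] weq)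
qed

section \<open>Curvature tensors normalizing a para-quaternionic structure\<close>

lemma tr_add: "tr (\<lambda>v. A v + B v) = tr A + tr B"
  by (simp add: tr_def inner_add_left sum.distrib)

lemma tr_diff: "tr (\<lambda>v. A v - B v) = tr A - tr B"
  by (simp add: tr_def inner_diff_left sum_subtractf)

lemma tr_minus: "tr (\<lambda>v. - A v) = - tr A"
  by (simp add: tr_def sum_negf)

lemma tr_scale: "tr (\<lambda>v. c *\<^sub>R A v) = c * tr A"
  by (simp add: tr_def sum_distrib_left)

lemma tr_ident: "tr (\<lambda>v::'a::euclidean_space. v) = DIM('a)"
  by (simp add: tr_def inner_same_Basis)

lemma tr_rank_one: "linear l \<Longrightarrow> tr (\<lambda>v. l v *\<^sub>R w) = l w"
  using linear_basis_expansion[of l w] by (simp add: tr_def mult.commute)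

lemma tr_comp:
  assumes A: "linear A" and B: "linear (B :: 'a::euclidean_space \<Rightarrow> 'a)"
  shows "tr (\<lambda>v. A (B v)) = tr (\<lambda>v. B (A v))"
proof -
  have "tr (\<lambda>v. A (B v)) = (\<Sum>b\<in>Basis. \<Sum>c\<in>Basis. (B b \<bullet> c) * (A c \<bullet> b))" if A: "linear A" for A B :: "'a \<Rightarrow> 'a"
    unfolding tr_def by (subst linear_basis_expansion[OF A]) (simp add: inner_sum_left)
  from this[OF A, of B] this[OF B, of A] show ?thesis
    by (simp add: mult.commute) (rule sum.swap)
qed

lemma tr_adjoint:
  assumes "linear (A :: 'a::euclidean_space \<Rightarrow> 'a)" shows "tr (adjoint A) = tr A"
  using adjoint_works[OF assms] by (simp add: tr_def inner_commute)

lemma curvature_spaceD: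
  assumes "R \<in> curvature_space \<G>"
  shows "linear (\<lambda>X. R X Y Z)" "linear (\<lambda>Y. R X Y Z)" "R Y X Z = - R X Y Z" "R X Y \<in> \<G>"
    "R X Y Z + R Y Z X + R Z X Y = 0"
  using assms unfolding curvature_space_def bilinear_def mem_Collect_eq by blast+

lemma so_algD: "A \<in> so_alg b \<Longrightarrow> linear A" "A \<in> so_alg b \<Longrightarrow> b (A u) v = - b u (A v)"
  by (auto simp: so_alg_def)

locale pseudo_euclidean =
  fixes b :: "'b::euclidean_space \<Rightarrow> 'b \<Rightarrow> real"
  assumes bil: "bilinear b" and sym: "b u v = b v u" and nondeg: "nondegenerate b"
begin

lemma lin1: "linear (\<lambda>u. b u v)" and lin2: "linear (b u)"
  using bil by (auto simp: bilinear_def)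

lemmas b_simps = bilinear_ladd[OF bil] bilinear_radd[OF bil] bilinear_lmul[OF bil] bilinear_rmul[OF bil]
  bilinear_lneg[OF bil] bilinear_rneg[OF bil] bilinear_lzero[OF bil] bilinear_rzero[OF bil]
  bilinear_lsub[OF bil] bilinear_rsub[OF bil]

lemma eq_zeroI: "(\<And>v. b u v = 0) \<Longrightarrow> u = 0"
  using nondeg by (auto simp: nondegenerate_def)

lemma eqI: "(\<And>v. b u v = b w v) \<Longrightarrow> u = w"
  using eq_zeroI[of "u - w"] by (simp add: b_simps)

lemma exists_non_null: "\<exists>Z. b Z Z \<noteq> 0"
proof (rule ccontr)
  assume "\<nexists>Z. b Z Z \<noteq> 0"
  then have null: "b Z Z = 0" for Z by blast
  have "b u v = 0" for u v
    using null[of "u + v"] null[of u] null[of v] sym[of u v] by (simp add: b_simps)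
  then have "u = 0" for u using eq_zeroI by blast
  then show False using nonempty_Basis nonzero_Basis by blast
qed

text \<open>Metric adjoints have the same trace: the operator \<open>T\<close> representing \<open>b\<close> with respect to the
  Euclidean inner product conjugates \<open>P\<close> into the Euclidean adjoint of \<open>P'\<close>.\<close>

lemma tr_b_adjoint:
  assumes P: "linear P" and P': "linear P'" and adj: "\<And>u v. b (P u) v = b u (P' v)"
  shows "tr P = tr P'"
proof -
  have "\<exists>w. \<forall>v. b w v = j \<bullet> v" for j
    using nondegenerate_representation[OF bil nondeg, of "\<lambda>v. j \<bullet> v"]
      bounded_linear.linear[OF bounded_linear_inner_right] by blast
  then obtain S where S: "\<And>j v. b (S j) v = j \<bullet> v" by metis
  define T where "T w = (\<Sum>i\<in>Basis. b w i *\<^sub>R i)" for w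
  have T: "T w \<bullet> v = b w v" for w v
    using linear_basis_expansion[OF lin2, of w v]
    by (simp add: T_def inner_sum_left inner_commute[of v] mult.commute)
  have linT: "linear T"
    unfolding T_def
    by (auto intro!: linearI simp: b_simps sum.distrib algebra_simps scaleR_sum_right)
  have linS: "linear S"
    by (rule linearI; rule eqI) (auto simp: S b_simps inner_add_left)
  have ST: "S (T u) = u" for u by (rule eqI) (simp add: S T)
  have TS: "T (S u) = u" for u by (rule vector_eq_rdot[THEN iffD1]) (simp add: S T)
  have TP: "T (P u) = adjoint P' (T u)" for u
  proof (rule vector_eq_rdot[THEN iffD1], intro allI)
    fix v show "T (P u) \<bullet> v = adjoint P' (T u) \<bullet> v"
      unfolding T adj unfolding T[symmetric] using adjoint_works[OF P', of v "T u"] by (simp add: inner_commute)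
  qed
  have linA: "linear (adjoint P')" by (rule adjoint_linear[OF P'])
  have "tr P = tr (\<lambda>u. S (adjoint P' (T u)))" by (simp add: TP[symmetric] ST)
  also have "\<dots> = tr (\<lambda>u. adjoint P' (T (S u)))"
    using tr_comp[OF linS linear_compose[OF linT linA]] by (simp add: o_def)
  also have "\<dots> = tr P'" by (simp add: TS tr_adjoint[OF P'])
  finally show ?thesis .
qed

text \<open>The usual octahedron argument: add the first Bianchi identities for the four cyclic shifts of
  \<open>X, Y, Z, U\<close>.\<close>

lemma curvature_pair_symmetry:
  assumes R: "R \<in> curvature_space (so_alg b)"
  shows "b (R X Y Z) U = b (R Z U X) Y"
proof -
  note D = curvature_spaceD[OF R]
  have sk: "b (R X Y Z) U = - b (R X Y U) Z" for X Y Z U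
    using so_algD(2)[OF D(4)] sym by metis
  have an: "b (R X Y Z) U = - b (R Y X Z) U" for X Y Z U
    by (subst D(3)) (simp add: b_simps)
  have bi: "b (R X Y Z) U + b (R Y Z X) U + b (R Z X Y) U = 0" for X Y Z U
    using arg_cong[OF D(5)[of X Y Z], of "\<lambda>w. b w U"] by (simp add: b_simps)
  show ?thesis
    using bi[of X Y Z U] bi[of Y Z U X] bi[of Z U X Y] bi[of U X Y Z]
      sk[of X Y Z U] sk[of Y Z X U] sk[of Z X Y U] sk[of Y Z U X] sk[of Z U Y X] sk[of U Y Z X]
      sk[of Z U X Y] sk[of U X Z Y] sk[of X Z U Y] sk[of U X Y Z] sk[of X Y U Z] sk[of Y U X Z]
      an[of X Y Z U] an[of Y Z X U] an[of Z X Y U] an[of Y Z U X] an[of Z U Y X] an[of U Y Z X]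
      an[of Z U X Y] an[of U X Z Y] an[of X Z U Y] an[of U X Y Z] an[of X Y U Z] an[of Y U X Z]
      an[of X Z Y U] an[of Y U Z X] 
    by linarith
qed

end

locale pseudo_curvature = pseudo_euclidean b
  for b :: "'b::euclidean_space \<Rightarrow> 'b \<Rightarrow> real" +
  fixes R :: "'b \<Rightarrow> 'b \<Rightarrow> 'b \<Rightarrow> 'b"
  assumes curv: "R \<in> curvature_space (so_alg b)"
begin

lemmas R_lin1 = curvature_spaceD(1)[OF curv] and R_lin2 = curvature_spaceD(2)[OF curv]
  and R_antisym = curvature_spaceD(3)[OF curv] and R_so = curvature_spaceD(4)[OF curv]
  and R_bianchi = curvature_spaceD(5)[OF curv]
  and R_lin3 = so_algD(1)[OF curvature_spaceD(4)[OF curv]]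
  and R_skew = so_algD(2)[OF curvature_spaceD(4)[OF curv]]

definition Ric where "Ric X Y = tr (\<lambda>e. R e X Y)"

text \<open>For \<open>J\<close> the identity, \<open>T J\<close> is the Ricci form.\<close>

definition T where "T J X Y = tr (\<lambda>e. J (R e X Y))"

text \<open>By pair symmetry, exchanging \<open>X\<close> and \<open>Y\<close> is taking the metric adjoint of \<open>e \<mapsto> R e X Y\<close>. Hence the
  Ricci form is symmetric and \<open>T J\<close> is skew for skew \<open>J\<close>.\<close>

lemma R_adjoint: "b (R e X Y) u = b e (R u Y X)"
proof -
  have "b (R e X Y) u = b (R Y u e) X" by (rule curvature_pair_symmetry[OF curv])
  also have "\<dots> = - b e (R Y u X)" by (rule R_skew)
  also have "\<dots> = b e (R u Y X)" by (subst R_antisym) (simp add: b_simps)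
  finally show ?thesis .
qed

lemma Ric_sym: "Ric X Y = Ric Y X"
  unfolding Ric_def by (rule tr_b_adjoint[OF R_lin1 R_lin1 R_adjoint])

lemma T_skew:
  assumes J: "J \<in> so_alg b" shows "T J X Y = - T J Y X"
proof -
  have "T J X Y = tr (\<lambda>e. - R (J e) Y X)"
    unfolding T_def
  proof (rule tr_b_adjoint)
    show "linear (\<lambda>e. J (R e X Y))" "linear (\<lambda>e. - R (J e) Y X)"
      using linear_compose[OF R_lin1 so_algD(1)[OF J]] linear_compose[OF so_algD(1)[OF J] linear_compose_neg[OF R_lin1]]
      by (auto simp: o_def)
    show "b (J (R u X Y)) v = b u (- R (J v) Y X)" for u v
      by (simp add: so_algD(2)[OF J] R_adjoint b_simps)
  qed
  also have "\<dots> = - tr (\<lambda>e. J (R e Y X))"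
    using tr_comp[OF R_lin1 so_algD(1)[OF J]] by (simp add: tr_minus)
  finally show ?thesis by (simp add: T_def)
qed

text \<open>The first Bianchi identity expresses the trace over the last argument of the curvature through
  traces over the first one.\<close>

lemma tr_J_R:
  assumes J: "J \<in> so_alg b" shows "tr (\<lambda>v. J (R X Y v)) = - 2 * T J X Y"
proof -
  have "R X Y v = R v Y X - R v X Y" for v
  proof -
    have "R Y v X = - R v Y X" by (rule R_antisym)
    with R_bianchi[of X Y v] have "R X Y v - R v Y X + R v X Y = 0" by simp
    then show ?thesis by (simp add: algebra_simps)
  qed
  then have "tr (\<lambda>v. J (R X Y v)) = tr (\<lambda>v. J (R v Y X) - J (R v X Y))"
    using linear_diff[OF so_algD(1)[OF J]] by simp
  also have "\<dots> = T J Y X - T J X Y" by (simp add: tr_diff T_def)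
  finally show ?thesis using T_skew[OF J, of Y X] by simp
qed

text \<open>If \<open>A\<close> is an element of a para-quaternionic basis with \<open>A\<^sup>2 = s\<close>, then \<open>om s A X Y\<close> is the
  coefficient of \<open>A\<close> in the \<open>Q\<close>-part of \<open>R(X, Y)\<close>, because all of \<open>Q\<close> is trace-free and because
  an endomorphism commuting with \<open>Q\<close> has trace zero after composition with \<open>A\<close>. Defining the coefficient
  as a trace makes its bilinearity evident.\<close>

definition om where "om s A X Y = s / DIM('b) * tr (\<lambda>v. A (R X Y v))"

lemma om_skew: assumes A: "A \<in> so_alg b" shows "om s A Y X = - om s A X Y"
  by (simp add: om_def R_antisym[of Y X] linear_neg[OF so_algD(1)[OF A]] tr_minus)

lemma om_linear_left: assumes A: "linear A" shows "linear (\<lambda>X. om s A X Y)"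
proof (rule linearI)
  show "om s A (X + X') Y = om s A X Y + om s A X' Y" for X X'
    by (simp add: om_def linear_add[OF R_lin1] linear_add[OF A] tr_add algebra_simps)
  show "om s A (c *\<^sub>R X) Y = c *\<^sub>R om s A X Y" for X c
    by (simp add: om_def linear_scale[OF R_lin1] linear_scale[OF A] tr_scale)
qed

lemma om_linear_right: assumes A: "linear A" shows "linear (om s A X)"
proof (rule linearI)
  show "om s A X (Y + Y') = om s A X Y + om s A X Y'" for Y Y'
    by (simp add: om_def linear_add[OF R_lin2] linear_add[OF A] tr_add algebra_simps)
  show "om s A X (c *\<^sub>R Y) = c *\<^sub>R om s A X Y" for Y c
    by (simp add: om_def linear_scale[OF R_lin2] linear_scale[OF A] tr_scale)
qed

lemma om_scale: "om s (\<lambda>v. c *\<^sub>R A v) X Y = c * om s A X Y"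
  by (simp add: om_def tr_scale)

text \<open>The coefficients of \<open>[J, R(X, Y)]\<close> with respect to \<open>J, K, JK\<close> are found by composing with these
  three endomorphisms and taking traces: products of two different ones are trace-free, and the
  cyclic invariance of the trace removes the commutator.\<close>

lemma commutator_formula:
  assumes J: "linear J" and K: "linear K" and J2: "\<And>v. J (J v) = e *\<^sub>R v" and K2: "\<And>v. K (K v) = e' *\<^sub>R v"
    and e: "e * e = 1" "e' * e' = 1" and anti: "\<And>v. K (J v) = - J (K v)"
    and comm: "\<And>v. J (R X Y v) - R X Y (J v) = p *\<^sub>R J v + q *\<^sub>R K v + r *\<^sub>R J (K v)"
  shows "J (R X Y v) - R X Y (J v)
    = (2 * om e' K X Y) *\<^sub>R J (K v) + (2 * e * om (- e * e') (\<lambda>v. J (K v)) X Y) *\<^sub>R K v"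
proof -
  note lin = linear_add[OF J] linear_add[OF K] linear_scale[OF J] linear_scale[OF K] linear_diff[OF J] linear_diff[OF K]
    linear_neg[OF J] linear_neg[OF K] linear_add[OF R_lin3] linear_scale[OF R_lin3] linear_diff[OF R_lin3] linear_neg[OF R_lin3]
  note trs = tr_add tr_diff tr_minus tr_scale tr_ident
  have trJ: "tr J = 0"
  proof -
    have "e' * tr J = tr (\<lambda>v. J (K (K v)))" by (simp add: K2 lin trs)
    also have "\<dots> = tr (\<lambda>v. K (J (K v)))"
      using tr_comp[OF linear_compose[OF K J] K] by (simp add: o_def)
    also have "\<dots> = - (e' * tr J)" by (simp add: K2 lin trs anti)
    finally show ?thesis using e by auto
  qed
  have trK: "tr K = 0"
  proof -
    have "e * tr K = tr (\<lambda>v. J (J (K v)))" by (simp add: J2 trs)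
    also have "\<dots> = tr (\<lambda>v. J (K (J v)))"
      using tr_comp[OF J linear_compose[OF K J]] by (simp add: o_def)
    also have "\<dots> = - (e * tr K)" by (simp add: J2 lin trs anti)
    finally show ?thesis using e by auto
  qed
  have trL: "tr (\<lambda>v. J (K v)) = 0"
    using tr_comp[OF J K] by (simp add: anti trs)
  have JJ: "tr (\<lambda>v. J (R X Y (J v))) = e * tr (R X Y)"
    using tr_comp[OF J linear_compose[OF J R_lin3[of X Y]]] tr_comp[OF linear_compose[OF R_lin3[of X Y] J] J]
    by (simp add: o_def J2 trs)
  have p: "p = 0"
  proof -
    have "tr (\<lambda>v. J (J (R X Y v) - R X Y (J v))) = 0" by (simp add: lin J2 trs JJ)
    moreover have "tr (\<lambda>v. J (J (R X Y v) - R X Y (J v))) = p * e * DIM('b)"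
      by (simp add: comm lin J2 trs trK trL)
    ultimately show ?thesis using e by auto
  qed
  have q: "q * e' * DIM('b) = - 2 * tr (\<lambda>v. J (K (R X Y v)))"
  proof -
    have "tr (\<lambda>v. K (R X Y (J v))) = tr (\<lambda>v. J (K (R X Y v)))"
      using tr_comp[OF linear_compose[OF R_lin3[of X Y] K] J] by (simp add: o_def)
    then have "tr (\<lambda>v. K (J (R X Y v) - R X Y (J v))) = - 2 * tr (\<lambda>v. J (K (R X Y v)))"
      by (simp add: lin anti trs)
    moreover have "tr (\<lambda>v. K (J (R X Y v) - R X Y (J v))) = q * e' * DIM('b)"
      by (simp add: comm p lin J2 K2 anti trs trJ trL)
    ultimately show ?thesis by simp
  qed
  have r: "r * (- e * e') * DIM('b) = - 2 * e * tr (\<lambda>v. K (R X Y v))"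
  proof -
    have "tr (\<lambda>v. J (K (R X Y (J v)))) = e * tr (\<lambda>v. K (R X Y v))"
      using tr_comp[OF linear_compose[OF linear_compose[OF R_lin3[of X Y] K] J] J] by (simp add: o_def J2 trs)
    then have "tr (\<lambda>v. J (K (J (R X Y v) - R X Y (J v)))) = - 2 * e * tr (\<lambda>v. K (R X Y v))"
      by (simp add: lin anti trs J2)
    moreover have "tr (\<lambda>v. J (K (J (R X Y v) - R X Y (J v)))) = r * (- e * e') * DIM('b)"
      by (simp add: comm p lin J2 K2 anti trs trJ trK)
    ultimately show ?thesis by simp
  qed
  have d: "real DIM('b) \<noteq> 0" by simp
  have "q = 2 * e * om (- e * e') (\<lambda>v. J (K v)) X Y"
  proof -
    have "q * DIM('b) = e' * (q * e' * DIM('b))" using e by algebra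
    also have "\<dots> = e' * (- 2 * tr (\<lambda>v. J (K (R X Y v))))" by (simp only: q)
    also have "\<dots> = 2 * e * (- e * e') * tr (\<lambda>v. J (K (R X Y v)))" using e by algebra
    finally show ?thesis using d unfolding om_def by (simp add: field_simps)
  qed
  moreover have "r = 2 * om e' K X Y"
  proof -
    have "r * DIM('b) = - e * e' * (r * (- e * e') * DIM('b))" using e by algebra
    also have "\<dots> = - e * e' * (- 2 * e * tr (\<lambda>v. K (R X Y v)))" by (simp only: r)
    also have "\<dots> = 2 * e' * tr (\<lambda>v. K (R X Y v))" using e by algebra
    finally show ?thesis using d unfolding om_def by (simp add: field_simps)
  qed
  ultimately show ?thesis using comm[of v] p by simp
qed

text \<open>Compare two evaluations of the trace of \<open>J \<circ> R(X, JY)\<close>: up to a factor it is the coefficient of \<open>J\<close>,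
  and it is \<open>- 2 T J X (J Y)\<close>. In the latter \<open>J\<close> is moved past the curvature, which produces the Ricci form
  of \<open>(X, JJY)\<close> and, from the commutator, traces of rank one operators.\<close>

lemma Ric_formula:
  assumes J: "J \<in> so_alg b" and K: "K \<in> so_alg b" and J2: "\<And>v. J (J v) = e *\<^sub>R v" and K2: "\<And>v. K (K v) = e' *\<^sub>R v"
    and e: "e * e = 1" "e' * e' = 1" and anti: "\<And>v. K (J v) = - J (K v)"
    and comm: "\<And>X Y. \<exists>p q r. \<forall>v. J (R X Y v) - R X Y (J v) = p *\<^sub>R J v + q *\<^sub>R K v + r *\<^sub>R J (K v)"
  shows "Ric X Y = - (DIM('b) / 2) * om e J X (J Y) - 2 * om e' K X (K Y)
      - 2 * om (- e * e') (\<lambda>v. J (K v)) X (J (K Y))"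
proof -
  note lJ = so_algD(1)[OF J] and lK = so_algD(1)[OF K]
  define L where "L = (\<lambda>v. J (K v))"
  have L: "L \<in> so_alg b"
    unfolding so_alg_def L_def using linear_compose[OF lK lJ]
    by (auto simp: o_def so_algD(2)[OF J] so_algD(2)[OF K] anti b_simps)
  have comm': "J (R u X v) - R u X (J v) = (2 * om e' K u X) *\<^sub>R L v + (2 * e * om (- e * e') L u X) *\<^sub>R K v"
    for u X v
  proof -
    from comm[of u X] obtain p q r
      where pqr: "\<And>v. J (R u X v) - R u X (J v) = p *\<^sub>R J v + q *\<^sub>R K v + r *\<^sub>R J (K v)" by blast
    show ?thesis
      unfolding L_def by (rule commutator_formula[OF lJ lK J2 K2 e anti pqr])
  qed
  have T_Ric: "T J X Y = Ric X (J Y) + 2 * om e' K (L Y) X + 2 * e * om (- e * e') L (K Y) X" for X Y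
  proof -
    have "J (R u X Y) = R u X (J Y) + (2 *\<^sub>R (om e' K u X *\<^sub>R L Y) + (2 * e) *\<^sub>R (om (- e * e') L u X *\<^sub>R K Y))" for u
      using comm'[of u X Y] by (simp add: algebra_simps)
    then show ?thesis
      unfolding T_def Ric_def by (simp only: tr_add tr_scale tr_rank_one[OF om_linear_left[OF lK]] tr_rank_one[OF om_linear_left[OF so_algD(1)[OF L]]])
  qed
  have "DIM('b) * e * om e J X (J Y) = tr (\<lambda>v. J (R X (J Y) v))"
    using e(1) by (simp add: om_def)
  also have "\<dots> = - 2 * T J X (J Y)" by (rule tr_J_R[OF J])
  also have "\<dots> = - 2 * (e * Ric X Y + 2 * om e' K (L (J Y)) X + 2 * e * om (- e * e') L (K (J Y)) X)"
    by (simp add: T_Ric J2) (simp add: Ric_def linear_scale[OF R_lin3] tr_scale)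
  also have "om e' K (L (J Y)) X = e * om e' K X (K Y)"
  proof -
    have "L (J Y) = - (e *\<^sub>R K Y)" by (simp add: L_def anti linear_neg[OF lJ] J2)
    then show ?thesis
      using om_skew[OF K, of e' "L (J Y)" X] by (simp add: linear_neg[OF om_linear_right[OF lK]] linear_scale[OF om_linear_right[OF lK]])
  qed
  also have "om (- e * e') L (K (J Y)) X = om (- e * e') L X (L Y)"
  proof -
    have "K (J Y) = - L Y" by (simp add: L_def anti)
    then show ?thesis
      using om_skew[OF L, of "- e * e'" "K (J Y)" X] by (simp add: linear_neg[OF om_linear_right[OF so_algD(1)[OF L]]])
  qed
  finally have *: "DIM('b) * e * om e J X (J Y) = - 2 * (e * Ric X Y + 2 * (e * om e' K X (K Y)) + 2 * e * om (- e * e') L X (L Y))" .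
  have "DIM('b) * om e J X (J Y) = e * (DIM('b) * e * om e J X (J Y))" using e by algebra
  also have "\<dots> = - 2 * (Ric X Y + 2 * om e' K X (K Y) + 2 * om (- e * e') L X (L Y))"
    unfolding * using e by algebra
  finally show ?thesis by (simp add: L_def field_simps)
qed

end

text \<open>A curvature tensor normalizing a para-quaternionic structure. The square of \<open>J3\<close> is \<open>- e1 e2\<close>, so
  every signature pattern of the basis is covered.\<close>

locale pq_curvature = pseudo_curvature b R
  for b :: "'b::euclidean_space \<Rightarrow> 'b \<Rightarrow> real" and R +
  fixes J1 J2 J3 :: "'b \<Rightarrow> 'b" and e1 e2 :: real
  assumes e1: "e1 * e1 = 1" and e2: "e2 * e2 = 1"
    and J1_so: "J1 \<in> so_alg b" and J2_so: "J2 \<in> so_alg b"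
    and J1_sq: "J1 (J1 v) = e1 *\<^sub>R v" and J2_sq: "J2 (J2 v) = e2 *\<^sub>R v"
    and J3_eq: "J3 v = J1 (J2 v)" and J2_J1: "J2 (J1 v) = - J1 (J2 v)"
    and normalizes: "A \<in> endo_span3 J1 J2 J3 \<Longrightarrow> (\<lambda>v. A (R X Y v) - R X Y (A v)) \<in> endo_span3 J1 J2 J3"
begin

lemmas J1_lin = so_algD(1)[OF J1_so] and J2_lin = so_algD(1)[OF J2_so]
  and J1_skew = so_algD(2)[OF J1_so] and J2_skew = so_algD(2)[OF J2_so]

lemmas J_simps = linear_add[OF J1_lin] linear_add[OF J2_lin] linear_scale[OF J1_lin] linear_scale[OF J2_lin]
  linear_diff[OF J1_lin] linear_diff[OF J2_lin] linear_neg[OF J1_lin] linear_neg[OF J2_lin]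
  J1_sq J2_sq J2_J1

lemma J3_so: "J3 \<in> so_alg b"
  unfolding so_alg_def J3_eq[abs_def] using linear_compose[OF J2_lin J1_lin]
  by (auto simp: o_def J1_skew J2_skew J_simps b_simps)

lemmas J3_lin = so_algD(1)[OF J3_so] and J3_skew = so_algD(2)[OF J3_so]

lemma commutators_in_span:
  "\<exists>p q r. \<forall>v. J1 (R X Y v) - R X Y (J1 v) = p *\<^sub>R J1 v + q *\<^sub>R J2 v + r *\<^sub>R J1 (J2 v)"
  "\<exists>p q r. \<forall>v. J2 (R X Y v) - R X Y (J2 v) = p *\<^sub>R J2 v + q *\<^sub>R J1 v + r *\<^sub>R J2 (J1 v)"
  "\<exists>p q r. \<forall>v. J3 (R X Y v) - R X Y (J3 v) = p *\<^sub>R J3 v + q *\<^sub>R J1 v + r *\<^sub>R J3 (J1 v)"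
proof -
  have span: "J1 \<in> endo_span3 J1 J2 J3" "J2 \<in> endo_span3 J1 J2 J3" "J3 \<in> endo_span3 J1 J2 J3"
    unfolding endo_span3_def mem_Collect_eq
    by (intro exI[of _ 1] exI[of _ 0] ext, simp) (intro exI[of _ 0] exI[of _ 1] ext, simp)+
  obtain p q r where "\<And>v. J1 (R X Y v) - R X Y (J1 v) = p *\<^sub>R J1 v + q *\<^sub>R J2 v + r *\<^sub>R J3 v"
    using normalizes[OF span(1), of X Y] unfolding endo_span3_def mem_Collect_eq fun_eq_iff by blast
  then show "\<exists>p q r. \<forall>v. J1 (R X Y v) - R X Y (J1 v) = p *\<^sub>R J1 v + q *\<^sub>R J2 v + r *\<^sub>R J1 (J2 v)"
    unfolding J3_eq by blast
  obtain p q r where "\<And>v. J2 (R X Y v) - R X Y (J2 v) = p *\<^sub>R J1 v + q *\<^sub>R J2 v + r *\<^sub>R J3 v"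
    using normalizes[OF span(2), of X Y] unfolding endo_span3_def mem_Collect_eq fun_eq_iff by blast
  then show "\<exists>p q r. \<forall>v. J2 (R X Y v) - R X Y (J2 v) = p *\<^sub>R J2 v + q *\<^sub>R J1 v + r *\<^sub>R J2 (J1 v)"
    by (intro exI[of _ q] exI[of _ p] exI[of _ "- r"]) (simp add: J3_eq J_simps)
  obtain p q r where "\<And>v. J3 (R X Y v) - R X Y (J3 v) = p *\<^sub>R J1 v + q *\<^sub>R J2 v + r *\<^sub>R J3 v"
    using normalizes[OF span(3), of X Y] unfolding endo_span3_def mem_Collect_eq fun_eq_iff by blast
  moreover have "J3 (J1 v) = - (e1 *\<^sub>R J2 v)" for v by (simp add: J3_eq J_simps)
  ultimately show "\<exists>p q r. \<forall>v. J3 (R X Y v) - R X Y (J3 v) = p *\<^sub>R J3 v + q *\<^sub>R J1 v + r *\<^sub>R J3 (J1 v)"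
    by (intro exI[of _ r] exI[of _ p] exI[of _ "- e1 * q"]) (simp add: e1 mult.assoc[symmetric])
qed

text \<open>The contractions \<open>\<omega>\<^sub>\<alpha>(X, J\<^sub>\<alpha> Y)\<close> of the coefficient forms; they turn out to be equal and
  proportional to the metric.\<close>

definition w1 where "w1 X Y = om e1 J1 X (J1 Y)"
definition w2 where "w2 X Y = om e2 J2 X (J2 Y)"
definition w3 where "w3 X Y = om (- e1 * e2) J3 X (J3 Y)"

text \<open>Also \<open>J2, J1\<close> and \<open>J3, J1\<close> begin para-quaternionic bases. Their third elements are \<open>- J3\<close> and
  \<open>- e1 J2\<close>, and the contractions do not change under such signs.\<close>

lemma Ric_formulas:
  "Ric X Y = - (DIM('b) / 2) * w1 X Y - 2 * w2 X Y - 2 * w3 X Y"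
  "Ric X Y = - (DIM('b) / 2) * w2 X Y - 2 * w1 X Y - 2 * w3 X Y"
  "Ric X Y = - (DIM('b) / 2) * w3 X Y - 2 * w1 X Y - 2 * w2 X Y"
proof -
  have J3': "(\<lambda>v. J1 (J2 v)) = J3" by (auto simp: J3_eq)
  show "Ric X Y = - (DIM('b) / 2) * w1 X Y - 2 * w2 X Y - 2 * w3 X Y"
    using Ric_formula[OF J1_so J2_so J1_sq J2_sq e1 e2 J2_J1 commutators_in_span(1), of X Y]
    by (simp add: w1_def w2_def w3_def J3' J3_eq)
  have J21: "(\<lambda>v. J2 (J1 v)) = (\<lambda>v. (-1) *\<^sub>R J3 v)" by (auto simp: J3_eq J_simps)
  have anti: "J1 (J2 v) = - J2 (J1 v)" for v by (simp add: J2_J1)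
  have "om (- e2 * e1) (\<lambda>v. J2 (J1 v)) X (J2 (J1 Y)) = w3 X Y"
    unfolding J21 om_scale w3_def by (simp add: J2_J1 J3_eq[symmetric] om_def linear_neg[OF R_lin2] linear_neg[OF J3_lin] tr_minus mult.commute)
  then show "Ric X Y = - (DIM('b) / 2) * w2 X Y - 2 * w1 X Y - 2 * w3 X Y"
    using Ric_formula[OF J2_so J1_so J2_sq J1_sq e2 e1 anti commutators_in_span(2), of X Y]
    by (simp add: w1_def w2_def)
  have J31: "(\<lambda>v. J3 (J1 v)) = (\<lambda>v. (- e1) *\<^sub>R J2 v)" by (auto simp: J3_eq J_simps)
  have anti: "J1 (J3 v) = - J3 (J1 v)" for v by (simp add: J3_eq J_simps)
  have sq3: "J3 (J3 v) = (- e1 * e2) *\<^sub>R v" for v by (simp add: J3_eq J_simps mult.commute)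
  have e3: "(- e1 * e2) * (- e1 * e2) = 1" using e1 e2 by algebra
  have e12: "- (- e1 * e2) * e1 = e2" using e1 e2 by algebra
  have "om (- (- e1 * e2) * e1) (\<lambda>v. J3 (J1 v)) X (J3 (J1 Y)) = w2 X Y"
    unfolding e12 J31 om_scale w2_def fun_cong[OF J31, of Y]
    using e1 by (simp add: om_def linear_neg[OF R_lin2] linear_scale[OF R_lin2] J_simps tr_minus tr_scale)
  then show "Ric X Y = - (DIM('b) / 2) * w3 X Y - 2 * w1 X Y - 2 * w2 X Y"
    using Ric_formula[OF J3_so J1_so sq3 J1_sq e3 e1 anti commutators_in_span(3), of X Y]
    by (simp add: w1_def w3_def)
qed

text \<open>The differences of the three Ricci formulas carry the factor \<open>2n - 2\<close>, where \<open>4n\<close> is the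
  dimension; this is why dimension 4 is excluded.\<close>

lemma contractions_agree:
  assumes "DIM('b) > 4"
  shows "w2 X Y = w1 X Y" "w3 X Y = w1 X Y" "Ric X Y = - (DIM('b) / 2 + 4) * w1 X Y"
proof -
  have d: "real DIM('b) / 2 - 2 \<noteq> 0" using assms by simp
  have "(real DIM('b) / 2 - 2) * (w2 X Y - w1 X Y) = 0"
    using Ric_formulas(1,2)[of X Y] by (simp add: algebra_simps)
  with d show 2: "w2 X Y = w1 X Y" by simp
  have "(real DIM('b) / 2 - 2) * (w3 X Y - w1 X Y) = 0"
    using Ric_formulas(1,3)[of X Y] by (simp add: algebra_simps)
  with d show 3: "w3 X Y = w1 X Y" by simp
  show "Ric X Y = - (DIM('b) / 2 + 4) * w1 X Y"
    using Ric_formulas(1)[of X Y] by (simp add: 2 3 algebra_simps)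
qed

lemma om_eq_contraction:
  assumes "DIM('b) > 4"
  shows "om e2 J2 X Y = e2 * w1 X (J2 Y)" "om (- e1 * e2) J3 X Y = (- e1 * e2) * w1 X (J3 Y)"
    "om e1 J1 X Y = e1 * w1 X (J1 Y)"
proof -
  have sc: "om s A X (c *\<^sub>R Y) = c * om s A X Y" if "linear A" for s A c
    by (simp add: om_def linear_scale[OF R_lin2] linear_scale[OF that] tr_scale)
  show "om e2 J2 X Y = e2 * w1 X (J2 Y)"
    using e2 by (simp add: contractions_agree(1)[OF assms, symmetric] w2_def J_simps sc[OF J2_lin] mult.assoc[symmetric])
  show "om e1 J1 X Y = e1 * w1 X (J1 Y)"
    using e1 by (simp add: w1_def J_simps sc[OF J1_lin] mult.assoc[symmetric])
  have sq3: "J3 (J3 v) = (- e1 * e2) *\<^sub>R v" for v by (simp add: J3_eq J_simps mult.commute)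
  have e3: "(- e1 * e2) * ((- e1 * e2) * t) = t" for t using e1 e2 by algebra
  show "om (- e1 * e2) J3 X Y = (- e1 * e2) * w1 X (J3 Y)"
    unfolding contractions_agree(2)[OF assms, symmetric] w3_def sq3 sc[OF J3_lin] e3 ..
qed

text \<open>Let \<open>A\<close> represent \<open>w1\<close> with respect to \<open>b\<close>; it is symmetric because the Ricci form is, and it
  commutes with \<open>J2\<close>, \<open>J3\<close> because the coefficient forms are skew. By pair symmetry the matrix
  entry \<open>b ([J1, R(X, Y)] Z) U\<close> equals \<open>- b (S X) Y\<close> for a sum \<open>S\<close> of two curvature endomorphisms, and it is
  a combination of the coefficient forms of \<open>J2\<close> and \<open>J3\<close>; for suitable \<open>Z\<close>, \<open>U\<close> this says that \<open>S\<close> is a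
  multiple of \<open>J3 A\<close>. As curvature endomorphisms normalize the structure, \<open>[J2, J3 A]\<close>, a multiple
  of \<open>J1 A\<close>, lies in the span of the \<open>J\<^sub>\<alpha>\<close>. So \<open>A\<close> is a combination of the identity, \<open>J2\<close> and
  \<open>J3\<close>, and by symmetry it is a multiple of the identity.\<close>

theorem einstein:
  assumes dim: "DIM('b) > 4"
  obtains lam where "\<And>X Y. w1 X Y = lam * b X Y"
proof -
  have w_sym: "w1 X Y = w1 Y X" for X Y
    using Ric_sym[of X Y] unfolding contractions_agree(3)[OF dim] by simp
  have w_lin: "linear (w1 X)" for X
    unfolding w1_def om_def
    by (rule linearI) (simp_all add: J_simps linear_add[OF R_lin2] linear_scale[OF R_lin2] tr_add tr_scale algebra_simps)
  obtain A where A: "\<And>X Y. b (A X) Y = w1 X Y"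
    using nondegenerate_representation[OF bil nondeg w_lin] by metis
  have A_sym: "b (A X) Y = b X (A Y)" for X Y
    using A w_sym sym by metis
  have A_comm: "A (J X) = J (A X)" if J: "J \<in> so_alg b" and o: "\<And>X Y. om s J X Y = s * w1 X (J Y)" and s: "s \<noteq> 0"
    for J s X
  proof (rule eqI)
    fix Y
    have "s * (w1 X (J Y) + w1 Y (J X)) = 0"
      using om_skew[OF J, of s X Y] unfolding o by (simp add: algebra_simps)
    then have "w1 X (J Y) = - w1 Y (J X)" using s by simp
    then show "b (A (J X)) Y = b (J (A X)) Y"
      using A[of X "J Y"] A[of "J X" Y] w_sym[of "J X" Y] by (simp add: so_algD(2)[OF J])
  qed
  have e0: "e1 \<noteq> 0" "e2 \<noteq> 0" "- e1 * e2 \<noteq> 0" using e1 e2 by auto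
  have A_J2: "A (J2 X) = J2 (A X)" and A_J3: "A (J3 X) = J3 (A X)" for X
    using A_comm[OF J2_so om_eq_contraction(1)[OF dim] e0(2)] A_comm[OF J3_so om_eq_contraction(2)[OF dim] e0(3)] by auto
  \<comment> \<open>With \<open>U = J2 Z\<close> the term with \<open>b (J3 Z) U\<close> drops out and \<open>b (J2 Z) U\<close> does not.\<close>
  obtain Z where Z: "b Z Z \<noteq> 0" using exists_non_null by blast
  define U where "U = J2 Z"
  define S where "S = (\<lambda>X. R (J1 Z) U X + R Z (J1 U) X)"
  define k where "k = 2 * b Z Z"
  have k0: "k \<noteq> 0" using Z e0 by (simp add: k_def)
  have S_eq: "S X = k *\<^sub>R J3 (A X)" for X
  proof (rule eqI)
    fix Y
    have "b (S X) Y = b (R X Y (J1 Z)) U + b (R X Y Z) (J1 U)"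
      using curvature_pair_symmetry[OF curv] by (simp add: S_def b_simps)
    also have "\<dots> = - b (J1 (R X Y Z) - R X Y (J1 Z)) U"
      by (simp add: b_simps J1_skew)
    also have "\<dots> = - (2 * om e2 J2 X Y) * b (J1 (J2 Z)) U - (2 * e1 * om (- e1 * e2) J3 X Y) * b (J2 Z) U"
    proof -
      from commutators_in_span(1)[of X Y] obtain p q r
        where pqr: "\<And>v. J1 (R X Y v) - R X Y (J1 v) = p *\<^sub>R J1 v + q *\<^sub>R J2 v + r *\<^sub>R J1 (J2 v)" by blast
      have J3': "(\<lambda>v. J1 (J2 v)) = J3" by (auto simp: J3_eq)
      show ?thesis
        unfolding commutator_formula[OF J1_lin J2_lin J1_sq J2_sq e1 e2 J2_J1 pqr] J3' by (simp add: b_simps)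
    qed
    also have "b (J1 (J2 Z)) U = 0"
      using J1_skew[of "J2 Z" "J2 Z"] sym[of "J1 (J2 Z)" "J2 Z"] by (simp add: U_def)
    also have "b (J2 Z) U = - e2 * b Z Z"
      using J2_skew[of Z "J2 Z"] by (simp add: U_def J2_sq b_simps)
    also have "om (- e1 * e2) J3 X Y = (- e1 * e2) * w1 X (J3 Y)" by (rule om_eq_contraction(2)[OF dim])
    also have "w1 X (J3 Y) = - b (J3 (A X)) Y" using A[of X "J3 Y"] by (simp add: J3_skew)
    finally have "b (S X) Y = - (2 * om e2 J2 X Y) * 0 - (2 * e1 * ((- e1 * e2) * - b (J3 (A X)) Y)) * (- e2 * b Z Z)" .
    also have "\<dots> = k * b (J3 (A X)) Y" unfolding k_def using e1 e2 by algebra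
    finally show "b (S X) Y = b (k *\<^sub>R J3 (A X)) Y" by (simp add: b_simps)
  qed
  have "(\<lambda>X. J2 (S X) - S (J2 X)) \<in> endo_span3 J1 J2 J3"
  proof -
    obtain p q r where 1: "\<And>v. J2 (R (J1 Z) U v) - R (J1 Z) U (J2 v) = p *\<^sub>R J2 v + q *\<^sub>R J1 v + r *\<^sub>R J2 (J1 v)"
      using commutators_in_span(2)[of "J1 Z" U] by blast
    obtain p' q' r' where 2: "\<And>v. J2 (R Z (J1 U) v) - R Z (J1 U) (J2 v) = p' *\<^sub>R J2 v + q' *\<^sub>R J1 v + r' *\<^sub>R J2 (J1 v)"
      using commutators_in_span(2)[of Z "J1 U"] by blast
    have "J2 (S X) - S (J2 X) = (q + q') *\<^sub>R J1 X + (p + p') *\<^sub>R J2 X + (- r - r') *\<^sub>R J3 X" for X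
      using 1[of X] 2[of X] by (simp add: S_def J_simps J3_eq algebra_simps)
    then show ?thesis unfolding endo_span3_def by auto
  qed
  then obtain p q r where "\<And>X. J2 (S X) - S (J2 X) = p *\<^sub>R J1 X + q *\<^sub>R J2 X + r *\<^sub>R J3 X"
    unfolding endo_span3_def mem_Collect_eq fun_eq_iff by blast
  moreover have "J2 (S X) - S (J2 X) = (- 2 * k * e2) *\<^sub>R J1 (A X)" for X
    by (simp add: S_eq A_J2 J3_eq J_simps) (simp add: algebra_simps flip: scaleR_2)
  ultimately have J1A: "(- 2 * k * e2) *\<^sub>R J1 (A X) = p *\<^sub>R J1 X + q *\<^sub>R J2 X + r *\<^sub>R J3 X" for X by metis
  define m where "m = - 2 * k * e2 * e1"
  have m0: "m \<noteq> 0" using k0 e0 by (simp add: m_def)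
  have mA: "m *\<^sub>R A X = (e1 * p) *\<^sub>R X + (q *\<^sub>R J3 X + (e1 * r) *\<^sub>R J2 X)" for X
    using arg_cong[OF J1A[of X], of J1] by (simp add: J_simps J3_eq m_def algebra_simps)
  have "q *\<^sub>R J3 X + (e1 * r) *\<^sub>R J2 X = 0" for X
  proof (rule eq_zeroI)
    fix Y
    have "b (m *\<^sub>R A X) Y = b X (m *\<^sub>R A Y)" by (simp add: b_simps A_sym)
    then show "b (q *\<^sub>R J3 X + (e1 * r) *\<^sub>R J2 X) Y = 0"
      unfolding mA by (simp add: b_simps J3_skew J2_skew)
  qed
  then have "m *\<^sub>R A X = (e1 * p) *\<^sub>R X" for X using mA[of X] by simp
  then have "m * w1 X Y = (e1 * p) * b X Y" for X Y
  proof -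
    have "m * b (A X) Y = b (m *\<^sub>R A X) Y" by (simp add: b_simps)
    also have "\<dots> = b ((e1 * p) *\<^sub>R X) Y" by (simp only: \<open>\<And>X. m *\<^sub>R A X = (e1 * p) *\<^sub>R X\<close>)
    finally show ?thesis by (simp add: A b_simps)
  qed
  then have "w1 X Y = (e1 * p / m) * b X Y" for X Y
    using m0 by (simp add: field_simps)
  then show ?thesis by (rule that)
qed

theorem commutator_J1:
  assumes dim: "DIM('b) > 4" and Ric: "Ric X0 Y0 \<noteq> 0"
  obtains lam where "lam \<noteq> 0"
    "\<And>X Y v. J1 (R X Y v) - R X Y (J1 v)
      = (lam * e2) *\<^sub>R (b X (J2 Y) *\<^sub>R J3 v) - (lam * e2) *\<^sub>R (b X (J3 Y) *\<^sub>R J2 v)"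
proof -
  obtain lam where lam: "\<And>X Y. w1 X Y = lam * b X Y" using einstein[OF dim] by blast
  show ?thesis
  proof (rule that[of "2 * lam"])
    show "2 * lam \<noteq> 0" using Ric contractions_agree(3)[OF dim, of X0 Y0] by (auto simp: lam)
    fix X Y v
    from commutators_in_span(1)[of X Y] obtain p q r
      where pqr: "\<And>v. J1 (R X Y v) - R X Y (J1 v) = p *\<^sub>R J1 v + q *\<^sub>R J2 v + r *\<^sub>R J1 (J2 v)" by blast
    have J3': "(\<lambda>v. J1 (J2 v)) = J3" by (auto simp: J3_eq)
    have c: "2 * e1 * ((- e1 * e2) * t) = - 2 * e2 * t" for t using e1 by algebra
    show "J1 (R X Y v) - R X Y (J1 v) = (2 * lam * e2) *\<^sub>R (b X (J2 Y) *\<^sub>R J3 v) - (2 * lam * e2) *\<^sub>R (b X (J3 Y) *\<^sub>R J2 v)"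
      unfolding commutator_formula[OF J1_lin J2_lin J1_sq J2_sq e1 e2 J2_J1 pqr] J3' om_eq_contraction(1,2)[OF dim] lam c
      by (simp add: J3_eq algebra_simps)
  qed
qed

end

section \<open>The Levi-Civita connection and fields along a map\<close>

lemma linear_fder_family:
  fixes L :: "'p::euclidean_space \<Rightarrow> 'c::real_vector \<Rightarrow> 'd::real_normed_vector"
  assumes U: "open U" "x \<in> U" and lin: "\<And>y. y \<in> U \<Longrightarrow> linear (L y)"
    and d: "\<And>a. (\<lambda>y. L y a) differentiable (at x)"
  shows "linear (\<lambda>a. fder (\<lambda>y. L y a) x w)"
proof (rule linearI)
  fix a a' :: 'c and c :: real
  have "fder (\<lambda>y. L y (a + a')) x w = fder (\<lambda>y. L y a + L y a') x w"
    by (rule fder_cong[OF U]) (simp add: linear_add[OF lin])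
  then show "fder (\<lambda>y. L y (a + a')) x w = fder (\<lambda>y. L y a) x w + fder (\<lambda>y. L y a') x w"
    by (simp add: fder_add d)
  have "fder (\<lambda>y. L y (c *\<^sub>R a)) x w = fder (\<lambda>y. c *\<^sub>R L y a) x w"
    by (rule fder_cong[OF U]) (simp add: linear_scale[OF lin])
  also have "\<dots> = c *\<^sub>R fder (\<lambda>y. L y a) x w"
    by (rule fder_unique) (intro has_derivative_scaleR_right fder_works d)
  finally show "fder (\<lambda>y. L y (c *\<^sub>R a)) x w = c *\<^sub>R fder (\<lambda>y. L y a) x w" .
qed

text \<open>Uniqueness of the Levi-Civita connection at a single point: the difference of two candidates is
  symmetric in its first two and skew in its last two arguments, hence zero.\<close>

lemma levi_civita_eqI:
  assumes metric: "pseudo_euclidean (g x)" and \<Gamma>_bil: "bilinear \<Gamma>" and \<Gamma>_sym: "\<And>u v. \<Gamma> u v = \<Gamma> v u"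
    and compat: "\<And>w u v. fder (\<lambda>y. g y u v) x w = g x (\<Gamma> w u) v + g x u (\<Gamma> w v)"
  shows "levi_civita g x = \<Gamma>"
proof -
  interpret pseudo_euclidean "g x" by (rule metric)
  show ?thesis
    unfolding levi_civita_def
  proof (rule the_equality)
    show "bilinear \<Gamma> \<and> (\<forall>u v. \<Gamma> u v = \<Gamma> v u) \<and>
        (\<forall>w u v. fder (\<lambda>y. g y u v) x w = g x (\<Gamma> w u) v + g x u (\<Gamma> w v))"
      using \<Gamma>_bil compat \<Gamma>_sym by blast
  next
    fix \<Gamma>' assume \<Gamma>': "bilinear \<Gamma>' \<and> (\<forall>u v. \<Gamma>' u v = \<Gamma>' v u) \<and>
        (\<forall>w u v. fder (\<lambda>y. g y u v) x w = g x (\<Gamma>' w u) v + g x u (\<Gamma>' w v))"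
    define T where "T w u v = g x (\<Gamma>' w u - \<Gamma> w u) v" for w u v
    have 1: "T w u v = T u w v" for w u v
      using \<Gamma>' \<Gamma>_sym by (simp add: T_def)
    have 2: "T w u v = - T w v u" for w u v
    proof -
      have "g x (\<Gamma>' w u) v + g x u (\<Gamma>' w v) = g x (\<Gamma> w u) v + g x u (\<Gamma> w v)"
        using \<Gamma>' compat by metis
      then show ?thesis
        using sym[of u] by (simp add: T_def b_simps)
    qed
    have "T w u v = 0" for w u v
      using 1[of w u v] 2[of u w v] 1[of u v w] 2[of v u w] 1[of v w u] 2[of w v u] by linarith
    then have "\<Gamma>' w u - \<Gamma> w u = 0" for w u
      using eq_zeroI unfolding T_def by blast
    then show "\<Gamma>' = \<Gamma>" by (intro ext) simp
  qed
qed

locale pr_chart =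
  fixes S :: "'b::euclidean_space set" and g :: "'b \<Rightarrow> 'b \<Rightarrow> 'b \<Rightarrow> real"
  assumes S_open: "open S" and metric: "metric_on S g"
begin

abbreviation Gm where "Gm \<equiv> levi_civita g"

lemma g_pseudo_euclidean: "x \<in> S \<Longrightarrow> pseudo_euclidean (g x)"
  using metric by (auto simp: metric_on_def pseudo_euclidean_def)

lemma g_smooth: "smooth_on S (\<lambda>x. g x u v)"
  using metric by (simp add: metric_on_def)

lemma g_bil: "x \<in> S \<Longrightarrow> bilinear (g x)" and g_sym: "x \<in> S \<Longrightarrow> g x u v = g x v u"
  and g_nondeg: "x \<in> S \<Longrightarrow> nondegenerate (g x)"
  using metric by (auto simp: metric_on_def)

lemma g_lin: "x \<in> S \<Longrightarrow> linear (\<lambda>u. g x u v)" "x \<in> S \<Longrightarrow> linear (g x u)"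
  using g_bil by (auto simp: bilinear_def)

lemma g_diff: "x \<in> S \<Longrightarrow> (\<lambda>y. g y u v) differentiable (at x)"
  by (rule smooth_on_differentiable[OF g_smooth])

text \<open>The Koszul expression for \<open>g(\<Gamma>(w, u), v)\<close>.\<close>

definition koszul where
  "koszul x w u v = (fder (\<lambda>y. g y u v) x w + fder (\<lambda>y. g y w v) x u - fder (\<lambda>y. g y w u) x v) / 2"

lemma dg_lin:
  assumes "x \<in> S"
  shows "linear (fder (\<lambda>y. g y u v) x)" "linear (\<lambda>u. fder (\<lambda>y. g y u v) x w)" "linear (\<lambda>v. fder (\<lambda>y. g y u v) x w)"
  using fder_linear[OF g_diff[OF assms]]
    linear_fder_family[OF S_open assms, of "\<lambda>y u. g y u v" w] linear_fder_family[OF S_open assms, of "\<lambda>y. g y u" w]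
  by (simp_all add: g_lin g_diff assms)

lemma dg_sym: "x \<in> S \<Longrightarrow> fder (\<lambda>y. g y u v) x w = fder (\<lambda>y. g y v u) x w"
  by (rule fder_cong[OF S_open]) (simp_all add: g_sym)

lemma koszul_lin:
  assumes x: "x \<in> S"
  shows "linear (\<lambda>w. koszul x w u v)" "linear (\<lambda>u. koszul x w u v)" "linear (koszul x w u)"
  by (rule linearI; simp add: koszul_def linear_add[OF dg_lin(1)[OF x]] linear_scale[OF dg_lin(1)[OF x]]
      linear_add[OF dg_lin(2)[OF x]] linear_scale[OF dg_lin(2)[OF x]]
      linear_add[OF dg_lin(3)[OF x]] linear_scale[OF dg_lin(3)[OF x]] algebra_simps add_divide_distrib diff_divide_distrib)+

lemma
  assumes x: "x \<in> S"
  shows Gm_bil: "bilinear (Gm x)" and Gm_sym: "Gm x u v = Gm x v u"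
    and Gm_compat: "fder (\<lambda>y. g y u v) x w = g x (Gm x w u) v + g x u (Gm x w v)"
    and Gm_koszul: "g x (Gm x w u) v = koszul x w u v"
proof -
  interpret pseudo_euclidean "g x" by (rule g_pseudo_euclidean[OF x])
  have "\<exists>z. \<forall>v. g x z v = koszul x w u v" for w u
    using nondegenerate_representation[OF bil nondeg koszul_lin(3)[OF x]] by blast
  then obtain \<Gamma> where \<Gamma>: "\<And>w u v. g x (\<Gamma> w u) v = koszul x w u v" by metis
  have "bilinear \<Gamma>"
    unfolding bilinear_def
    by (intro conjI allI; rule linearI; rule eqI)
      (simp_all add: b_simps \<Gamma> linear_add[OF koszul_lin(1)[OF x]] linear_scale[OF koszul_lin(1)[OF x]]
        linear_add[OF koszul_lin(2)[OF x]] linear_scale[OF koszul_lin(2)[OF x]])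
  moreover have "\<Gamma> u v = \<Gamma> v u" for u v
    by (rule eqI) (simp add: \<Gamma> koszul_def dg_sym[OF x, of u v])
  moreover have "fder (\<lambda>y. g y u v) x w = g x (\<Gamma> w u) v + g x u (\<Gamma> w v)" for w u v
  proof -
    have "g x u (\<Gamma> w v) = koszul x w v u" using \<Gamma> sym[of u] by simp
    then show ?thesis
      unfolding \<Gamma> koszul_def using dg_sym[OF x, of u v] dg_sym[OF x, of w v] dg_sym[OF x, of w u]
      by (simp add: field_simps)
  qed
  ultimately have *: "Gm x = \<Gamma>" and "bilinear \<Gamma>" "\<And>u v. \<Gamma> u v = \<Gamma> v u"
    "\<And>w u v. fder (\<lambda>y. g y u v) x w = g x (\<Gamma> w u) v + g x u (\<Gamma> w v)"
    using levi_civita_eqI[of g x \<Gamma>, OF g_pseudo_euclidean[OF x]] by blast+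
  then show "bilinear (Gm x)" by simp
  show "Gm x u v = Gm x v u" unfolding * by fact
  show "fder (\<lambda>y. g y u v) x w = g x (Gm x w u) v + g x u (Gm x w v)" unfolding * by fact
  show "g x (Gm x w u) v = koszul x w u v" unfolding * by (rule \<Gamma>)
qed

lemma Gm_differentiable:
  assumes x: "x \<in> S" shows "(\<lambda>y. Gm y u v) differentiable (at x)"
proof (rule differentiable_solution[OF S_open x g_bil g_nondeg[OF x] g_diff[OF x]])
  show "(\<lambda>y. koszul y u v w) differentiable (at x)" for w
    unfolding koszul_def divide_inverse
    by (intro differentiable_mult differentiable_diff differentiable_add
        smooth_on_differentiable[OF smooth_on_fder[OF g_smooth] x]) simp
  show "y \<in> S \<Longrightarrow> g y (Gm y u v) w = koszul y u v w" for y w by (rule Gm_koszul)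
qed

lemma Gm_lin: assumes "x \<in> S" shows "linear (\<lambda>u. Gm x u v)" "linear (Gm x u)"
  using Gm_bil[OF assms] by (auto simp: bilinear_def)

lemma dGm_lin:
  assumes x: "x \<in> S"
  shows "linear (fder (\<lambda>y. Gm y u v) x)" "linear (\<lambda>u. fder (\<lambda>y. Gm y u v) x w)" "linear (\<lambda>v. fder (\<lambda>y. Gm y u v) x w)"
  using fder_linear[OF Gm_differentiable[OF assms]]
    linear_fder_family[OF S_open assms, of "\<lambda>y u. Gm y u v" w] linear_fder_family[OF S_open assms, of "\<lambda>y. Gm y u" w]
  by (simp_all add: Gm_lin Gm_differentiable assms)

lemma riemann_eq:
  "riemann g x X Y Z = fder (\<lambda>y. Gm y Y Z) x X - fder (\<lambda>y. Gm y X Z) x Y + Gm x X (Gm x Y Z) - Gm x Y (Gm x X Z)"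
  by (simp add: riemann_def Let_def)

text \<open>Differentiate \<open>g(Z, U)\<close> twice; the antisymmetrization of the second derivatives vanishes.\<close>

lemma riemann_skew:
  assumes x: "x \<in> S" shows "g x (riemann g x X Y Z) U = - g x Z (riemann g x X Y U)"
proof -
  interpret pseudo_euclidean "g x" by (rule g_pseudo_euclidean[OF x])
  have *: "fder (\<lambda>y. fder (\<lambda>y. g y Z U) y Y) x X =
     g x (Gm x X (Gm x Y Z)) U + g x (Gm x Y Z) (Gm x X U) + g x (fder (\<lambda>y. Gm y Y Z) x X) U
     + (g x (Gm x X Z) (Gm x Y U) + g x Z (Gm x X (Gm x Y U)) + g x Z (fder (\<lambda>y. Gm y Y U) x X))" for X Y
  proof -
    have d1: "((\<lambda>y. g y (Gm y Y Z) U) has_derivative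
        (\<lambda>w. fder (\<lambda>y. g y (Gm x Y Z) U) x w + g x (fder (\<lambda>y. Gm y Y Z) x w) U)) (at x)"
      using has_derivative_bilinear_family[OF S_open x g_bil g_diff[OF x] Gm_differentiable[OF x] differentiable_const, of Y Z U]
      by (simp add: b_simps)
    have d2: "((\<lambda>y. g y Z (Gm y Y U)) has_derivative
        (\<lambda>w. fder (\<lambda>y. g y Z (Gm x Y U)) x w + g x Z (fder (\<lambda>y. Gm y Y U) x w))) (at x)"
      using has_derivative_bilinear_family[OF S_open x g_bil g_diff[OF x] differentiable_const Gm_differentiable[OF x], of Z Y U]
      by (simp add: b_simps)
    have "fder (\<lambda>y. fder (\<lambda>y. g y Z U) y Y) x X = fder (\<lambda>y. g y (Gm y Y Z) U + g y Z (Gm y Y U)) x X"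
      by (rule fder_cong[OF S_open x]) (rule Gm_compat)
    also have "\<dots> = fder (\<lambda>y. g y (Gm x Y Z) U) x X + g x (fder (\<lambda>y. Gm y Y Z) x X) U
        + (fder (\<lambda>y. g y Z (Gm x Y U)) x X + g x Z (fder (\<lambda>y. Gm y Y U) x X))"
      by (rule fder_unique) (rule has_derivative_add[OF d1 d2])
    finally show ?thesis by (simp add: Gm_compat[OF x])
  qed
  have "fder (\<lambda>y. fder (\<lambda>y. g y Z U) y Y) x X = fder (\<lambda>y. fder (\<lambda>y. g y Z U) y X) x Y"
    by (rule symmetric_second_derivative[OF S_open x g_smooth])
  then show ?thesis
    unfolding * riemann_eq by (simp add: b_simps)
qed

lemma riemann_curvature_space:
  assumes x: "x \<in> S" shows "riemann g x \<in> curvature_space (so_alg (g x))"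
proof -
  note lin = linear_add[OF dGm_lin(1)[OF x]] linear_scale[OF dGm_lin(1)[OF x]]
      linear_add[OF dGm_lin(2)[OF x]] linear_scale[OF dGm_lin(2)[OF x]]
      linear_add[OF dGm_lin(3)[OF x]] linear_scale[OF dGm_lin(3)[OF x]]
      linear_add[OF Gm_lin(1)[OF x]] linear_scale[OF Gm_lin(1)[OF x]]
      linear_add[OF Gm_lin(2)[OF x]] linear_scale[OF Gm_lin(2)[OF x]]
  have "bilinear (\<lambda>X Y. riemann g x X Y Z)" for Z
    unfolding bilinear_def
    by (intro conjI allI; rule linearI) (simp_all add: riemann_eq lin algebra_simps)
  moreover have "riemann g x X Y Z = - riemann g x Y X Z" for X Y Z
    by (simp add: riemann_eq)
  moreover have "linear (riemann g x X Y)" for X Y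
    by (rule linearI) (simp_all add: riemann_eq lin algebra_simps)
  moreover have "riemann g x X Y Z + riemann g x Y Z X + riemann g x Z X Y = 0" for X Y Z
  proof -
    have "fder (\<lambda>y. Gm y u v) x w = fder (\<lambda>y. Gm y v u) x w" for u v w
      by (rule fder_cong[OF S_open x]) (rule Gm_sym)
    from this[of Y Z X] this[of X Z Y] this[of X Y Z] show ?thesis
      by (simp add: riemann_eq Gm_sym[OF x, of Z Y] Gm_sym[OF x, of Z X] Gm_sym[OF x, of Y X])
  qed
  ultimately show ?thesis
    unfolding curvature_space_def so_alg_def mem_Collect_eq using riemann_skew[OF x] by blast
qed

end

locale pr_map = pr_chart S g for S :: "'b::euclidean_space set" and g +
  fixes U :: "'a::euclidean_space set" and \<phi> :: "'a \<Rightarrow> 'b"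
  assumes U_open: "open U" and \<phi>_smooth: "smooth_on U \<phi>" and \<phi>_in: "x \<in> U \<Longrightarrow> \<phi> x \<in> S"
begin

text \<open>The pulled-back Levi-Civita connection on vector fields along \<open>\<phi>\<close> and the induced connection on
  endomorphism fields along \<open>\<phi>\<close>. The direction of differentiation is a vector \<open>u\<close> at \<open>x\<close>.\<close>

definition DD where "DD s x u = fder s x u + Gm (\<phi> x) (fder \<phi> x u) (s x)"

definition DE where
  "DE A x u v = fder (\<lambda>y. A y v) x u + Gm (\<phi> x) (fder \<phi> x u) (A x v) - A x (Gm (\<phi> x) (fder \<phi> x u) v)"

lemma \<phi>_diff: "x \<in> U \<Longrightarrow> \<phi> differentiable (at x)"
  by (rule smooth_on_differentiable[OF \<phi>_smooth])

lemma d\<phi>_diff: "x \<in> U \<Longrightarrow> (\<lambda>y. fder \<phi> y v) differentiable (at x)"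
  by (rule smooth_on_differentiable[OF smooth_on_fder[OF \<phi>_smooth]])

lemma d\<phi>_lin: "x \<in> U \<Longrightarrow> linear (fder \<phi> x)"
  by (rule fder_linear[OF \<phi>_diff])

lemma DD_cong: "open N \<Longrightarrow> x \<in> N \<Longrightarrow> (\<And>y. y \<in> N \<Longrightarrow> s y = t y) \<Longrightarrow> DD s x u = DD t x u"
  using fder_cong[of N x s t u] by (simp add: DD_def)

lemma DE_cong: "open N \<Longrightarrow> x \<in> N \<Longrightarrow> (\<And>y. y \<in> N \<Longrightarrow> A y = B y) \<Longrightarrow> DE A x u = DE B x u"
  using fder_cong[of N x "\<lambda>y. A y _" "\<lambda>y. B y _" u] by (auto simp: DE_def)

lemma DD_add:
  "x \<in> U \<Longrightarrow> s differentiable (at x) \<Longrightarrow> t differentiable (at x) \<Longrightarrow>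
    DD (\<lambda>y. s y + t y) x u = DD s x u + DD t x u"
  by (simp add: DD_def fder_add linear_add[OF Gm_lin(2)[OF \<phi>_in]])

lemma DE_add:
  "x \<in> U \<Longrightarrow> (\<And>v. (\<lambda>y. A y v) differentiable (at x)) \<Longrightarrow> (\<And>v. (\<lambda>y. B y v) differentiable (at x)) \<Longrightarrow>
    DE (\<lambda>y v. A y v + B y v) x u v = DE A x u v + DE B x u v"
  by (simp add: DE_def fder_add linear_add[OF Gm_lin(2)[OF \<phi>_in]])

lemma DE_scaleR:
  fixes a :: "'a \<Rightarrow> real"
  shows "x \<in> U \<Longrightarrow> a differentiable (at x) \<Longrightarrow> (\<And>v. (\<lambda>y. A y v) differentiable (at x)) \<Longrightarrow>
    DE (\<lambda>y v. a y *\<^sub>R A y v) x u v = fder a x u *\<^sub>R A x v + a x *\<^sub>R DE A x u v"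
  by (simp add: DE_def fder_scaleR linear_scale[OF Gm_lin(2)[OF \<phi>_in]] algebra_simps)

lemma DE_pullback:
  assumes "x \<in> U" "(\<lambda>z. E z v) differentiable (at (\<phi> x))"
  shows "DE (\<lambda>y. E (\<phi> y)) x u v = cov_endo Gm E (\<phi> x) (fder \<phi> x u) v"
  by (simp add: DE_def cov_endo_def fder_compose[of \<phi> x "\<lambda>z. E z v", OF \<phi>_diff[OF assms(1)] assms(2)])

lemma Gm_pullback_differentiable: "x \<in> U \<Longrightarrow> (\<lambda>y. Gm (\<phi> y) a b) differentiable (at x)"
  by (rule differentiable_compose_at[OF \<phi>_diff Gm_differentiable[OF \<phi>_in]])

lemma Gm_along_differentiable: 
  "x \<in> U \<Longrightarrow> a differentiable (at x) \<Longrightarrow> b differentiable (at x) \<Longrightarrow> (\<lambda>y. Gm (\<phi> y) (a y) (b y)) differentiable (at x)"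
  by (rule differentiable_bilinear_family[OF U_open _ Gm_bil[OF \<phi>_in] Gm_pullback_differentiable])

lemma fder_Gm_along: 
  assumes "x \<in> U" "a differentiable (at x)" "b differentiable (at x)"
  shows "fder (\<lambda>y. Gm (\<phi> y) (a y) (b y)) x u = fder (\<lambda>z. Gm z (a x) (b x)) (\<phi> x) (fder \<phi> x u)
    + Gm (\<phi> x) (fder a x u) (b x) + Gm (\<phi> x) (a x) (fder b x u)"
  using fder_bilinear_family[OF U_open assms(1) Gm_bil[OF \<phi>_in] Gm_pullback_differentiable[OF assms(1)] assms(2,3), of u]
    fder_compose[OF \<phi>_diff[OF assms(1)] Gm_differentiable[OF \<phi>_in[OF assms(1)]], of "a x" "b x" u]
  by simp

lemma DD_differentiable:
  assumes N: "open N" "x \<in> N" "N \<subseteq> U" and s: "smooth_on N s"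
  shows "(\<lambda>y. DD s y v) differentiable (at x)"
  unfolding DD_def using N
  by (intro differentiable_add Gm_along_differentiable d\<phi>_diff smooth_on_differentiable[OF s]
      smooth_on_differentiable[OF smooth_on_fder[OF s]]) auto

lemma DD_metric:
  assumes x: "x \<in> U" and s: "s differentiable (at x)" and t: "t differentiable (at x)"
  shows "fder (\<lambda>y. g (\<phi> y) (s y) (t y)) x u = g (\<phi> x) (DD s x u) (t x) + g (\<phi> x) (s x) (DD t x u)"
proof -
  interpret pseudo_euclidean "g (\<phi> x)" by (rule g_pseudo_euclidean[OF \<phi>_in[OF x]])
  have pull: "(\<lambda>y. g (\<phi> y) a b) differentiable (at x)" for a b
    by (rule differentiable_compose_at[OF \<phi>_diff[OF x] g_diff[OF \<phi>_in[OF x]]])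
  have "fder (\<lambda>y. g (\<phi> y) (s y) (t y)) x u = fder (\<lambda>y. g (\<phi> y) (s x) (t x)) x u
      + g (\<phi> x) (fder s x u) (t x) + g (\<phi> x) (s x) (fder t x u)"
    by (rule fder_bilinear_family[OF U_open x g_bil[OF \<phi>_in] pull s t])
  also have "fder (\<lambda>y. g (\<phi> y) (s x) (t x)) x u = fder (\<lambda>z. g z (s x) (t x)) (\<phi> x) (fder \<phi> x u)"
    by (rule fder_compose[OF \<phi>_diff[OF x] g_diff[OF \<phi>_in[OF x]]])
  finally show ?thesis by (simp add: DD_def Gm_compat[OF \<phi>_in[OF x]] b_simps)
qed

lemma metric_along_differentiable:
  assumes x: "x \<in> U" and s: "s differentiable (at x)" and t: "t differentiable (at x)"
  shows "(\<lambda>y. g (\<phi> y) (s y) (t y)) differentiable (at x)"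
  by (rule differentiable_bilinear_family[OF U_open x g_bil[OF \<phi>_in]
        differentiable_compose_at[OF \<phi>_diff[OF x] g_diff[OF \<phi>_in[OF x]]] s t])

lemma DD_torsion_free:
  assumes x: "x \<in> U" shows "DD (\<lambda>y. fder \<phi> y v) x u = DD (\<lambda>y. fder \<phi> y u) x v"
  using symmetric_second_derivative[OF U_open x \<phi>_smooth, of u v] Gm_sym[OF \<phi>_in[OF x]]
  by (simp add: DD_def)

lemma DD_Leibniz:
  assumes N: "open N" "x \<in> N" "N \<subseteq> U" and A: "\<And>y. y \<in> N \<Longrightarrow> linear (A y)" "\<And>v. (\<lambda>y. A y v) differentiable (at x)"
    and s: "s differentiable (at x)"
  shows "DD (\<lambda>y. A y (s y)) x u = DE A x u (s x) + A x (DD s x u)"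
  using fder_linear_family[OF N(1,2) A s, of u] N linear_add[OF A(1)[OF N(2)]]
  by (simp add: DD_def DE_def)

lemma DE_compose:
  assumes N: "open N" "x \<in> N" "N \<subseteq> U" and A: "\<And>y. y \<in> N \<Longrightarrow> linear (A y)" "\<And>v. (\<lambda>y. A y v) differentiable (at x)"
    and B: "\<And>v. (\<lambda>y. B y v) differentiable (at x)"
  shows "DE (\<lambda>y v. A y (B y v)) x u v = DE A x u (B x v) + A x (DE B x u v)"
  using fder_linear_family[OF N(1,2) A B, of v u]
  by (simp add: DE_def linear_add[OF A(1)[OF N(2)]] linear_diff[OF A(1)[OF N(2)]])

lemma DE_const_scale: "x \<in> U \<Longrightarrow> DE (\<lambda>y v. c *\<^sub>R v) x u v = 0"
  by (simp add: DE_def linear_scale[OF Gm_lin(2)[OF \<phi>_in]])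

text \<open>The curvature of the pulled-back connection is the pulled-back curvature. Second derivatives of
  \<open>s\<close> and of \<open>\<phi>\<close> cancel by Schwarz.\<close>

lemma DD_curvature:
  assumes N: "open N" "x \<in> N" "N \<subseteq> U" and s: "smooth_on N s"
  shows "DD (\<lambda>y. DD s y v) x u - DD (\<lambda>y. DD s y u) x v
    = riemann g (\<phi> x) (fder \<phi> x u) (fder \<phi> x v) (s x)"
proof -
  have x: "x \<in> U" using N by auto
  note ds = smooth_on_differentiable[OF s N(2)] smooth_on_differentiable[OF smooth_on_fder[OF s] N(2)]
  have *: "DD (\<lambda>y. DD s y v) x u = fder (\<lambda>y. fder s y v) x u
      + (fder (\<lambda>z. Gm z (fder \<phi> x v) (s x)) (\<phi> x) (fder \<phi> x u)
      + Gm (\<phi> x) (fder (\<lambda>y. fder \<phi> y v) x u) (s x) + Gm (\<phi> x) (fder \<phi> x v) (fder s x u))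
      + Gm (\<phi> x) (fder \<phi> x u) (fder s x v) + Gm (\<phi> x) (fder \<phi> x u) (Gm (\<phi> x) (fder \<phi> x v) (s x))" for u v
    unfolding DD_def
    by (simp add: fder_add ds Gm_along_differentiable d\<phi>_diff x fder_Gm_along linear_add[OF Gm_lin(2)[OF \<phi>_in[OF x]]])
  show ?thesis
    unfolding * riemann_eq
    using symmetric_second_derivative[OF U_open x \<phi>_smooth, of u v] symmetric_second_derivative[OF N(1,2) s, of u v]
    by simp
qed

lemma DE_differentiable:
  assumes N: "open N" "x \<in> N" "N \<subseteq> U" and A: "\<And>y. y \<in> N \<Longrightarrow> linear (A y)" "\<And>v. smooth_on N (\<lambda>y. A y v)"
  shows "(\<lambda>y. DE A y v w) differentiable (at x)"
proof -
  have x: "x \<in> U" using N by auto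
  note dA = smooth_on_differentiable[OF A(2) N(2)]
  have c: "(\<lambda>y. Gm (\<phi> y) (fder \<phi> y v) w) differentiable (at x)"
    by (intro Gm_along_differentiable x d\<phi>_diff) simp
  show ?thesis
    unfolding DE_def
    by (intro differentiable_diff differentiable_add Gm_along_differentiable d\<phi>_diff x dA
        smooth_on_differentiable[OF smooth_on_fder[OF A(2)] N(2)] differentiable_linear_family[OF N(1,2) A(1) dA c])
qed

text \<open>Apply the curvature identity for vector fields to \<open>A w\<close> and to \<open>w\<close>, where \<open>w\<close> has constant
  coefficients, and compare by the Leibniz rule.\<close>

lemma DE_curvature:
  assumes N: "open N" "x \<in> N" "N \<subseteq> U" and A: "\<And>y. y \<in> N \<Longrightarrow> linear (A y)" "\<And>v. smooth_on N (\<lambda>y. A y v)"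
  shows "DE (\<lambda>y. DE A y v) x u w - DE (\<lambda>y. DE A y u) x v w
    = riemann g (\<phi> x) (fder \<phi> x u) (fder \<phi> x v) (A x w) - A x (riemann g (\<phi> x) (fder \<phi> x u) (fder \<phi> x v) w)"
proof -
  have x: "x \<in> U" using N by auto
  note dA = smooth_on_differentiable[OF A(2) N(2)]
  define c where "c v y = DD (\<lambda>y. w) y v" for v y
  have cd: "c v differentiable (at x)" for v
    unfolding c_def[abs_def] by (rule DD_differentiable[OF N smooth_on_const])
  have c_eq: "c v y = Gm (\<phi> y) (fder \<phi> y v) w" for v y by (simp add: c_def DD_def)
  have 1: "DD (\<lambda>y. A y w) y v = DE A y v w + A y (c v y)" if "y \<in> N" for y v
    by (simp add: DD_def DE_def c_eq)
  have 2: "DD (\<lambda>y. DD (\<lambda>y. A y w) y v) x u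
      = DE (\<lambda>y. DE A y v) x u w + DE A x v (c u x) + (DE A x u (c v x) + A x (DD (c v) x u))" for u v
  proof -
    have "DD (\<lambda>y. DD (\<lambda>y. A y w) y v) x u = DD (\<lambda>y. DE A y v w + A y (c v y)) x u"
      by (rule DD_cong[OF N(1,2)]) (rule 1)
    also have "\<dots> = DD (\<lambda>y. DE A y v w) x u + DD (\<lambda>y. A y (c v y)) x u"
      by (intro DD_add x DE_differentiable[OF N A] differentiable_linear_family[OF N(1,2) A(1) dA cd]) 
    also have "DD (\<lambda>y. A y (c v y)) x u = DE A x u (c v x) + A x (DD (c v) x u)"
      by (rule DD_Leibniz[OF N A(1) dA cd])
    also have "DD (\<lambda>y. DE A y v w) x u = DE (\<lambda>y. DE A y v) x u w + DE A x v (c u x)"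
      by (simp add: DD_def DE_def[of "\<lambda>y. DE A y v"] c_eq)
    finally show ?thesis .
  qed
  have "DD (c v) x u - DD (c u) x v = riemann g (\<phi> x) (fder \<phi> x u) (fder \<phi> x v) w"
    using DD_curvature[OF N smooth_on_const, of w v u] by (simp add: c_def[abs_def])
  then have 3: "A x (DD (c v) x u) - A x (DD (c u) x v) = A x (riemann g (\<phi> x) (fder \<phi> x u) (fder \<phi> x v) w)"
    by (simp add: linear_diff[OF A(1)[OF N(2)], symmetric])
  show ?thesis
    using DD_curvature[OF N A(2), of w v u] 3 unfolding 2 by (simp add: algebra_simps)
qed

end

section \<open>Parallel para-quaternionic bundles\<close>

lemma endo_span3_add:
  "A \<in> endo_span3 J1 J2 J3 \<Longrightarrow> B \<in> endo_span3 J1 J2 J3 \<Longrightarrow> (\<lambda>v. A v + B v) \<in> endo_span3 J1 J2 J3"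
proof -
  assume "A \<in> endo_span3 J1 J2 J3" "B \<in> endo_span3 J1 J2 J3"
  then obtain a b c a' b' c' where "A = (\<lambda>v. a *\<^sub>R J1 v + b *\<^sub>R J2 v + c *\<^sub>R J3 v)"
      "B = (\<lambda>v. a' *\<^sub>R J1 v + b' *\<^sub>R J2 v + c' *\<^sub>R J3 v)"
    unfolding endo_span3_def by blast
  then have "(\<lambda>v. A v + B v) = (\<lambda>v. (a + a') *\<^sub>R J1 v + (b + b') *\<^sub>R J2 v + (c + c') *\<^sub>R J3 v)"
    by (simp add: algebra_simps)
  then show ?thesis unfolding endo_span3_def by blast
qed

lemma endo_span3_scale:
  "A \<in> endo_span3 J1 J2 J3 \<Longrightarrow> (\<lambda>v. t *\<^sub>R A v) \<in> endo_span3 J1 J2 J3"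
proof -
  assume "A \<in> endo_span3 J1 J2 J3"
  then obtain a b c where "A = (\<lambda>v. a *\<^sub>R J1 v + b *\<^sub>R J2 v + c *\<^sub>R J3 v)"
    unfolding endo_span3_def by blast
  then have "(\<lambda>v. t *\<^sub>R A v) = (\<lambda>v. (t * a) *\<^sub>R J1 v + (t * b) *\<^sub>R J2 v + (t * c) *\<^sub>R J3 v)"
    by (simp add: algebra_simps)
  then show ?thesis unfolding endo_span3_def by blast
qed

lemma endo_span3_base: "J1 \<in> endo_span3 J1 J2 J3" "J2 \<in> endo_span3 J1 J2 J3" "J3 \<in> endo_span3 J1 J2 J3"
  unfolding endo_span3_def mem_Collect_eq
  by (intro exI[of _ 1] exI[of _ 0] ext, simp) (intro exI[of _ 0] exI[of _ 1] ext, simp)+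

lemma pq_basisD:
  assumes "pq_basis e1 e2 e3 Q E1 E2 E3"
  shows "Q = endo_span3 E1 E2 E3" "linear E1" "linear E2" "linear E3" "e1 \<noteq> 0" "e2 \<noteq> 0" "e3 \<noteq> 0"
proof -
  have "(e1, e2, e3) \<in> {(-1, 1, 1), (1, -1, 1), (1, 1, -1)}"
    using assms unfolding pq_basis_def by blast
  then show "e1 \<noteq> 0" "e2 \<noteq> 0" "e3 \<noteq> 0" by auto
qed (use assms in \<open>unfold pq_basis_def, blast+\<close>)

text \<open>Anticommutators with the basis elements isolate the coefficients. Applied to a fixed vector this
  exhibits the coefficients of a differentiable section as differentiable functions.\<close>

lemma pq_basis_coefficients:
  assumes pb: "pq_basis e1 e2 e3 Q E1 E2 E3" and A: "A = (\<lambda>v. a *\<^sub>R E1 v + b *\<^sub>R E2 v + c *\<^sub>R E3 v)"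
  shows "A (E1 v) + E1 (A v) = (2 * e1 * a) *\<^sub>R v" "A (E2 v) + E2 (A v) = (2 * e2 * b) *\<^sub>R v"
    "A (E3 v) + E3 (A v) = (2 * e3 * c) *\<^sub>R v"
proof -
  have lin: "linear E1" "linear E2" "linear E3" using pq_basisD[OF pb] by auto
  note ls = linear_add[OF lin(1)] linear_add[OF lin(2)] linear_add[OF lin(3)]
    linear_scale[OF lin(1)] linear_scale[OF lin(2)] linear_scale[OF lin(3)]
  have sq: "E1 (E1 v) = e1 *\<^sub>R v" "E2 (E2 v) = e2 *\<^sub>R v" "E3 (E3 v) = e3 *\<^sub>R v"
    "E1 (E2 v) = - E2 (E1 v)" "E2 (E3 v) = - E3 (E2 v)" "E3 (E1 v) = - E1 (E3 v)"
    using pb unfolding pq_basis_def by blast+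
  have t: "t *\<^sub>R v + t *\<^sub>R v = (2 * t) *\<^sub>R v" for t by (simp flip: scaleR_left_distrib)
  show "A (E1 v) + E1 (A v) = (2 * e1 * a) *\<^sub>R v" "A (E2 v) + E2 (A v) = (2 * e2 * b) *\<^sub>R v"
    "A (E3 v) + E3 (A v) = (2 * e3 * c) *\<^sub>R v"
    unfolding A using t[of "a * e1"] t[of "b * e2"] t[of "c * e3"] by (simp_all add: ls sq ac_simps)
qed

text \<open>The local content of a para-quaternionic Kaehler manifold in one chart.\<close>

locale pq_chart = pr_chart S g for S :: "'b::euclidean_space set" and g +
  fixes Q :: "'b \<Rightarrow> ('b \<Rightarrow> 'b) set"
  assumes Q_so: "y \<in> S \<Longrightarrow> Q y \<subseteq> so_alg (g y)" and Q_par: "bundle_parallel S g Q"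
    and Q_frame: "y \<in> S \<Longrightarrow> \<exists>V J1 J2 J3 e1 e2 e3. open V \<and> y \<in> V \<and> V \<subseteq> S \<and>
        (\<forall>v. smooth_on V (\<lambda>y. J1 y v) \<and> smooth_on V (\<lambda>y. J2 y v) \<and> smooth_on V (\<lambda>y. J3 y v)) \<and>
        (\<forall>y\<in>V. pq_basis e1 e2 e3 (Q y) (J1 y) (J2 y) (J3 y))"
begin

lemma Q_frameE:
  assumes y: "y \<in> S"
  obtains V E1 E2 E3 e1 e2 e3 where "open V" "y \<in> V" "V \<subseteq> S"
    "\<forall>v. smooth_on V (\<lambda>y. E1 y v)" "\<forall>v. smooth_on V (\<lambda>y. E2 y v)" "\<forall>v. smooth_on V (\<lambda>y. E3 y v)"
    "\<forall>y\<in>V. pq_basis e1 e2 e3 (Q y) (E1 y) (E2 y) (E3 y)"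
proof -
  obtain V E1 E2 E3 e1 e2 e3 where *: "open V \<and> y \<in> V \<and> V \<subseteq> S \<and>
        (\<forall>v. smooth_on V (\<lambda>y. E1 y v) \<and> smooth_on V (\<lambda>y. E2 y v) \<and> smooth_on V (\<lambda>y. E3 y v)) \<and>
        (\<forall>y\<in>V. pq_basis e1 e2 e3 (Q y) (E1 y) (E2 y) (E3 y))"
    using Q_frame[OF y] by (elim exE) (rule that)
  show ?thesis by (rule that[of V E1 E2 E3 e1 e2 e3]) (use * in auto)
qed

lemma Q_span: "y \<in> S \<Longrightarrow> \<exists>J1 J2 J3. Q y = endo_span3 J1 J2 J3"
  by (erule Q_frameE) (blast dest: pq_basisD(1))

lemma Q_add: "y \<in> S \<Longrightarrow> A \<in> Q y \<Longrightarrow> B \<in> Q y \<Longrightarrow> (\<lambda>v. A v + B v) \<in> Q y"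
  and Q_scale: "y \<in> S \<Longrightarrow> A \<in> Q y \<Longrightarrow> (\<lambda>v. t *\<^sub>R A v) \<in> Q y"
  using Q_span[of y] endo_span3_add[of A] endo_span3_scale[of A] by auto

lemma Q_diff: "y \<in> S \<Longrightarrow> A \<in> Q y \<Longrightarrow> B \<in> Q y \<Longrightarrow> (\<lambda>v. A v - B v) \<in> Q y"
  using Q_add[of y A "\<lambda>v. (-1) *\<^sub>R B v"] Q_scale[of y B "-1"] by simp

lemma Q_linear: "y \<in> S \<Longrightarrow> A \<in> Q y \<Longrightarrow> linear A"
  using Q_so so_algD(1) by blast

end

locale pq_map = pr_map S g U \<phi> + pq_chart S g Q
  for S :: "'b::euclidean_space set" and g and U :: "'a::euclidean_space set" and \<phi> and Q
begin

lemma preimage_open: "open N \<Longrightarrow> N \<subseteq> U \<Longrightarrow> open V \<Longrightarrow> open (N \<inter> \<phi> -` V)"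
  using continuous_open_preimage[OF continuous_on_subset[OF smooth_on_continuous[OF \<phi>_smooth]]] by blast

text \<open>The hypothesis on \<open>Q\<close> speaks of smooth sections over open sets of the ambient manifold. A
  section along \<open>\<phi>\<close> that is merely differentiable is a combination of a pulled-back smooth frame with
  differentiable coefficients, and the derivatives of both factors stay in \<open>Q\<close>.\<close>

lemma DE_section:
  assumes N: "open N" "x \<in> N" "N \<subseteq> U" and A: "\<And>y. y \<in> N \<Longrightarrow> A y \<in> Q (\<phi> y)"
    and dA: "\<And>v. (\<lambda>y. A y v) differentiable (at x)"
  shows "DE A x u \<in> Q (\<phi> x)"
proof -
  have x: "x \<in> U" using N by auto
  obtain V E1 E2 E3 e1 e2 e3 where V: "open V" "\<phi> x \<in> V" "V \<subseteq> S"
    and E: "\<forall>v. smooth_on V (\<lambda>y. E1 y v)" "\<forall>v. smooth_on V (\<lambda>y. E2 y v)" "\<forall>v. smooth_on V (\<lambda>y. E3 y v)"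
    and pb: "\<forall>y\<in>V. pq_basis e1 e2 e3 (Q y) (E1 y) (E2 y) (E3 y)"
    by (rule Q_frameE[OF \<phi>_in[OF x]])
  note E_smooth = E[rule_format] and pb = pb[rule_format]
  have QV: "Q y = endo_span3 (E1 y) (E2 y) (E3 y)" if "y \<in> V" for y
    by (rule pq_basisD(1)[OF pb[OF that]])
  have e: "e1 \<noteq> 0" "e2 \<noteq> 0" "e3 \<noteq> 0" using pq_basisD[OF pb[OF V(2)]] by auto
  have E_Q: "E1 y \<in> Q y" "E2 y \<in> Q y" "E3 y \<in> Q y" if "y \<in> V" for y
    using endo_span3_base QV[OF that] by auto
  define N' where "N' = N \<inter> \<phi> -` V"
  have N': "open N'" "x \<in> N'" "N' \<subseteq> U" using preimage_open[OF N(1,3) V(1)] N V by (auto simp: N'_def)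
  obtain v0 :: 'b where v0: "v0 \<noteq> 0" using nonempty_Basis nonzero_Basis by blast
  \<comment> \<open>The factor in front undoes the scaling by \<open>2 e (v0 \<bullet> v0)\<close> in \<open>pq_basis_coefficients\<close>.\<close>
  define cf where "cf E e y = ((A y (E (\<phi> y) v0) + E (\<phi> y) (A y v0)) \<bullet> v0) * (1 / (2 * e * (v0 \<bullet> v0)))"
    for E :: "'b \<Rightarrow> 'b \<Rightarrow> 'b" and e y
  have A_eq: "A y = (\<lambda>v. cf E1 e1 y *\<^sub>R E1 (\<phi> y) v + (cf E2 e2 y *\<^sub>R E2 (\<phi> y) v + cf E3 e3 y *\<^sub>R E3 (\<phi> y) v))"
    if y: "y \<in> N'" for y
  proof -
    have yV: "\<phi> y \<in> V" "y \<in> N" using y by (auto simp: N'_def)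
    obtain a b c where abc: "A y = (\<lambda>v. a *\<^sub>R E1 (\<phi> y) v + b *\<^sub>R E2 (\<phi> y) v + c *\<^sub>R E3 (\<phi> y) v)"
      using A[OF yV(2)] unfolding QV[OF yV(1)] endo_span3_def by blast
    note co = pq_basis_coefficients[OF pb[OF yV(1)] abc, of v0]
    have "cf E1 e1 y = a" "cf E2 e2 y = b" "cf E3 e3 y = c"
      unfolding cf_def co using v0 e by auto
    then show ?thesis by (simp add: abc add.assoc)
  qed
  have dE: "(\<lambda>y. E (\<phi> y) v) differentiable (at x)" if "\<And>v. smooth_on V (\<lambda>y. E y v)" for E :: "'b \<Rightarrow> 'b \<Rightarrow> 'b" and v
    by (rule differentiable_compose_at[OF \<phi>_diff[OF x] smooth_on_differentiable[OF that V(2)]])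
  have dcf: "cf E e differentiable (at x)"
    if "\<And>v. smooth_on V (\<lambda>y. E y v)" "\<And>y. y \<in> V \<Longrightarrow> linear (E y)" for E e
  proof -
    have 1: "(\<lambda>y. A y (E (\<phi> y) v0)) differentiable (at x)"
      by (rule differentiable_linear_family[OF N(1,2) _ dA dE[OF that(1)]])
        (use A Q_linear \<phi>_in N in blast)
    have 2: "(\<lambda>y. E (\<phi> y) (A y v0)) differentiable (at x)"
      by (rule differentiable_linear_family[OF N'(1,2) _ dE[OF that(1)] dA])
        (use that(2) in \<open>auto simp: N'_def\<close>)
    show ?thesis
      unfolding cf_def[abs_def]
      by (intro differentiable_mult differentiable_inner_left differentiable_add 1 2) simp
  qed
  have E_lin: "linear (E1 y)" "linear (E2 y)" "linear (E3 y)" if "y \<in> V" for y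
    using pq_basisD[OF pb[OF that]] by auto
  have summand: "(\<lambda>v. DE (\<lambda>y v. cf E e y *\<^sub>R E (\<phi> y) v) x u v) \<in> Q (\<phi> x)"
    and dsummand: "\<And>v. (\<lambda>y. cf E e y *\<^sub>R E (\<phi> y) v) differentiable (at x)"
    if E: "\<And>v. smooth_on V (\<lambda>y. E y v)" "\<And>y. y \<in> V \<Longrightarrow> E y \<in> Q y" for E e
  proof -
    have lin: "\<And>y. y \<in> V \<Longrightarrow> linear (E y)" using E(2) Q_linear V(3) by blast
    have "cov_endo Gm E (\<phi> x) (fder \<phi> x u) \<in> Q (\<phi> x)"
      using Q_par E V unfolding bundle_parallel_def by blast
    moreover have "DE (\<lambda>y v. cf E e y *\<^sub>R E (\<phi> y) v) x u v
        = fder (cf E e) x u *\<^sub>R E (\<phi> x) v + cf E e x *\<^sub>R cov_endo Gm E (\<phi> x) (fder \<phi> x u) v" for v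
      using DE_scaleR[OF x dcf[OF E(1) lin] dE[OF E(1)], where u=u and v=v]
      by (simp add: DE_pullback[OF x smooth_on_differentiable[OF E(1) V(2)]])
    ultimately show "(\<lambda>v. DE (\<lambda>y v. cf E e y *\<^sub>R E (\<phi> y) v) x u v) \<in> Q (\<phi> x)"
      using Q_add[OF \<phi>_in[OF x] Q_scale[OF \<phi>_in[OF x] E(2)[OF V(2)]] Q_scale[OF \<phi>_in[OF x]]] by simp
    show "(\<lambda>y. cf E e y *\<^sub>R E (\<phi> y) v) differentiable (at x)" for v
      by (rule differentiable_scaleR_at[OF dcf[OF E(1) lin] dE[OF E(1)]])
  qed
  have "DE A x u v = DE (\<lambda>y v. cf E1 e1 y *\<^sub>R E1 (\<phi> y) v + (cf E2 e2 y *\<^sub>R E2 (\<phi> y) v + cf E3 e3 y *\<^sub>R E3 (\<phi> y) v)) x u v" for v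
    by (rule fun_cong[OF DE_cong[OF N'(1,2) A_eq]])
  also have "\<dots> v = DE (\<lambda>y v. cf E1 e1 y *\<^sub>R E1 (\<phi> y) v) x u v + (DE (\<lambda>y v. cf E2 e2 y *\<^sub>R E2 (\<phi> y) v) x u v
      + DE (\<lambda>y v. cf E3 e3 y *\<^sub>R E3 (\<phi> y) v) x u v)" for v
    by (simp add: DE_add[OF x] dsummand E_smooth E_Q differentiable_add)
  finally have "DE A x u = (\<lambda>v. DE (\<lambda>y v. cf E1 e1 y *\<^sub>R E1 (\<phi> y) v) x u v + (DE (\<lambda>y v. cf E2 e2 y *\<^sub>R E2 (\<phi> y) v) x u v
      + DE (\<lambda>y v. cf E3 e3 y *\<^sub>R E3 (\<phi> y) v) x u v))" by blast
  then show ?thesis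
    using Q_add[OF \<phi>_in[OF x] summand[OF E_smooth(1) E_Q(1)] Q_add[OF \<phi>_in[OF x] summand[OF E_smooth(2) E_Q(2)] summand[OF E_smooth(3) E_Q(3)]]]
    by simp
qed

end

context pq_chart
begin

text \<open>Two derivatives of a frame field of \<open>Q\<close> stay in \<open>Q\<close>, and their commutator is the commutator with
  the curvature. This is the case \<open>\<phi> = id\<close> of the calculus above.\<close>

lemma riemann_normalizes:
  assumes y: "y \<in> S" and A: "A \<in> Q y"
  shows "(\<lambda>v. A (riemann g y X Y v) - riemann g y X Y (A v)) \<in> Q y"
proof -
  interpret I: pq_map S g S "\<lambda>x. x" Q
    by unfold_locales (auto simp: S_open smooth_on_ident)
  obtain V E1 E2 E3 e1 e2 e3 where V: "open V" "y \<in> V" "V \<subseteq> S"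
    and E: "\<forall>v. smooth_on V (\<lambda>y. E1 y v)" "\<forall>v. smooth_on V (\<lambda>y. E2 y v)" "\<forall>v. smooth_on V (\<lambda>y. E3 y v)"
    and pb: "\<forall>y\<in>V. pq_basis e1 e2 e3 (Q y) (E1 y) (E2 y) (E3 y)"
    by (rule Q_frameE[OF y])
  note E_smooth = E[rule_format] and pb = pb[rule_format]
  have QV: "Q y = endo_span3 (E1 y) (E2 y) (E3 y)" if "y \<in> V" for y
    by (rule pq_basisD(1)[OF pb[OF that]])
  have E_Q: "E1 y \<in> Q y" "E2 y \<in> Q y" "E3 y \<in> Q y" if "y \<in> V" for y
    using endo_span3_base QV[OF that] by auto
  have key: "(\<lambda>v. E y (riemann g y X Y v) - riemann g y X Y (E y v)) \<in> Q y"
    if E: "\<And>v. smooth_on V (\<lambda>y. E y v)" "\<And>y. y \<in> V \<Longrightarrow> E y \<in> Q y" for E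
  proof -
    have lin: "\<And>y. y \<in> V \<Longrightarrow> linear (E y)" using E(2) Q_linear V(3) by blast
    have 1: "I.DE E z w \<in> Q z" if "z \<in> V" for z w
      by (rule I.DE_section[OF V(1) that V(3) E(2) smooth_on_differentiable[OF E(1) that]])
    have 2: "I.DE (\<lambda>z. I.DE E z w) y w' \<in> Q y" for w w'
      by (rule I.DE_section[OF V 1 I.DE_differentiable[OF V lin E(1)]])
    have "E y (riemann g y X Y v) - riemann g y X Y (E y v)
        = I.DE (\<lambda>z. I.DE E z X) y Y v - I.DE (\<lambda>z. I.DE E z Y) y X v" for v
      using I.DE_curvature[OF V lin E(1), of Y X v] by (simp add: algebra_simps)
    then show ?thesis using Q_diff[OF y 2 2] by simp
  qed
  obtain a b c where abc: "A = (\<lambda>v. a *\<^sub>R E1 y v + b *\<^sub>R E2 y v + c *\<^sub>R E3 y v)"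
    using A unfolding QV[OF V(2)] endo_span3_def by blast
  have linR: "linear (riemann g y X Y)"
    by (rule so_algD(1)[OF curvature_spaceD(4)[OF riemann_curvature_space[OF y]]])
  have "(\<lambda>v. A (riemann g y X Y v) - riemann g y X Y (A v))
    = (\<lambda>v. a *\<^sub>R (E1 y (riemann g y X Y v) - riemann g y X Y (E1 y v))
        + (b *\<^sub>R (E2 y (riemann g y X Y v) - riemann g y X Y (E2 y v))
        + c *\<^sub>R (E3 y (riemann g y X Y v) - riemann g y X Y (E3 y v))))"
    by (simp add: abc linear_add[OF linR] linear_scale[OF linR] algebra_simps)
  then show ?thesis
    using Q_add[OF y Q_scale[OF y key[OF E_smooth(1) E_Q(1)]] Q_add[OF y Q_scale[OF y key[OF E_smooth(2) E_Q(2)]]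
        Q_scale[OF y key[OF E_smooth(3) E_Q(3)]]]] by simp
qed

text \<open>So a nonzero scalar curvature forces a nonzero Ricci form.\<close>

lemma scal_zero_if_Ricci_flat:
  assumes y: "y \<in> S" and Ric: "\<And>Y Z. ricci g y Y Z = 0"
  shows "scal g y = 0"
proof -
  interpret pseudo_euclidean "g y" by (rule g_pseudo_euclidean[OF y])
  have "(THE A. linear A \<and> (\<forall>Y Z. g y (A Y) Z = ricci g y Y Z)) = (\<lambda>v. 0)"
  proof (rule the_equality)
    show "linear (\<lambda>v::'b. 0::'b) \<and> (\<forall>Y Z. g y 0 Z = ricci g y Y Z)"
      by (auto simp: Ric b_simps intro: linearI)
    show "A = (\<lambda>v. 0)" if "linear A \<and> (\<forall>Y Z. g y (A Y) Z = ricci g y Y Z)" for A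
      using that eq_zeroI by (auto simp: Ric)
  qed
  then show ?thesis by (simp add: scal_def tr_def)
qed

text \<open>This is the way in which the nonvanishing of the scalar curvature enters: the commutator of the
  curvature with \<open>J1\<close> determines the forms \<open>g (X, J2 Y)\<close> and \<open>g (X, J3 Y)\<close>.\<close>

lemma riemann_commutator:
  assumes y: "y \<in> S" and dim: "DIM('b) > 4" and scal: "scal g y \<noteq> 0"
    and \<epsilon>: "\<epsilon> * \<epsilon> = 1" and QJ: "Q y = endo_span3 J1 J2 J3"
    and sq: "\<And>v. J1 (J1 v) = \<epsilon> *\<^sub>R v" "\<And>v. J2 (J2 v) = v" and J3: "\<And>v. J3 v = J1 (J2 v)" "\<And>v. J3 v = - J2 (J1 v)"
  obtains lam where "lam \<noteq> 0"
    "\<And>X Y v. J1 (riemann g y X Y v) - riemann g y X Y (J1 v)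
      = lam *\<^sub>R (g y X (J2 Y) *\<^sub>R J3 v) - lam *\<^sub>R (g y X (J3 Y) *\<^sub>R J2 v)"
proof -
  have so: "J1 \<in> so_alg (g y)" "J2 \<in> so_alg (g y)"
    using Q_so[OF y] endo_span3_base unfolding QJ by blast+
  interpret pseudo_euclidean "g y" by (rule g_pseudo_euclidean[OF y])
  interpret pq_curvature "g y" "riemann g y" J1 J2 J3 \<epsilon> 1
    by unfold_locales
      (use riemann_curvature_space[OF y] \<epsilon> so sq J3 riemann_normalizes[OF y] in \<open>auto simp: QJ, metis minus_equation_iff J3\<close>)
  obtain X0 Y0 where "ricci g y X0 Y0 \<noteq> 0" using scal_zero_if_Ricci_flat[OF y] scal by blast
  then have "Ric X0 Y0 \<noteq> 0" by (simp add: Ric_def ricci_def)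
  from commutator_J1[OF dim this] that show ?thesis by auto
qed

end

section \<open>Nondegenerate immersions\<close>

locale pr_immersion = pr_map S g U \<phi>
  for S :: "'b::euclidean_space set" and g and U :: "'a::euclidean_space set" and \<phi> +
  assumes immersion: "x \<in> U \<Longrightarrow> inj (fder \<phi> x)"
    and gi_nondeg: "x \<in> U \<Longrightarrow> nondegenerate (induced_metric g \<phi> x)"
begin

abbreviation gi where "gi \<equiv> induced_metric g \<phi>"
abbreviation h where "h \<equiv> second_fundamental_form g \<phi>"

text \<open>The tangential part of the ambient derivative; it is shown below to be the Levi-Civita connection
  of the induced metric.\<close>

definition Gi where "Gi x u v = tan_part g \<phi> x (DD (\<lambda>y. fder \<phi> y v) x u)"

lemma gi_pseudo_euclidean:
  assumes x: "x \<in> U" shows "pseudo_euclidean (gi x)"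
proof -
  note [simp] = linear_add[OF d\<phi>_lin[OF x]] linear_scale[OF d\<phi>_lin[OF x]]
    linear_add[OF g_lin(1)[OF \<phi>_in[OF x]]] linear_scale[OF g_lin(1)[OF \<phi>_in[OF x]]]
    linear_add[OF g_lin(2)[OF \<phi>_in[OF x]]] linear_scale[OF g_lin(2)[OF \<phi>_in[OF x]]]
  have "bilinear (gi x)"
    unfolding bilinear_def by (intro conjI allI; rule linearI) (simp_all add: induced_metric_def)
  then show ?thesis
    using gi_nondeg[OF x] g_sym[OF \<phi>_in[OF x]] by (simp add: pseudo_euclidean_def induced_metric_def)
qed

lemma gi_eqI: "x \<in> U \<Longrightarrow> (\<And>v. g (\<phi> x) (fder \<phi> x u) (fder \<phi> x v) = g (\<phi> x) (fder \<phi> x w) (fder \<phi> x v)) \<Longrightarrow> u = w"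
  using pseudo_euclidean.eqI[OF gi_pseudo_euclidean, of x u w] by (simp add: induced_metric_def)

lemma tangent_orthogonal_zero:
  assumes x: "x \<in> U" and o: "\<And>v. g (\<phi> x) (fder \<phi> x u) (fder \<phi> x v) = 0" shows "u = 0"
  using pseudo_euclidean.eq_zeroI[OF gi_pseudo_euclidean[OF x], of u] o by (simp add: induced_metric_def)

lemma tan_part_eqI:
  assumes x: "x \<in> U" and eq: "\<And>v. g (\<phi> x) w (fder \<phi> x v) = g (\<phi> x) (fder \<phi> x u) (fder \<phi> x v)"
  shows "tan_part g \<phi> x w = u"
  unfolding tan_part_def
proof (rule the_equality)
  show "\<forall>v. g (\<phi> x) (w - fder \<phi> x u) (fder \<phi> x v) = 0"
    by (simp add: linear_diff[OF g_lin(1)[OF \<phi>_in[OF x]]] eq)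
  show "u' = u" if "\<forall>v. g (\<phi> x) (w - fder \<phi> x u') (fder \<phi> x v) = 0" for u'
    by (rule gi_eqI[OF x]) (use that eq in \<open>simp add: linear_diff[OF g_lin(1)[OF \<phi>_in[OF x]]]\<close>)
qed

lemma tan_part_works:
  assumes x: "x \<in> U"
  shows "g (\<phi> x) (fder \<phi> x (tan_part g \<phi> x w)) (fder \<phi> x v) = g (\<phi> x) w (fder \<phi> x v)"
proof -
  interpret i: pseudo_euclidean "gi x" by (rule gi_pseudo_euclidean[OF x])
  have "linear (\<lambda>v. g (\<phi> x) w (fder \<phi> x v))"
    using linear_compose[OF d\<phi>_lin[OF x] g_lin(2)[OF \<phi>_in[OF x]]] by (simp add: o_def)
  then obtain u where "\<forall>v. gi x u v = g (\<phi> x) w (fder \<phi> x v)"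
    using nondegenerate_representation[OF i.bil i.nondeg] by blast
  then have u: "\<And>v. g (\<phi> x) w (fder \<phi> x v) = g (\<phi> x) (fder \<phi> x u) (fder \<phi> x v)"
    by (simp add: induced_metric_def)
  show ?thesis unfolding tan_part_eqI[OF x u] u ..
qed

lemma tan_part_linear: assumes x: "x \<in> U" shows "linear (tan_part g \<phi> x)"
  by (rule linearI; rule tan_part_eqI[OF x])
    (simp_all add: linear_add[OF d\<phi>_lin[OF x]] linear_scale[OF d\<phi>_lin[OF x]]
    linear_add[OF g_lin(1)[OF \<phi>_in[OF x]]] linear_scale[OF g_lin(1)[OF \<phi>_in[OF x]]] tan_part_works[OF x])

lemma h_eq: "h x u v = DD (\<lambda>y. fder \<phi> y v) x u - fder \<phi> x (Gi x u v)"
  by (simp add: second_fundamental_form_def nor_part_def Gi_def DD_def)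

lemma gauss_formula: "DD (\<lambda>y. fder \<phi> y v) x u = fder \<phi> x (Gi x u v) + h x u v"
  by (simp add: h_eq)

lemma Gi_works: "x \<in> U \<Longrightarrow> g (\<phi> x) (fder \<phi> x (Gi x u v)) (fder \<phi> x w) = g (\<phi> x) (DD (\<lambda>y. fder \<phi> y v) x u) (fder \<phi> x w)"
  unfolding Gi_def by (rule tan_part_works)

lemma h_normal: "x \<in> U \<Longrightarrow> g (\<phi> x) (h x u v) (fder \<phi> x w) = 0"
  by (simp add: h_eq linear_diff[OF g_lin(1)[OF \<phi>_in]] Gi_works)

lemma h_normal': "x \<in> U \<Longrightarrow> g (\<phi> x) (fder \<phi> x w) (h x u v) = 0"
  using h_normal g_sym[OF \<phi>_in] by metis

lemma Gi_sym: "x \<in> U \<Longrightarrow> Gi x u v = Gi x v u"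
  by (simp add: Gi_def DD_torsion_free)

lemma h_sym: "x \<in> U \<Longrightarrow> h x u v = h x v u"
  by (simp add: h_eq Gi_sym[of x u v] DD_torsion_free)

lemma DD_tangent_lin:
  assumes x: "x \<in> U" shows "linear (DD (\<lambda>y. fder \<phi> y v) x)"
  unfolding DD_def
  by (rule linearI) (simp_all add: linear_add[OF d\<phi>_lin[OF x]] linear_scale[OF d\<phi>_lin[OF x]]
      linear_add[OF fder_linear[OF d\<phi>_diff[OF x]]] linear_scale[OF fder_linear[OF d\<phi>_diff[OF x]]]
      linear_add[OF Gm_lin(1)[OF \<phi>_in[OF x]]] linear_scale[OF Gm_lin(1)[OF \<phi>_in[OF x]]] algebra_simps)

lemma Gi_lin: assumes x: "x \<in> U" shows "linear (\<lambda>u. Gi x u v)" "linear (Gi x u)"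
proof -
  show "linear (\<lambda>u. Gi x u v)" for v
    unfolding Gi_def using linear_compose[OF DD_tangent_lin[OF x] tan_part_linear[OF x]] by (simp add: o_def)
  then show "linear (Gi x u)" using Gi_sym[OF x, of u] by presburger
qed

lemma h_lin: assumes x: "x \<in> U" shows "linear (\<lambda>u. h x u v)" "linear (h x u)"
proof -
  show "linear (\<lambda>u. h x u v)" for v
    unfolding h_eq by (intro linear_compose_sub DD_tangent_lin[OF x])
      (use linear_compose[OF Gi_lin(1)[OF x] d\<phi>_lin[OF x]] in \<open>simp add: o_def\<close>)
  then show "linear (h x u)" using h_sym[OF x, of u] by presburger
qed

lemma Gi_differentiable:
  assumes x: "x \<in> U" shows "(\<lambda>y. Gi y u v) differentiable (at x)"
proof (rule differentiable_solution[where b = gi and U = U])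
  show "open U" "x \<in> U" "nondegenerate (gi x)" by (rule U_open, rule x, rule gi_nondeg[OF x])
  show "y \<in> U \<Longrightarrow> bilinear (gi y)" for y using pseudo_euclidean.bil[OF gi_pseudo_euclidean] .
  show "(\<lambda>y. gi y u v) differentiable (at x)" for u v
    unfolding induced_metric_def by (intro metric_along_differentiable x d\<phi>_diff)
  show "(\<lambda>y. g (\<phi> y) (DD (\<lambda>y. fder \<phi> y v) y u) (fder \<phi> y w)) differentiable (at x)" for w
    by (intro metric_along_differentiable x d\<phi>_diff DD_differentiable[OF U_open x order_refl smooth_on_fder[OF \<phi>_smooth]])
  show "y \<in> U \<Longrightarrow> gi y (Gi y u v) w = g (\<phi> y) (DD (\<lambda>y. fder \<phi> y v) y u) (fder \<phi> y w)" for y w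
    by (simp add: induced_metric_def Gi_works)
qed

lemma levi_civita_induced: 
  assumes x: "x \<in> U" shows "levi_civita gi x = Gi x"
proof (rule levi_civita_eqI[of gi x "Gi x", OF gi_pseudo_euclidean[OF x]])
  show "bilinear (Gi x)" using Gi_lin[OF x] by (simp add: bilinear_def)
  show "Gi x u v = Gi x v u" for u v by (rule Gi_sym[OF x])
  show "fder (\<lambda>y. gi y u v) x w = gi x (Gi x w u) v + gi x u (Gi x w v)" for u v w
    unfolding induced_metric_def DD_metric[OF x d\<phi>_diff[OF x] d\<phi>_diff[OF x]]
    using Gi_works[OF x, of w u v] Gi_works[OF x, of w v u]
      g_sym[OF \<phi>_in[OF x], of "fder \<phi> x u" "fder \<phi> x (Gi x w v)"]
      g_sym[OF \<phi>_in[OF x], of "fder \<phi> x u" "DD (\<lambda>y. fder \<phi> y v) x w"]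
    by simp
qed

lemma DD_tangent:
  assumes x: "x \<in> U" and s: "s differentiable (at x)"
  shows "DD (\<lambda>y. fder \<phi> y (s y)) x u = fder \<phi> x (fder s x u + Gi x u (s x)) + h x u (s x)"
proof -
  have "DD (\<lambda>y. fder \<phi> y (s y)) x u = DD (\<lambda>y. fder \<phi> y (s x)) x u + fder \<phi> x (fder s x u)"
    using fder_linear_family[OF U_open x d\<phi>_lin d\<phi>_diff[OF x] s, of u] by (simp add: DD_def)
  then show ?thesis by (simp add: gauss_formula linear_add[OF d\<phi>_lin[OF x]])
qed

text \<open>Differentiating the orthogonality of \<open>K T\<close> and \<open>T\<close>, for a field \<open>K\<close> of skew endomorphisms, links
  the derivative of \<open>K\<close> with the second fundamental form. It is used with \<open>J2\<close> and \<open>J3\<close> for \<open>K\<close>, first to show that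
  \<open>J1\<close> is parallel and then for the symmetries of the shape tensor.\<close>

lemma orthogonality_derivative:
  assumes N: "open N" "x \<in> N" "N \<subseteq> U" and K: "\<And>y. y \<in> N \<Longrightarrow> linear (K y)" "\<And>v. (\<lambda>y. K y v) differentiable (at x)"
    and skew: "K x \<in> so_alg (g (\<phi> x))"
    and orth: "\<And>y u v. y \<in> N \<Longrightarrow> g (\<phi> y) (K y (fder \<phi> y u)) (fder \<phi> y v) = 0"
  shows "g (\<phi> x) (DE K x w (fder \<phi> x u)) (fder \<phi> x v)
    = g (\<phi> x) (K x (h x w v)) (fder \<phi> x u) - g (\<phi> x) (K x (h x w u)) (fder \<phi> x v)"
proof -
  have x: "x \<in> U" using N by auto
  note lin = linear_add[OF K(1)[OF N(2)]] linear_add[OF g_lin(1)[OF \<phi>_in[OF x]]] linear_add[OF g_lin(2)[OF \<phi>_in[OF x]]]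
  have "0 = fder (\<lambda>y. g (\<phi> y) (K y (fder \<phi> y u)) (fder \<phi> y v)) x w"
    using fder_cong[OF N(1,2), of "\<lambda>y. g (\<phi> y) (K y (fder \<phi> y u)) (fder \<phi> y v)" "\<lambda>y. 0" w] orth by simp
  also have "\<dots> = g (\<phi> x) (DD (\<lambda>y. K y (fder \<phi> y u)) x w) (fder \<phi> x v)
      + g (\<phi> x) (K x (fder \<phi> x u)) (DD (\<lambda>y. fder \<phi> y v) x w)"
    by (rule DD_metric[OF x differentiable_linear_family[OF N(1,2) K d\<phi>_diff[OF x]] d\<phi>_diff[OF x]])
  also have "DD (\<lambda>y. K y (fder \<phi> y u)) x w = DE K x w (fder \<phi> x u) + K x (fder \<phi> x (Gi x w u) + h x w u)"
    unfolding gauss_formula[symmetric] by (rule DD_Leibniz[OF N K d\<phi>_diff[OF x]])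
  also have "g (\<phi> x) (K x (fder \<phi> x u)) (DD (\<lambda>y. fder \<phi> y v) x w) = g (\<phi> x) (K x (fder \<phi> x u)) (h x w v)"
    unfolding gauss_formula by (simp add: lin orth N)
  also have "\<dots> = - g (\<phi> x) (K x (h x w v)) (fder \<phi> x u)"
    using so_algD(2)[OF skew] g_sym[OF \<phi>_in[OF x]] by metis
  finally show ?thesis by (simp add: lin orth N)
qed

end

section \<open>Divisibility of symplectic forms\<close>

lemma common_kernel:
  fixes l m :: "'a::euclidean_space \<Rightarrow> real"
  assumes "linear l" "linear m" "DIM('a) > 2"
  obtains u where "u \<noteq> 0" "l u = 0" "m u = 0"
proof -
  define p where "p = (\<Sum>i\<in>Basis. l i *\<^sub>R i)"
  define q where "q = (\<Sum>i\<in>Basis. m i *\<^sub>R i)"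
  have pq: "l u = p \<bullet> u" "m u = q \<bullet> u" for u
    using linear_basis_expansion[OF assms(1), of u] linear_basis_expansion[OF assms(2), of u]
    by (simp_all add: p_def q_def inner_sum_left inner_commute[of u] mult.commute)
  have "dim {p, q} \<le> card {p, q}" by (rule dim_le_card) (auto intro: span_base)
  also have "card {p, q} \<le> 2" by (simp add: card_insert_if)
  finally have "dim {p, q} < DIM('a)" using assms(3) by simp
  then obtain u where u: "u \<noteq> 0" and ort: "\<And>y. y \<in> span {p, q} \<Longrightarrow> orthogonal u y"
    by (rule orthogonal_to_subspace_exists) blast
  have "p \<in> span {p, q}" "q \<in> span {p, q}" by (auto intro: span_base)
  then have "u \<bullet> p = 0" "u \<bullet> q = 0" using ort by (auto simp: orthogonal_def)
  then show ?thesis using that[OF u] by (simp add: pq inner_commute)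
qed

text \<open>A symplectic form \<open>F\<close> on a space of dimension greater than 2 is not divisible by a 1-form: \<open>c \<and> F = 0\<close>
  implies \<open>c = 0\<close>. If \<open>c w \<noteq> 0\<close>, then \<open>F\<close> is a combination of products of \<open>c\<close> and \<open>F w\<close>, so a nonzero
  vector killed by both would be in its kernel.\<close>

lemma symplectic_form_not_divisible:
  fixes F :: "'a::euclidean_space \<Rightarrow> 'a \<Rightarrow> real" and c :: "'a \<Rightarrow> real"
  assumes dim: "DIM('a) > 2" and lin: "\<And>v. linear (\<lambda>u. F u v)" and alt: "\<And>u v. F u v = - F v u"
    and nondeg: "nondegenerate F" and cyc: "\<And>w u v. c w * F u v + c u * F v w + c v * F w u = 0"
  shows "c w = 0"
proof (rule ccontr)
  assume c: "c w \<noteq> 0"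
  obtain z :: 'a where z: "z \<noteq> 0" using nonempty_Basis nonzero_Basis by blast
  have nd: "(\<And>v. F u v = 0) \<Longrightarrow> u = 0" for u using nondeg by (auto simp: nondegenerate_def)
  obtain v where v: "F w v \<noteq> 0"
  proof (rule ccontr)
    assume "\<not> thesis"
    then have 0: "F w v = 0" for v using that by blast
    then have "F z v = 0" for v using cyc[of w z v] alt[of v w] c by simp
    then show False using nd z by blast
  qed
  \<comment> \<open>By the cyclic identity for \<open>w, u, v\<close>, a vector killed by \<open>F w\<close> and \<open>F v\<close> is killed by \<open>c\<close> as well.\<close>
  obtain u where u: "u \<noteq> 0" "F u w = 0" "F u v = 0"
    using common_kernel[OF lin lin dim] by blast
  have "c u = 0" using cyc[of w u v] u v alt[of v w] alt[of w u] by simp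
  then have "F u t = 0" for t using cyc[of w u t] u alt[of w u] c by simp
  then show False using nd u by blast
qed

section \<open>Parallel Kaehler form implies totally complex\<close>

text \<open>The local content of the hypotheses on the submanifold, over the domain \<open>U\<close> of an adapted basis.
  The last assumption is the parallelism required of surfaces.\<close>

locale eps_submanifold = pq_map S g U \<phi> Q + pr_immersion S g U \<phi>
  for S :: "'b::euclidean_space set" and g and U :: "'a::euclidean_space set"
    and \<phi> :: "'a \<Rightarrow> 'b" and Q :: "'b \<Rightarrow> ('b \<Rightarrow> 'b) set" +
  fixes \<epsilon> :: real and J1 J2 J3 :: "'a \<Rightarrow> 'b \<Rightarrow> 'b" and n :: nat
  assumes eps: "\<epsilon> \<in> {-1, 1}" and dim_b: "DIM('b) = 4 * n" and dim_a: "DIM('a) = 2 * n"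
    and J_smooth: "smooth_on U (\<lambda>x. J1 x v)" "smooth_on U (\<lambda>x. J2 x v)" "smooth_on U (\<lambda>x. J3 x v)"
    and Q_J: "x \<in> U \<Longrightarrow> Q (\<phi> x) = endo_span3 (J1 x) (J2 x) (J3 x)"
    and J1_sq: "x \<in> U \<Longrightarrow> J1 x (J1 x w) = \<epsilon> *\<^sub>R w" and J2_sq: "x \<in> U \<Longrightarrow> J2 x (J2 x w) = w"
    and J3_eq: "x \<in> U \<Longrightarrow> J3 x w = J1 x (J2 x w)" and J3_eq': "x \<in> U \<Longrightarrow> J3 x w = - J2 x (J1 x w)"
    and J1_tangent: "x \<in> U \<Longrightarrow> J1 x (fder \<phi> x u) \<in> range (fder \<phi> x)"
    and curv_inv: "x \<in> U \<Longrightarrow>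
      riemann g (\<phi> x) (fder \<phi> x X) (fder \<phi> x Y) (fder \<phi> x Z) \<in> range (fder \<phi> x)"
    and F_parallel: "x \<in> U \<Longrightarrow>
      cov_form (levi_civita (induced_metric g \<phi>)) (\<lambda>x u v. induced_metric g \<phi> x (restrict_endo \<phi> J1 x u) v) x X Y Z = 0"
    and scal_nonzero: "y \<in> S \<Longrightarrow> scal g y \<noteq> 0"
    and surface: "n = 1 \<Longrightarrow> x \<in> U \<Longrightarrow> DE J1 x u v = 0"
begin

lemma eps_sq: "\<epsilon> * \<epsilon> = 1" "\<epsilon> \<noteq> 0" using eps by auto

lemma J_Q: assumes "x \<in> U" shows "J1 x \<in> Q (\<phi> x)" "J2 x \<in> Q (\<phi> x)" "J3 x \<in> Q (\<phi> x)"
  using endo_span3_base Q_J[OF assms] by auto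

lemma J_so: assumes "x \<in> U" shows "J1 x \<in> so_alg (g (\<phi> x))" "J2 x \<in> so_alg (g (\<phi> x))" "J3 x \<in> so_alg (g (\<phi> x))"
  using J_Q[OF assms] Q_so[OF \<phi>_in[OF assms]] by auto

lemmas J_lin = so_algD(1)[OF J_so(1)] so_algD(1)[OF J_so(2)] so_algD(1)[OF J_so(3)]
lemmas J_skew = so_algD(2)[OF J_so(1)] so_algD(2)[OF J_so(2)] so_algD(2)[OF J_so(3)]
lemmas J_diff = smooth_on_differentiable[OF J_smooth(1)] smooth_on_differentiable[OF J_smooth(2)]
  smooth_on_differentiable[OF J_smooth(3)]

lemmas lin_simps = linear_add[OF J_lin(1)] linear_add[OF J_lin(2)] linear_add[OF J_lin(3)]
  linear_diff[OF J_lin(1)] linear_diff[OF J_lin(2)] linear_diff[OF J_lin(3)]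
  linear_neg[OF J_lin(1)] linear_neg[OF J_lin(2)] linear_neg[OF J_lin(3)]
  linear_scale[OF J_lin(1)] linear_scale[OF J_lin(2)] linear_scale[OF J_lin(3)]

lemma J2_J1: "x \<in> U \<Longrightarrow> J2 x (J1 x w) = - J1 x (J2 x w)"
  using J3_eq J3_eq' by (metis minus_equation_iff)

lemmas J_simps = J1_sq J2_sq J2_J1 J3_eq

lemma g\<phi>_pseudo_euclidean: "x \<in> U \<Longrightarrow> pseudo_euclidean (g (\<phi> x))" by (rule g_pseudo_euclidean[OF \<phi>_in])

abbreviation JJ where "JJ \<equiv> restrict_endo \<phi> J1"

lemma d\<phi>_inj: "x \<in> U \<Longrightarrow> fder \<phi> x u = fder \<phi> x v \<Longrightarrow> u = v"
  using immersion by (auto dest: injD)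

lemma JJ: assumes x: "x \<in> U" shows "fder \<phi> x (JJ x u) = J1 x (fder \<phi> x u)"
proof -
  obtain w where w: "J1 x (fder \<phi> x u) = fder \<phi> x w" using J1_tangent[OF x] by blast
  have "JJ x u = w"
    unfolding restrict_endo_def w using d\<phi>_inj[OF x] by blast
  then show ?thesis by (simp add: w)
qed

lemma JJ_sq: assumes x: "x \<in> U" shows "JJ x (JJ x u) = \<epsilon> *\<^sub>R u"
  by (rule d\<phi>_inj[OF x]) (simp add: JJ x J1_sq linear_scale[OF d\<phi>_lin])

lemma JJ_lin: assumes x: "x \<in> U" shows "linear (JJ x)"
  by (rule linearI; rule d\<phi>_inj[OF x])
    (simp_all add: JJ x linear_scale[OF d\<phi>_lin] linear_add[OF d\<phi>_lin] lin_simps)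

lemma JJ_skew: "x \<in> U \<Longrightarrow> gi x (JJ x u) v = - gi x u (JJ x v)"
  by (simp add: induced_metric_def JJ J_skew)

lemma DE_J_Q:
  assumes x: "x \<in> U"
  shows "DE (J1) x u \<in> Q (\<phi> x)" "DE J2 x u \<in> Q (\<phi> x)" "DE J3 x u \<in> Q (\<phi> x)"
  using DE_section[OF U_open x order_refl] J_Q J_diff x by auto

lemma DE_anticommute:
  assumes x: "x \<in> U" and A: "\<And>y. y \<in> U \<Longrightarrow> linear (A y)" "\<And>v. (\<lambda>y. A y v) differentiable (at x)"
    and B: "\<And>y. y \<in> U \<Longrightarrow> linear (B y)" "\<And>v. (\<lambda>y. B y v) differentiable (at x)"
    and AB: "\<And>y v. y \<in> U \<Longrightarrow> A y (B y v) + B y (A y v) = c *\<^sub>R v"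
  shows "DE A x u (B x v) + A x (DE B x u v) + (DE B x u (A x v) + B x (DE A x u v)) = 0"
proof -
  have "DE (\<lambda>y v. A y (B y v) + B y (A y v)) x u = DE (\<lambda>y v. c *\<^sub>R v) x u"
    by (rule DE_cong[OF U_open x]) (simp add: AB)
  then have "DE (\<lambda>y v. A y (B y v) + B y (A y v)) x u v = 0" by (simp add: DE_const_scale[OF x])
  moreover have "DE (\<lambda>y v. A y (B y v) + B y (A y v)) x u v
      = DE (\<lambda>y v. A y (B y v)) x u v + DE (\<lambda>y v. B y (A y v)) x u v"
    by (rule DE_add[OF x differentiable_linear_family[OF U_open x A B(2)] differentiable_linear_family[OF U_open x B A(2)]])
  ultimately show ?thesis
    using DE_compose[OF U_open x order_refl A B(2), where u = u and v = v]
      DE_compose[OF U_open x order_refl B A(2), where u = u and v = v] by simp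
qed

text \<open>The connection form of \<open>Q\<close> in the adapted basis is skew: this follows by differentiating the
  relations \<open>J\<^sub>1\<^sup>2 = \<epsilon>\<close>, \<open>J\<^sub>2\<^sup>2 = 1\<close>, \<open>J\<^sub>1 J\<^sub>2 + J\<^sub>2 J\<^sub>1 = 0\<close> and \<open>J\<^sub>3 = J\<^sub>1 J\<^sub>2\<close>.\<close>

lemma DE_J:
  assumes x: "x \<in> U"
  shows "\<exists>a b d. (\<forall>v. DE J1 x u v = a *\<^sub>R J2 x v + b *\<^sub>R J3 x v) \<and>
    (\<forall>v. DE J2 x u v = (- \<epsilon> * a) *\<^sub>R J1 x v + d *\<^sub>R J3 x v) \<and>
    (\<forall>v. DE J3 x u v = b *\<^sub>R J1 x v + (\<epsilon> * d) *\<^sub>R J2 x v)"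
proof -
  note [simp] = J_simps lin_simps x eps_sq
  obtain p1 a b where 1: "\<And>v. DE J1 x u v = p1 *\<^sub>R J1 x v + a *\<^sub>R J2 x v + b *\<^sub>R J3 x v"
    using DE_J_Q(1)[OF x, of u] unfolding Q_J[OF x] endo_span3_def mem_Collect_eq fun_eq_iff by blast
  obtain c p2 d where 2: "\<And>v. DE J2 x u v = c *\<^sub>R J1 x v + p2 *\<^sub>R J2 x v + d *\<^sub>R J3 x v"
    using DE_J_Q(2)[OF x, of u] unfolding Q_J[OF x] endo_span3_def mem_Collect_eq fun_eq_iff by blast
  note an = DE_anticommute[OF x]
  obtain v :: 'b where v: "v \<noteq> 0" using nonempty_Basis nonzero_Basis by blast
  have z: "t = 0" if "t *\<^sub>R v = 0" for t :: real using that v by simp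
  have "(4 * (p1 * \<epsilon>)) *\<^sub>R v = 0"
    using an[of J1 J1 "2 * \<epsilon>" u v] by (simp add: J_lin J_diff 1) (simp add: algebra_simps flip: scaleR_left_distrib)
  then have p1: "p1 = 0" using z[of "4 * (p1 * \<epsilon>)"] by simp
  have "(4 * p2) *\<^sub>R v = 0"
    using an[of J2 J2 2 u v] by (simp add: J_lin J_diff 2 scaleR_2) (simp add: algebra_simps flip: scaleR_left_distrib)
  then have p2: "p2 = 0" using z[of "4 * p2"] by simp
  have "(2 * a + 2 * (\<epsilon> * c)) *\<^sub>R v = 0"
    using an[of J1 J2 0 u v] by (simp add: J_lin J_diff 1 2 p1 p2) (simp add: algebra_simps flip: scaleR_left_distrib)
  then have "2 * a + 2 * (\<epsilon> * c) = 0" by (rule z)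
  then have c: "c = - \<epsilon> * a" using eps_sq by algebra
  have "DE J3 x u v = b *\<^sub>R J1 x v + (\<epsilon> * d) *\<^sub>R J2 x v" for v
  proof -
    have "DE J3 x u = DE (\<lambda>y v. J1 y (J2 y v)) x u"
      by (rule DE_cong[OF U_open x]) (simp add: J3_eq fun_eq_iff)
    then have "DE J3 x u v = DE J1 x u (J2 x v) + J1 x (DE J2 x u v)"
      using DE_compose[OF U_open x order_refl J_lin(1) J_diff(1)[OF x] J_diff(2)[OF x]] by simp
    then show ?thesis by (simp add: 1 2 p1 p2 c mult.assoc[symmetric] mult.commute[of d])
  qed
  with 1 2 p1 p2 c show ?thesis by (intro exI[of _ a] exI[of _ b] exI[of _ d]) simp
qed

lemma J1_normal: "x \<in> U \<Longrightarrow> (\<And>v. g (\<phi> x) w (fder \<phi> x v) = 0) \<Longrightarrow> g (\<phi> x) (J1 x w) (fder \<phi> x v) = 0"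
  by (simp add: J_skew(1) JJ[symmetric])

lemma J1_h: "x \<in> U \<Longrightarrow> g (\<phi> x) (J1 x (h x u v)) (fder \<phi> x w) = 0"
  by (rule J1_normal) (simp_all add: h_normal)

text \<open>The covariant derivative of the Kaehler form only sees the derivative of \<open>J1\<close>, because \<open>J1\<close> preserves
  tangent and normal vectors and so the second fundamental form drops out.\<close>

lemma Kaehler_condition:
  assumes x: "x \<in> U"
  shows "g (\<phi> x) (DE J1 x w (fder \<phi> x u)) (fder \<phi> x v) = 0"
proof -
  interpret pseudo_euclidean "g (\<phi> x)" by (rule g\<phi>_pseudo_euclidean[OF x])
  have dJ: "(\<lambda>y. J1 y (fder \<phi> y u)) differentiable (at x)"
    by (rule differentiable_linear_family[OF U_open x J_lin(1) J_diff(1)[OF x] d\<phi>_diff[OF x]])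
  have "fder (\<lambda>y. gi y (JJ y u) v) x w = fder (\<lambda>y. g (\<phi> y) (J1 y (fder \<phi> y u)) (fder \<phi> y v)) x w"
    by (rule fder_cong[OF U_open x]) (simp add: induced_metric_def JJ)
  also have "\<dots> = g (\<phi> x) (DD (\<lambda>y. J1 y (fder \<phi> y u)) x w) (fder \<phi> x v)
      + g (\<phi> x) (J1 x (fder \<phi> x u)) (DD (\<lambda>y. fder \<phi> y v) x w)"
    by (rule DD_metric[OF x dJ d\<phi>_diff[OF x]])
  also have "DD (\<lambda>y. J1 y (fder \<phi> y u)) x w = DE J1 x w (fder \<phi> x u) + J1 x (fder \<phi> x (Gi x w u) + h x w u)"
    unfolding gauss_formula[symmetric] by (rule DD_Leibniz[OF U_open x order_refl J_lin(1) J_diff(1)[OF x] d\<phi>_diff[OF x]])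
  also have "g (\<phi> x) (J1 x (fder \<phi> x u)) (DD (\<lambda>y. fder \<phi> y v) x w) = g (\<phi> x) (J1 x (fder \<phi> x u)) (fder \<phi> x (Gi x w v))"
    unfolding gauss_formula JJ[OF x, symmetric] by (simp add: b_simps h_normal'[OF x])
  finally have "cov_form (levi_civita gi) (\<lambda>x u v. gi x (JJ x u) v) x w u v = g (\<phi> x) (DE J1 x w (fder \<phi> x u)) (fder \<phi> x v)"
    unfolding cov_form_def levi_civita_induced[OF x]
    by (simp add: induced_metric_def JJ x b_simps lin_simps J1_h)
  then show ?thesis using F_parallel[OF x, of w u v] by simp
qed

lemma beta_relations:
  assumes x: "x \<in> U"
  shows "g (\<phi> x) (J2 x (fder \<phi> x u)) (fder \<phi> x (JJ x v)) = - g (\<phi> x) (J3 x (fder \<phi> x u)) (fder \<phi> x v)"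
    "g (\<phi> x) (J3 x (fder \<phi> x u)) (fder \<phi> x (JJ x v)) = - \<epsilon> * g (\<phi> x) (J2 x (fder \<phi> x u)) (fder \<phi> x v)"
proof -
  interpret pseudo_euclidean "g (\<phi> x)" by (rule g\<phi>_pseudo_euclidean[OF x])
  have s: "g (\<phi> x) w (J1 x w') = - g (\<phi> x) (J1 x w) w'" for w w' using J_skew(1)[OF x, of w w'] by simp
  show "g (\<phi> x) (J2 x (fder \<phi> x u)) (fder \<phi> x (JJ x v)) = - g (\<phi> x) (J3 x (fder \<phi> x u)) (fder \<phi> x v)"
    by (simp add: JJ x s J3_eq)
  show "g (\<phi> x) (J3 x (fder \<phi> x u)) (fder \<phi> x (JJ x v)) = - \<epsilon> * g (\<phi> x) (J2 x (fder \<phi> x u)) (fder \<phi> x v)"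
    by (simp add: JJ x s J3_eq J1_sq b_simps)
qed

lemma exists_non_null_tangent: assumes x: "x \<in> U" obtains z where "gi x z z \<noteq> 0"
  using pseudo_euclidean.exists_non_null[OF gi_pseudo_euclidean[OF x]] by blast

lemma J1_curvature_commutator:
  assumes x: "x \<in> U" and n: "n \<ge> 2"
  shows "\<exists>lam. lam \<noteq> 0 \<and> (\<forall>X Y v. J1 x (riemann g (\<phi> x) X Y v) - riemann g (\<phi> x) X Y (J1 x v)
      = lam *\<^sub>R (g (\<phi> x) X (J2 x Y) *\<^sub>R J3 x v) - lam *\<^sub>R (g (\<phi> x) X (J3 x Y) *\<^sub>R J2 x v))"
proof -
  have "DIM('b) > 4" using n dim_b by simp
  show ?thesis
    by (rule riemann_commutator[OF \<phi>_in[OF x] \<open>DIM('b) > 4\<close> scal_nonzero[OF \<phi>_in[OF x]] eps_sq(1) Q_J[OF x]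
      J1_sq[OF x] J2_sq[OF x] J3_eq[OF x] J3_eq'[OF x]]) blast
qed

text \<open>Write \<open>P = DE J1 = a J2 + b J3\<close> and \<open>\<beta>\<^sub>i(u, v) = g(J\<^sub>i u, v)\<close> on tangent vectors. The Kaehler condition is
  \<open>a \<beta>\<^sub>2 + b \<beta>\<^sub>3 = 0\<close>; replacing \<open>v\<close> by its image under the complex structure gives
  \<open>a \<beta>\<^sub>3 + \<epsilon> b \<beta>\<^sub>2 = 0\<close>. The determinant of this system vanishes only if \<open>P\<close> is null, which happens
  for \<open>\<epsilon> = 1\<close> only. In that case \<open>a [J\<^sub>1, R(u, v)]\<close> is \<open>\<beta>\<^sub>3\<close> times a multiple of \<open>P\<close>. It maps \<open>T\<close> into \<open>T\<close> by curvature
  invariance and into the orthogonal complement by the Kaehler condition. But a null \<open>P\<close> that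
  vanishes on \<open>T\<close> makes \<open>J\<^sub>1\<close> a scalar on \<open>T\<close>, which contradicts its skewness.\<close>

lemma totally_complex_if_not_parallel:
  assumes x: "x \<in> U" and n: "n \<ge> 2" and nz: "DE J1 x w0 v0 \<noteq> 0"
  shows "g (\<phi> x) (J2 x (fder \<phi> x u)) (fder \<phi> x v) = 0" "g (\<phi> x) (J3 x (fder \<phi> x u)) (fder \<phi> x v) = 0"
proof -
  interpret pseudo_euclidean "g (\<phi> x)" by (rule g\<phi>_pseudo_euclidean[OF x])
  define \<beta>2 where "\<beta>2 u v = g (\<phi> x) (J2 x (fder \<phi> x u)) (fder \<phi> x v)" for u v
  define \<beta>3 where "\<beta>3 u v = g (\<phi> x) (J3 x (fder \<phi> x u)) (fder \<phi> x v)" for u v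
  obtain a b where P: "\<And>v. DE J1 x w0 v = a *\<^sub>R J2 x v + b *\<^sub>R J3 x v"
    using DE_J[OF x, of w0] by blast
  have ab: "a \<noteq> 0 \<or> b \<noteq> 0" using nz by (auto simp: P)
  have 1: "a * \<beta>2 u v + b * \<beta>3 u v = 0" for u v
    using Kaehler_condition[OF x, of w0 u v] by (simp add: P b_simps \<beta>2_def \<beta>3_def)
  have r: "\<beta>2 u (JJ x v) = - \<beta>3 u v" "\<beta>3 u (JJ x v) = - \<epsilon> * \<beta>2 u v" for u v
    using beta_relations[OF x] by (simp_all add: \<beta>2_def \<beta>3_def)
  have 2: "a * \<beta>3 u v + \<epsilon> * b * \<beta>2 u v = 0" for u v
    using 1[of u "JJ x v"] by (simp add: r algebra_simps)
  have 3: "(a * a - \<epsilon> * b * b) * \<beta>2 u v = 0" for u v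
    using 1[of u v] 2[of u v] by algebra
  have \<beta>2_zero: "\<beta>2 u v = 0" for u v
  proof (cases "a * a = \<epsilon> * b * b")
    case False then show ?thesis using 3[of u v] by simp
  next
    case null: True
    then have a: "a \<noteq> 0" using ab eps_sq by auto
    have \<beta>3_zero: "\<beta>3 v u = 0" for u v
    proof (rule ccontr)
      assume nonzero: "\<beta>3 v u \<noteq> 0"
      obtain lam where lam: "lam \<noteq> 0" and com: "\<forall>X Y v. J1 x (riemann g (\<phi> x) X Y v) - riemann g (\<phi> x) X Y (J1 x v)
          = lam *\<^sub>R (g (\<phi> x) X (J2 x Y) *\<^sub>R J3 x v) - lam *\<^sub>R (g (\<phi> x) X (J3 x Y) *\<^sub>R J2 x v)"
        using J1_curvature_commutator[OF x n] by blast
      note com = com[rule_format]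
      have P0: "a *\<^sub>R J2 x (fder \<phi> x z) + b *\<^sub>R J3 x (fder \<phi> x z) = 0" for z
      proof -
        define E where "E = J1 x (riemann g (\<phi> x) (fder \<phi> x u) (fder \<phi> x v) (fder \<phi> x z))
          - riemann g (\<phi> x) (fder \<phi> x u) (fder \<phi> x v) (J1 x (fder \<phi> x z))"
        obtain r1 where r1: "riemann g (\<phi> x) (fder \<phi> x u) (fder \<phi> x v) (fder \<phi> x z) = fder \<phi> x r1"
          using curv_inv[OF x] by blast
        obtain r2 where r2: "riemann g (\<phi> x) (fder \<phi> x u) (fder \<phi> x v) (J1 x (fder \<phi> x z)) = fder \<phi> x r2"
          using curv_inv[OF x, of u v "JJ x z"] by (auto simp: JJ x)
        have E_tan: "E = fder \<phi> x (JJ x r1 - r2)"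
          by (simp add: E_def r1 r2 JJ x linear_diff[OF d\<phi>_lin])
        have "E = lam *\<^sub>R (\<beta>2 v u *\<^sub>R J3 x (fder \<phi> x z)) - lam *\<^sub>R (\<beta>3 v u *\<^sub>R J2 x (fder \<phi> x z))"
          unfolding E_def com \<beta>2_def \<beta>3_def sym[of "fder \<phi> x u"] ..
        then have "a *\<^sub>R E = lam *\<^sub>R ((a * \<beta>2 v u) *\<^sub>R J3 x (fder \<phi> x z)) - lam *\<^sub>R ((a * \<beta>3 v u) *\<^sub>R J2 x (fder \<phi> x z))"
          by (simp add: scaleR_diff_right mult.left_commute[of a])
        also have "a * \<beta>2 v u = - (b * \<beta>3 v u)" using 1[of v u] by simp
        finally have aE': "a *\<^sub>R E = lam *\<^sub>R ((- (b * \<beta>3 v u)) *\<^sub>R J3 x (fder \<phi> x z))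
          - lam *\<^sub>R ((a * \<beta>3 v u) *\<^sub>R J2 x (fder \<phi> x z))" .
        have aE: "a *\<^sub>R E = (- lam * \<beta>3 v u) *\<^sub>R (a *\<^sub>R J2 x (fder \<phi> x z) + b *\<^sub>R J3 x (fder \<phi> x z))"
          unfolding aE' by (simp add: algebra_simps)
        have "g (\<phi> x) (a *\<^sub>R E) (fder \<phi> x t) = 0" for t
          unfolding aE using 1[of z t] by (simp add: b_simps \<beta>2_def \<beta>3_def)
        then have "g (\<phi> x) E (fder \<phi> x t) = 0" for t using a by (simp add: b_simps)
        then have "JJ x r1 - r2 = 0"
          unfolding E_tan by (rule tangent_orthogonal_zero[OF x])
        then have "E = 0" unfolding E_tan using linear_0[OF d\<phi>_lin[OF x]] by simp
        then show ?thesis using aE nonzero lam by simp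
      qed
      have ab_J: "a *\<^sub>R fder \<phi> x z = b *\<^sub>R J1 x (fder \<phi> x z)" for z
        using arg_cong[OF P0[of z], of "J2 x"] by (simp add: lin_simps J_simps x linear_0[OF J_lin(2)])
      obtain z where z: "gi x z z \<noteq> 0" by (rule exists_non_null_tangent[OF x])
      have "a * a * gi x z z = g (\<phi> x) (a *\<^sub>R fder \<phi> x z) (a *\<^sub>R fder \<phi> x z)"
        by (simp add: b_simps induced_metric_def)
      also have "\<dots> = b * b * g (\<phi> x) (J1 x (fder \<phi> x z)) (J1 x (fder \<phi> x z))"
        unfolding ab_J by (simp add: b_simps)
      also have "\<dots> = - (\<epsilon> * b * b) * gi x z z"
        by (simp add: J_skew x J1_sq b_simps induced_metric_def)
      finally have "a * a * gi x z z = 0" by (simp add: null)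
      then show False using a z by simp
    qed
    show ?thesis using 1[of u v] a by (simp add: \<beta>3_zero)
  qed
  then show "g (\<phi> x) (J2 x (fder \<phi> x u)) (fder \<phi> x v) = 0" by (simp add: \<beta>2_def)
  show "g (\<phi> x) (J3 x (fder \<phi> x u)) (fder \<phi> x v) = 0"
    using r(1)[of u v] \<beta>2_zero by (simp add: \<beta>3_def)
qed

text \<open>The cyclic sum of the identity \<open>orthogonality_derivative\<close> has no second fundamental form left,
  as \<open>h\<close> is symmetric. What remains is the product of the 1-form \<open>c\<close> with the Kaehler form.\<close>

lemma form_coefficient_zero:
  assumes n: "n \<ge> 2" and N: "open N" "x \<in> N" "N \<subseteq> U"
    and K: "\<And>y. y \<in> N \<Longrightarrow> linear (K y)" "\<And>v. (\<lambda>y. K y v) differentiable (at x)" and skew: "K x \<in> so_alg (g (\<phi> x))"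
    and orth: "\<And>y u v. y \<in> N \<Longrightarrow> g (\<phi> y) (K y (fder \<phi> y u)) (fder \<phi> y v) = 0"
    and c: "\<And>w u v. g (\<phi> x) (DE K x w (fder \<phi> x u)) (fder \<phi> x v) = c w * g (\<phi> x) (J1 x (fder \<phi> x u)) (fder \<phi> x v)"
  shows "c w = 0"
proof -
  have x: "x \<in> U" using N by auto
  interpret i: pseudo_euclidean "gi x" by (rule gi_pseudo_euclidean[OF x])
  define F where "F u v = gi x (JJ x u) v" for u v
  have F: "F u v = g (\<phi> x) (J1 x (fder \<phi> x u)) (fder \<phi> x v)" for u v
    by (simp add: F_def induced_metric_def JJ x)
  have od: "c w * F u v = g (\<phi> x) (K x (h x w v)) (fder \<phi> x u) - g (\<phi> x) (K x (h x w u)) (fder \<phi> x v)" for w u v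
    unfolding F c[symmetric] by (rule orthogonality_derivative[OF N K skew orth])
  show ?thesis
  proof (rule symplectic_form_not_divisible[of F c])
    show "DIM('a) > 2" using n dim_a by simp
    show "linear (\<lambda>u. F u v)" for v
      unfolding F_def using linear_compose[OF JJ_lin[OF x] i.lin1] by (simp add: o_def)
    show "F u v = - F v u" for u v
      unfolding F_def using JJ_skew[OF x, of u v] i.sym by metis
    show "nondegenerate F"
      unfolding nondegenerate_def F_def
    proof (intro allI impI)
      fix u assume "\<forall>v. gi x (JJ x u) v = 0"
      then have "JJ x u = 0" using i.eq_zeroI by blast
      then show "u = 0" using JJ_sq[OF x, of u] linear_0[OF JJ_lin[OF x]] eps_sq by simp
    qed
    show "c w * F u v + c u * F v w + c v * F w u = 0" for w u v
      unfolding od by (simp add: h_sym[OF x, of w v] h_sym[OF x, of u w] h_sym[OF x, of v u])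
  qed
qed

text \<open>A nonzero derivative of \<open>J1\<close> persists on a neighbourhood, where therefore \<open>J2\<close> and \<open>J3\<close> map tangent
  vectors to normal ones. The components of the derivatives of \<open>J2\<close> and \<open>J3\<close> along \<open>J1\<close> are then zero, and
  by \<open>DE_J\<close> these determine the derivative of \<open>J1\<close>.\<close>

theorem J1_parallel:
  assumes x: "x \<in> U" shows "DE J1 x w v = 0"
proof (cases "n \<ge> 2")
  case False
  have "n \<noteq> 0" using dim_a DIM_positive[where 'a='a] by auto
  with False have "n = 1" by simp
  then show ?thesis using surface x by blast
next
  case n: True
  show ?thesis
  proof (rule ccontr)
    assume nz: "DE J1 x w v \<noteq> 0"
    \<comment> \<open>The contradiction needs orthogonality on a whole neighbourhood, because it will be differentiated.\<close>
    define N where "N = {y \<in> U. DE J1 y w v \<noteq> 0}"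
    have "continuous_on U (\<lambda>y. DE J1 y w v)"
    proof (rule continuous_at_imp_continuous_on, rule ballI)
      fix y assume y: "y \<in> U"
      show "isCont (\<lambda>y. DE J1 y w v) y"
        by (rule differentiable_imp_continuous_within[OF DE_differentiable[OF U_open y order_refl J_lin(1) J_smooth(1)]])
    qed
    then have "open (U \<inter> (\<lambda>y. DE J1 y w v) -` (- {0}))"
      using continuous_open_preimage[OF _ U_open] by blast
    moreover have "N = U \<inter> (\<lambda>y. DE J1 y w v) -` (- {0})" by (auto simp: N_def)
    ultimately have N: "open N" "x \<in> N" "N \<subseteq> U" using nz x by (auto simp: N_def)
    have orth: "g (\<phi> y) (J2 y (fder \<phi> y u)) (fder \<phi> y v) = 0" "g (\<phi> y) (J3 y (fder \<phi> y u)) (fder \<phi> y v) = 0"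
      if "y \<in> N" for y u v
      using totally_complex_if_not_parallel[OF _ n] that by (auto simp: N_def)
    interpret pseudo_euclidean "g (\<phi> x)" by (rule g\<phi>_pseudo_euclidean[OF x])
    obtain a b d where D: "\<And>u v. DE J1 x u v = a u *\<^sub>R J2 x v + b u *\<^sub>R J3 x v"
      "\<And>u v. DE J2 x u v = (- \<epsilon> * a u) *\<^sub>R J1 x v + d u *\<^sub>R J3 x v"
      "\<And>u v. DE J3 x u v = b u *\<^sub>R J1 x v + (\<epsilon> * d u) *\<^sub>R J2 x v" using DE_J[OF x] by metis
    have "- \<epsilon> * a w = 0"
      by (rule form_coefficient_zero[OF n N, of J2 "\<lambda>w. - \<epsilon> * a w"])
        (use N x in \<open>auto simp: J_lin J_diff J_so D b_simps orth\<close>)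
    moreover have "b w = 0"
      by (rule form_coefficient_zero[OF n N, of J3 b])
        (use N x in \<open>auto simp: J_lin J_diff J_so D b_simps orth\<close>)
    ultimately show False using nz eps_sq by (simp add: D)
  qed
qed

lemma DE_J2:
  assumes x: "x \<in> U"
  shows "\<exists>d. (\<forall>u v. DE J2 x u v = d u *\<^sub>R J3 x v) \<and> (\<forall>u v. DE J3 x u v = (\<epsilon> * d u) *\<^sub>R J2 x v)"
proof -
  have "\<exists>d. (\<forall>v. DE J2 x u v = d *\<^sub>R J3 x v) \<and> (\<forall>v. DE J3 x u v = (\<epsilon> * d) *\<^sub>R J2 x v)" for u
  proof -
    obtain a b d where D: "\<And>v. DE J1 x u v = a *\<^sub>R J2 x v + b *\<^sub>R J3 x v"
      "\<And>v. DE J2 x u v = (- \<epsilon> * a) *\<^sub>R J1 x v + d *\<^sub>R J3 x v"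
      "\<And>v. DE J3 x u v = b *\<^sub>R J1 x v + (\<epsilon> * d) *\<^sub>R J2 x v" using DE_J[OF x, of u] by blast
    obtain v :: 'b where v: "v \<noteq> 0" using nonempty_Basis nonzero_Basis by blast
    have ab: "a *\<^sub>R v + b *\<^sub>R J1 x v = 0" for v
      using J1_parallel[OF x, of u "J2 x v"] unfolding D(1) by (simp add: J_simps x)
    have ab': "a *\<^sub>R v - b *\<^sub>R J1 x v = 0" for v
      using arg_cong[OF ab[of "J2 x v"], of "J2 x"] by (simp add: lin_simps J_simps x linear_0[OF J_lin(2)])
    have "(2 * a) *\<^sub>R v = 0" using ab[of v] ab'[of v] by (simp add: scaleR_2 flip: scaleR_scaleR)
    then have a: "a = 0" using v by simp
    have "b *\<^sub>R J1 x (J1 x v) = 0" using ab[of "J1 x v"] a by simp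
    then have "b = 0" using v eps_sq by (simp add: J1_sq x)
    then show ?thesis using D a by auto
  qed
  then show ?thesis by metis
qed

text \<open>In higher dimensions the curvature commutes with the parallel field \<open>J1\<close>, and the commutator formula
  leaves only \<open>\<beta> = 0\<close>. A surface has tangent planes spanned by a non-null vector \<open>z\<close> and its image
  \<open>\<J> z\<close>; there \<open>\<beta>\<close> is zero because \<open>J2\<close> and \<open>J3\<close> are skew.\<close>

theorem totally_complex:
  assumes x: "x \<in> U"
  shows "g (\<phi> x) (J2 x (fder \<phi> x u)) (fder \<phi> x v) = 0" "g (\<phi> x) (J3 x (fder \<phi> x u)) (fder \<phi> x v) = 0"
proof -
  interpret pseudo_euclidean "g (\<phi> x)" by (rule g\<phi>_pseudo_euclidean[OF x])
  interpret i: pseudo_euclidean "gi x" by (rule gi_pseudo_euclidean[OF x])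
  define \<beta> where "\<beta> u v = g (\<phi> x) (J2 x (fder \<phi> x u)) (fder \<phi> x v)" for u v
  have \<beta>: "\<beta> u v = 0" for u v
  proof (cases "n \<ge> 2")
    case n: True
    obtain lam where lam: "lam \<noteq> 0" and com: "\<forall>X Y v. J1 x (riemann g (\<phi> x) X Y v) - riemann g (\<phi> x) X Y (J1 x v)
          = lam *\<^sub>R (g (\<phi> x) X (J2 x Y) *\<^sub>R J3 x v) - lam *\<^sub>R (g (\<phi> x) X (J3 x Y) *\<^sub>R J2 x v)"
      using J1_curvature_commutator[OF x n] by blast
    note com = com[rule_format]
    have zero: "DE (\<lambda>y. DE J1 y v) x u w = 0" for u v w
    proof -
      have "DE (\<lambda>y. DE J1 y v) x u = DE (\<lambda>y w. 0 *\<^sub>R w) x u"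
        by (rule DE_cong[OF U_open x]) (simp add: J1_parallel fun_eq_iff)
      then show ?thesis using DE_const_scale[OF x, of 0 u w] by simp
    qed
    define q2 where "q2 = g (\<phi> x) (fder \<phi> x v) (J2 x (fder \<phi> x u))"
    define q3 where "q3 = g (\<phi> x) (fder \<phi> x v) (J3 x (fder \<phi> x u))"
    have "q2 *\<^sub>R J3 x w = q3 *\<^sub>R J2 x w" for w
    proof -
      have "lam *\<^sub>R (q2 *\<^sub>R J3 x w - q3 *\<^sub>R J2 x w) = 0"
        using DE_curvature[OF U_open x order_refl J_lin(1) J_smooth(1), where u = v and v = u and w = w] com[of "fder \<phi> x v" "fder \<phi> x u" w]
        unfolding scaleR_diff_right by (simp add: zero q2_def q3_def)
      then show ?thesis using lam unfolding scaleR_eq_0_iff by simp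
    qed
    \<comment> \<open>Replacing \<open>w\<close> by \<open>J2 w\<close> and then applying \<open>J2\<close> changes the sign of one side only, so both sides vanish.\<close>
    then have q: "q2 *\<^sub>R J1 x w = q3 *\<^sub>R w" for w
      using \<open>q2 *\<^sub>R J3 x (J2 x w) = q3 *\<^sub>R J2 x (J2 x w)\<close> by (simp add: J_simps x)
    obtain w :: 'b where w: "w \<noteq> 0" using nonempty_Basis nonzero_Basis by blast
    have q': "- (q2 *\<^sub>R J1 x w) = q3 *\<^sub>R w"
      using arg_cong[OF q[of "J2 x w"], of "J2 x"] by (simp add: lin_simps J_simps x)
    have "q3 *\<^sub>R w = - (q3 *\<^sub>R w)" using q[of w] q' by metis
    then have "(q3 + q3) *\<^sub>R w = 0" unfolding scaleR_left_distrib by (simp only: eq_neg_iff_add_eq_0)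
    then have "q3 *\<^sub>R w = 0" by simp
    then have "q2 *\<^sub>R J1 x (J1 x w) = 0" using q[of "J1 x w"] w by simp
    then have "q2 = 0" using w eps_sq by (simp add: J1_sq x)
    then show ?thesis by (simp add: q2_def \<beta>_def sym)
  next
    case False
    have "n \<noteq> 0" using dim_a DIM_positive[where 'a='a] by auto
    with False dim_a have dim2: "DIM('a) = 2" by simp
    obtain z where z: "gi x z z \<noteq> 0" by (rule exists_non_null_tangent[OF x])
    have zJz: "gi x z (JJ x z) = 0" using JJ_skew[OF x, of z z] i.sym[of z "JJ x z"] by simp
    have JzJz: "gi x (JJ x z) (JJ x z) = - \<epsilon> * gi x z z"
      using JJ_skew[OF x, of z "JJ x z"] by (simp add: JJ_sq x i.b_simps)
    have indep: "t = 0" if "t = r *\<^sub>R JJ x z" "t = s *\<^sub>R z" for t r s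
    proof -
      have "s * gi x z z = gi x (s *\<^sub>R z) z" by (simp add: i.b_simps)
      also have "s *\<^sub>R z = r *\<^sub>R JJ x z" using that by simp
      also have "gi x (r *\<^sub>R JJ x z) z = r * gi x (JJ x z) z" by (simp add: i.b_simps)
      also have "\<dots> = 0" using zJz i.sym[of z "JJ x z"] by (simp add: i.b_simps)
      finally show ?thesis using z that by simp
    qed
    have z0: "z \<noteq> 0" and Jz0: "JJ x z \<noteq> 0" using z JzJz eps_sq by (auto simp: i.b_simps)
    have ne: "z \<noteq> JJ x z" using indep[of z 1 1] z0 by auto
    have "independent {z, JJ x z}"
    proof -
      have "z \<noteq> k *\<^sub>R JJ x z" for k using indep[of z k 1] z0 by auto
      then show ?thesis using ne z0 Jz0 by (auto simp: independent_insert span_singleton)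
    qed
    then have "UNIV \<subseteq> span {z, JJ x z}"
      by (intro card_ge_dim_independent) (auto simp: dim2 ne)
    have rep: "\<exists>p q. u = p *\<^sub>R z + q *\<^sub>R JJ x z" for u
    proof -
      have "u \<in> span {z, JJ x z}" using \<open>UNIV \<subseteq> span {z, JJ x z}\<close> by blast
      then show ?thesis by (auto simp: span_insert span_singleton algebra_simps)
    qed
    obtain p q where u: "u = p *\<^sub>R z + q *\<^sub>R JJ x z" using rep by blast
    obtain p' q' where v: "v = p' *\<^sub>R z + q' *\<^sub>R JJ x z" using rep by blast
    have alt: "\<beta> t t = 0" for t
      using J_skew(2)[OF x, of "fder \<phi> x t" "fder \<phi> x t"] sym[of "J2 x (fder \<phi> x t)"] by (simp add: \<beta>_def)
    have b3: "g (\<phi> x) (J3 x (fder \<phi> x t)) (fder \<phi> x t) = 0" for t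
      using J_skew(3)[OF x, of "fder \<phi> x t" "fder \<phi> x t"] sym[of "J3 x (fder \<phi> x t)"] by simp
    have "\<beta> z (JJ x z) = 0" unfolding \<beta>_def beta_relations(1)[OF x] by (simp add: b3)
    moreover have "\<beta> (JJ x z) z = - \<beta> z (JJ x z)"
      using J_skew(2)[OF x, of "fder \<phi> x (JJ x z)" "fder \<phi> x z"] sym by (simp add: \<beta>_def)
    ultimately show ?thesis
      using alt[of z] alt[of "JJ x z"] unfolding u v
      by (simp add: \<beta>_def linear_add[OF d\<phi>_lin[OF x]] linear_scale[OF d\<phi>_lin[OF x]] lin_simps x b_simps)
  qed
  then show "g (\<phi> x) (J2 x (fder \<phi> x u)) (fder \<phi> x v) = 0" by (simp add: \<beta>_def)
  show "g (\<phi> x) (J3 x (fder \<phi> x u)) (fder \<phi> x v) = 0"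
    using beta_relations(1)[OF x, of u v] \<beta> by (simp add: \<beta>_def)
qed

end

section \<open>The shape tensor\<close>

context eps_submanifold
begin

abbreviation C where "C \<equiv> shape_tensor g \<phi> J2"

text \<open>By dimension, \<open>T\<close> and \<open>J2 T\<close> together fill the ambient tangent space, so \<open>J2\<close> exchanges tangent and
  normal vectors. This makes the shape tensor well defined.\<close>

lemma J2_normal_tangent:
  assumes x: "x \<in> U" and w: "\<And>v. g (\<phi> x) w (fder \<phi> x v) = 0"
  obtains u where "J2 x w = fder \<phi> x u"
proof -
  interpret pseudo_euclidean "g (\<phi> x)" by (rule g\<phi>_pseudo_euclidean[OF x])
  note [simp] = linear_add[OF d\<phi>_lin[OF x]] linear_scale[OF d\<phi>_lin[OF x]] linear_0[OF d\<phi>_lin[OF x]] lin_simps J_simps x b_simps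
  define L :: "'a \<times> 'a \<Rightarrow> 'b" where "L p = fder \<phi> x (fst p) + J2 x (fder \<phi> x (snd p))" for p
  have linL: "linear L"
    by (rule linearI) (simp_all add: L_def algebra_simps)
  have "p = 0" if "L p = 0" for p
  proof -
    have "g (\<phi> x) (L p) (fder \<phi> x t) = g (\<phi> x) (fder \<phi> x (fst p)) (fder \<phi> x t)" for t
      by (simp add: L_def totally_complex)
    then have "g (\<phi> x) (fder \<phi> x (fst p)) (fder \<phi> x t) = 0" for t using that by (metis b_simps(7))
    then have 1: "fst p = 0" by (rule tangent_orthogonal_zero[OF x])
    then have "J2 x (J2 x (fder \<phi> x (snd p))) = J2 x 0" using that by (simp add: L_def)
    then have "fder \<phi> x (snd p) = fder \<phi> x 0" using linear_0[OF J_lin(2)[OF x]] by simp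
    then have "snd p = 0" by (rule d\<phi>_inj[OF x])
    with 1 show ?thesis by (simp add: prod_eq_iff)
  qed
  then have "inj L" by (simp add: linear_injective_0[OF linL])
  then have "surj L"
    by (rule linear_injective_imp_surjective[OF linL]) (simp add: dim_a dim_b)
  then obtain p where p: "w = L p" by (metis surj_def)
  have "g (\<phi> x) (fder \<phi> x (fst p)) (fder \<phi> x t) = 0" for t
    using w[of t] by (simp add: p L_def totally_complex)
  then have "fst p = 0" by (rule tangent_orthogonal_zero[OF x])
  then show ?thesis using that[of "snd p"] by (simp add: p L_def)
qed

lemma C_works: assumes x: "x \<in> U" shows "fder \<phi> x (C x X Y) = J2 x (h x X Y)"
proof -
  obtain u where u: "J2 x (h x X Y) = fder \<phi> x u"
    by (rule J2_normal_tangent[OF x h_normal[OF x]])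
  have "C x X Y = u"
    unfolding shape_tensor_def u using d\<phi>_inj[OF x] by blast
  then show ?thesis by (simp add: u)
qed

lemma h_C: "x \<in> U \<Longrightarrow> h x X Y = J2 x (fder \<phi> x (C x X Y))"
  by (simp add: C_works J2_sq)

lemma C_sym: "x \<in> U \<Longrightarrow> C x X Y = C x Y X"
  by (simp add: shape_tensor_def h_sym[of x X])

lemma C_lin: assumes x: "x \<in> U" shows "linear (\<lambda>X. C x X Y)" "linear (C x X)"
proof -
  show "linear (\<lambda>X. C x X Y)" for Y
    by (rule linearI; rule d\<phi>_inj[OF x])
      (simp_all add: C_works x linear_add[OF d\<phi>_lin] linear_scale[OF d\<phi>_lin] linear_add[OF h_lin(1)] linear_scale[OF h_lin(1)] lin_simps)
  then show "linear (C x X)" using C_sym[OF x, of X] by presburger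
qed

lemma gi_C: "x \<in> U \<Longrightarrow> gi x (C x X Y) Z = g (\<phi> x) (J2 x (h x X Y)) (fder \<phi> x Z)"
  by (simp add: induced_metric_def C_works)

lemma C_selfadjoint:
  assumes x: "x \<in> U" shows "gi x (C x X Y) Z = gi x Y (C x X Z)"
proof -
  interpret pseudo_euclidean "g (\<phi> x)" by (rule g\<phi>_pseudo_euclidean[OF x])
  obtain d where D: "\<And>u v. DE J2 x u v = d u *\<^sub>R J3 x v" using DE_J2[OF x] by blast
  have "g (\<phi> x) (DE J2 x X (fder \<phi> x Y)) (fder \<phi> x Z) = 0"
    by (simp add: D b_simps totally_complex x)
  then have "gi x (C x X Z) Y = gi x (C x X Y) Z"
    using orthogonality_derivative[OF U_open x order_refl J_lin(2) J_diff(2)[OF x] J_so(2)[OF x] totally_complex(1), of X Y Z]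
    by (simp add: gi_C x)
  then show ?thesis using pseudo_euclidean.sym[OF gi_pseudo_euclidean[OF x], of Y] by simp
qed

text \<open>Orthogonality of \<open>J3 T\<close> and \<open>T\<close> makes \<open>\<J> C\<^sub>X\<close> self-adjoint. As \<open>\<J>\<close> is skew and \<open>C\<^sub>X\<close> self-adjoint, this
  means that they anticommute.\<close>

lemma C_anticommutes_JJ:
  assumes x: "x \<in> U" shows "C x X (JJ x Y) = - JJ x (C x X Y)"
proof -
  interpret pseudo_euclidean "g (\<phi> x)" by (rule g\<phi>_pseudo_euclidean[OF x])
  interpret i: pseudo_euclidean "gi x" by (rule gi_pseudo_euclidean[OF x])
  obtain d where D: "\<And>u v. DE J3 x u v = (\<epsilon> * d u) *\<^sub>R J2 x v" using DE_J2[OF x] by blast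
  have J3h: "J3 x (h x X Y) = fder \<phi> x (JJ x (C x X Y))" for X Y
    by (simp add: J3_eq JJ C_works x)
  have s: "gi x (JJ x (C x X Z)) Y = gi x (JJ x (C x X Y)) Z" for Y Z
  proof -
    have "g (\<phi> x) (DE J3 x X (fder \<phi> x Y)) (fder \<phi> x Z) = 0"
      by (simp add: D b_simps totally_complex x)
    then show ?thesis
      using orthogonality_derivative[OF U_open x order_refl J_lin(3) J_diff(3)[OF x] J_so(3)[OF x] totally_complex(2), of X Y Z]
      by (simp add: J3h induced_metric_def)
  qed
  show ?thesis
  proof (rule i.eqI)
    fix Z
    have "gi x (C x X (JJ x Y)) Z = gi x (JJ x Y) (C x X Z)" by (rule C_selfadjoint[OF x])
    also have "\<dots> = - gi x Y (JJ x (C x X Z))" by (rule JJ_skew[OF x])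
    also have "\<dots> = - gi x (JJ x (C x X Z)) Y" by (simp add: i.sym[of Y])
    also have "\<dots> = - gi x (JJ x (C x X Y)) Z" by (simp only: s)
    finally show "gi x (C x X (JJ x Y)) Z = gi x (- JJ x (C x X Y)) Z" by (simp add: i.b_simps)
  qed
qed

lemma C_differentiable:
  assumes x: "x \<in> U" shows "(\<lambda>y. C y X Y) differentiable (at x)"
proof (rule differentiable_solution[where b = gi and U = U])
  show "open U" "x \<in> U" "nondegenerate (gi x)" by (rule U_open, rule x, rule gi_nondeg[OF x])
  show "y \<in> U \<Longrightarrow> bilinear (gi y)" for y using pseudo_euclidean.bil[OF gi_pseudo_euclidean] .
  show "(\<lambda>y. gi y u v) differentiable (at x)" for u v
    unfolding induced_metric_def by (intro metric_along_differentiable x d\<phi>_diff)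
  have "(\<lambda>y. J2 y (DD (\<lambda>y. fder \<phi> y Y) y X)) differentiable (at x)"
    by (rule differentiable_linear_family[OF U_open x J_lin(2) J_diff(2)[OF x]
          DD_differentiable[OF U_open x order_refl smooth_on_fder[OF \<phi>_smooth]]])
  then show "(\<lambda>y. g (\<phi> y) (J2 y (DD (\<lambda>y. fder \<phi> y Y) y X)) (fder \<phi> y v)) differentiable (at x)" for v
    by (intro metric_along_differentiable x d\<phi>_diff)
  show "gi y (C y X Y) v = g (\<phi> y) (J2 y (DD (\<lambda>y. fder \<phi> y Y) y X)) (fder \<phi> y v)" if y: "y \<in> U" for y v
    by (simp add: gi_C y gauss_formula lin_simps linear_add[OF g_lin(1)[OF \<phi>_in[OF y]]] totally_complex)
qed

lemma riemann_induced:
  assumes x: "x \<in> U"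
  shows "riemann gi x X Y Z = fder (\<lambda>y. Gi y Y Z) x X - fder (\<lambda>y. Gi y X Z) x Y + Gi x X (Gi x Y Z) - Gi x Y (Gi x X Z)"
proof -
  have "fder (\<lambda>y. levi_civita gi y u v) x w = fder (\<lambda>y. Gi y u v) x w" for u v w
    by (rule fder_cong[OF U_open x]) (simp add: levi_civita_induced)
  then show ?thesis by (simp add: riemann_def Let_def levi_civita_induced x)
qed

text \<open>The second derivative of a coordinate field, split along \<open>T\<close> and \<open>J2 T\<close>. The tangential term
  with two factors \<open>C\<close> arises from \<open>J2 h = C\<close>; the term with \<open>d\<close> arises from the derivative of \<open>J2\<close> and \<open>J3 = - J2 J1\<close>.\<close>

lemma second_derivative_tangent:
  assumes x: "x \<in> U" and D: "\<And>u v. DE J2 x u v = d u *\<^sub>R J3 x v"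
  shows "DD (\<lambda>y. DD (\<lambda>y. fder \<phi> y Z) y Y) x X =
    fder \<phi> x (fder (\<lambda>y. Gi y Y Z) x X + Gi x X (Gi x Y Z) + C x X (C x Y Z)) +
    J2 x (fder \<phi> x (C x X (Gi x Y Z) - d X *\<^sub>R JJ x (C x Y Z) + fder (\<lambda>y. C y Y Z) x X + Gi x X (C x Y Z)))"
proof -
  have dC: "(\<lambda>y. fder \<phi> y (C y Y Z)) differentiable (at x)"
    by (rule differentiable_linear_family[OF U_open x d\<phi>_lin d\<phi>_diff[OF x] C_differentiable[OF x]])
  have dG: "(\<lambda>y. fder \<phi> y (Gi y Y Z)) differentiable (at x)"
    by (rule differentiable_linear_family[OF U_open x d\<phi>_lin d\<phi>_diff[OF x] Gi_differentiable[OF x]])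
  have "DD (\<lambda>y. DD (\<lambda>y. fder \<phi> y Z) y Y) x X = DD (\<lambda>y. fder \<phi> y (Gi y Y Z) + J2 y (fder \<phi> y (C y Y Z))) x X"
    by (rule DD_cong[OF U_open x]) (simp add: gauss_formula h_C)
  also have "\<dots> = DD (\<lambda>y. fder \<phi> y (Gi y Y Z)) x X + DD (\<lambda>y. J2 y (fder \<phi> y (C y Y Z))) x X"
    by (rule DD_add[OF x dG differentiable_linear_family[OF U_open x J_lin(2) J_diff(2)[OF x] dC]])
  also have "DD (\<lambda>y. fder \<phi> y (Gi y Y Z)) x X
      = fder \<phi> x (fder (\<lambda>y. Gi y Y Z) x X + Gi x X (Gi x Y Z)) + J2 x (fder \<phi> x (C x X (Gi x Y Z)))"
    by (simp add: DD_tangent[OF x Gi_differentiable[OF x]] h_C[OF x])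
  also have "DD (\<lambda>y. J2 y (fder \<phi> y (C y Y Z))) x X
      = DE J2 x X (fder \<phi> x (C x Y Z)) + J2 x (DD (\<lambda>y. fder \<phi> y (C y Y Z)) x X)"
    by (rule DD_Leibniz[OF U_open x order_refl J_lin(2) J_diff(2)[OF x] dC])
  also have "DD (\<lambda>y. fder \<phi> y (C y Y Z)) x X
      = fder \<phi> x (fder (\<lambda>y. C y Y Z) x X + Gi x X (C x Y Z)) + h x X (C x Y Z)"
    by (rule DD_tangent[OF x C_differentiable[OF x]])
  also have "DE J2 x X (fder \<phi> x (C x Y Z)) = - (d X *\<^sub>R J2 x (fder \<phi> x (JJ x (C x Y Z))))"
    by (simp add: D J3_eq' x JJ)
  finally show ?thesis
    by (simp add: lin_simps x C_works[symmetric] linear_add[OF d\<phi>_lin] linear_diff[OF d\<phi>_lin] linear_scale[OF d\<phi>_lin])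
qed

text \<open>Antisymmetrize the second derivatives. The tangential part is the Gauss equation; the part in
  \<open>J2 T\<close> vanishes by curvature invariance, which is the Codazzi equation.\<close>

lemma gauss_codazzi:
  assumes x: "x \<in> U" and D: "\<And>u v. DE J2 x u v = d u *\<^sub>R J3 x v"
  defines "K \<equiv> \<lambda>X Y Z. C x X (Gi x Y Z) - d X *\<^sub>R JJ x (C x Y Z) + fder (\<lambda>y. C y Y Z) x X + Gi x X (C x Y Z)"
  shows "R_tan g \<phi> x X Y Z = riemann gi x X Y Z + shape_bracket g \<phi> J2 x X Y Z" and "K X Y Z = K Y X Z"
proof -
  define t where "t = riemann gi x X Y Z + shape_bracket g \<phi> J2 x X Y Z"
  define k where "k = K X Y Z - K Y X Z"
  have R: "riemann g (\<phi> x) (fder \<phi> x X) (fder \<phi> x Y) (fder \<phi> x Z) = fder \<phi> x t + J2 x (fder \<phi> x k)"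
    unfolding DD_curvature[OF U_open x order_refl smooth_on_fder[OF \<phi>_smooth], symmetric]
      second_derivative_tangent[OF x D]
    by (simp add: t_def k_def K_def riemann_induced[OF x] shape_bracket_def Let_def linear_add[OF d\<phi>_lin[OF x]]
        linear_diff[OF d\<phi>_lin[OF x]] lin_simps x)
  obtain r where r: "fder \<phi> x t + J2 x (fder \<phi> x k) = fder \<phi> x r" using curv_inv[OF x, of X Y Z] unfolding R by blast
  have "g (\<phi> x) (fder \<phi> x r) (fder \<phi> x v) = g (\<phi> x) (fder \<phi> x t) (fder \<phi> x v)" for v
    unfolding r[symmetric] by (simp add: linear_add[OF g_lin(1)[OF \<phi>_in[OF x]]] totally_complex x)
  then have rt: "r = t" by (rule gi_eqI[OF x])
  show "R_tan g \<phi> x X Y Z = t"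
    unfolding R_tan_def R r rt by (rule tan_part_eqI[OF x refl])
  have "J2 x (J2 x (fder \<phi> x k)) = J2 x 0" using r rt by simp
  then have "fder \<phi> x k = fder \<phi> x 0"
    by (simp add: J2_sq x linear_0[OF J_lin(2)] linear_0[OF d\<phi>_lin])
  then have "k = 0" by (rule d\<phi>_inj[OF x])
  then show "K X Y Z = K Y X Z" by (simp add: k_def)
qed

theorem bracket_eq_curvature_difference:
  assumes x: "x \<in> U"
  shows "shape_bracket g \<phi> J2 x X Y Z = R_tan g \<phi> x X Y Z - riemann gi x X Y Z"
proof -
  obtain d where D: "\<And>u v. DE J2 x u v = d u *\<^sub>R J3 x v" using DE_J2[OF x] by blast
  show ?thesis using gauss_codazzi(1)[OF x D] by simp
qed

text \<open>Commutators of self-adjoint operators are skew, and the product of two operators that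
  anticommute with \<open>\<J>\<close> commutes with it. The first Bianchi identity is the symmetry of \<open>C\<close>.\<close>

theorem bracket_curvature_space:
  assumes x: "x \<in> U"
  shows "shape_bracket g \<phi> J2 x \<in> curvature_space (u_alg (gi x) (JJ x))"
proof -
  interpret i: pseudo_euclidean "gi x" by (rule gi_pseudo_euclidean[OF x])
  note ls = linear_add[OF C_lin(1)[OF x]] linear_scale[OF C_lin(1)[OF x]] linear_add[OF C_lin(2)[OF x]] linear_scale[OF C_lin(2)[OF x]]
    linear_neg[OF C_lin(2)[OF x]] linear_diff[OF JJ_lin[OF x]]
  have br: "shape_bracket g \<phi> J2 x X Y Z = C x X (C x Y Z) - C x Y (C x X Z)" for X Y Z
    by (simp add: shape_bracket_def Let_def)
  have "bilinear (\<lambda>X Y. shape_bracket g \<phi> J2 x X Y Z)" for Z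
    unfolding bilinear_def by (intro conjI allI; rule linearI) (simp_all add: br ls algebra_simps)
  moreover have "shape_bracket g \<phi> J2 x X Y Z = - shape_bracket g \<phi> J2 x Y X Z" for X Y Z
    by (simp add: br)
  moreover have "shape_bracket g \<phi> J2 x X Y \<in> u_alg (gi x) (JJ x)" for X Y
  proof -
    have "linear (shape_bracket g \<phi> J2 x X Y)"
      by (rule linearI) (simp_all add: br ls algebra_simps)
    moreover have "gi x (shape_bracket g \<phi> J2 x X Y u) v = - gi x u (shape_bracket g \<phi> J2 x X Y v)" for u v
      by (simp add: br i.b_simps C_selfadjoint[OF x])
    moreover have "shape_bracket g \<phi> J2 x X Y (JJ x u) = JJ x (shape_bracket g \<phi> J2 x X Y u)" for u
      by (simp add: br C_anticommutes_JJ[OF x] ls)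
    ultimately show ?thesis by (simp add: u_alg_def so_alg_def)
  qed
  moreover have "shape_bracket g \<phi> J2 x X Y Z + shape_bracket g \<phi> J2 x Y Z X + shape_bracket g \<phi> J2 x Z X Y = 0" for X Y Z
    by (simp add: br C_sym[OF x, of Z Y] C_sym[OF x, of Z X] C_sym[OF x, of Y X])
  ultimately show ?thesis unfolding curvature_space_def by blast
qed

definition cov_shape where "cov_shape x W X Y = fder (\<lambda>y. C y X Y) x W + Gi x W (C x X Y) - C x (Gi x W X) Y - C x X (Gi x W Y)"

lemma cov_curv_bracket:
  assumes x: "x \<in> U"
  shows "cov_curv (levi_civita gi) (shape_bracket g \<phi> J2) x W X Y Z
    = cov_shape x W X (C x Y Z) + C x X (cov_shape x W Y Z) - cov_shape x W Y (C x X Z) - C x Y (cov_shape x W X Z)"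
proof -
  have br: "shape_bracket g \<phi> J2 y X Y Z = C y X (C y Y Z) - C y Y (C y X Z)" for y X Y Z
    by (simp add: shape_bracket_def Let_def)
  have d: "((\<lambda>y. C y X (C y Y Z)) has_derivative (\<lambda>w. fder (\<lambda>y. C y X (C x Y Z)) x w + C x X (fder (\<lambda>y. C y Y Z) x w))) (at x)" for X Y
    by (rule has_derivative_linear_family[OF U_open x C_lin(2) C_differentiable[OF x] C_differentiable[OF x]])
  have "fder (\<lambda>y. shape_bracket g \<phi> J2 y X Y Z) x W
      = fder (\<lambda>y. C y X (C x Y Z)) x W + C x X (fder (\<lambda>y. C y Y Z) x W)
      - (fder (\<lambda>y. C y Y (C x X Z)) x W + C x Y (fder (\<lambda>y. C y X Z) x W))"
    unfolding br by (rule fder_unique) (rule has_derivative_diff[OF d d])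
  then show ?thesis
    unfolding cov_curv_def levi_civita_induced[OF x] cov_shape_def br
    by (simp add: linear_add[OF C_lin(2)[OF x]] linear_diff[OF C_lin(2)[OF x]] linear_diff[OF Gi_lin(2)[OF x]] algebra_simps)
qed

text \<open>By the Leibniz rule the cyclic sum consists of commutators of \<open>C\<^sub>Y\<close> with \<open>(\<nabla>\<^sub>Z C)\<^sub>X - (\<nabla>\<^sub>X C)\<^sub>Z\<close>. After
  the Codazzi equation the coefficient of each value \<open>d(Z)\<close> is a sum of products of \<open>\<J>\<close>, \<open>C\<^sub>X\<close> and \<open>C\<^sub>Y\<close>
  that cancel once \<open>\<J>\<close> is moved to the left.\<close>

theorem bracket_bianchi:
  assumes x: "x \<in> U"
  shows "cov_curv (levi_civita gi) (shape_bracket g \<phi> J2) x Z X Y W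
     + cov_curv (levi_civita gi) (shape_bracket g \<phi> J2) x X Y Z W
     + cov_curv (levi_civita gi) (shape_bracket g \<phi> J2) x Y Z X W = 0"
proof -
  obtain d where D: "\<And>u v. DE J2 x u v = d u *\<^sub>R J3 x v" using DE_J2[OF x] by blast
  have codazzi: "cov_shape x X Y V = cov_shape x Y X V + (d X *\<^sub>R JJ x (C x Y V) - d Y *\<^sub>R JJ x (C x X V))" for X Y V
    using gauss_codazzi(2)[OF x D, of X Y V] Gi_sym[OF x, of X Y] by (simp add: cov_shape_def algebra_simps)
  have CJ: "C x A (JJ x B) = - JJ x (C x A B)" for A B by (rule C_anticommutes_JJ[OF x])
  note ls = linear_add[OF C_lin(2)[OF x]] linear_diff[OF C_lin(2)[OF x]] linear_scale[OF C_lin(2)[OF x]]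
  show ?thesis
    \<comment> \<open>These three instances orient the derivatives cyclically, so that all remaining ones cancel.\<close>
    unfolding cov_curv_bracket[OF x] codazzi[of Z X] codazzi[of Y Z] codazzi[of X Y]
    by (simp add: ls CJ algebra_simps)
qed

end

section \<open>Passage from charts to the manifold\<close>

lemma smooth_atlas_chart:
  assumes A: "smooth_atlas A" and d: "d \<in> A"
  shows "open (cimg d)" "p \<in> cdom d \<Longrightarrow> cinv d (cmap d p) = p"
proof -
  have h: "open (cimg d)" "homeomorphism (cdom d) (cimg d) (cmap d) (cinv d)"
    using A d by (auto simp: smooth_atlas_def)
  then show "open (cimg d)" "p \<in> cdom d \<Longrightarrow> cinv d (cmap d p) = p"
    by (auto simp: homeomorphism_def)
qed

theorem proposition5p11:
  fixes \<epsilon> :: real and n :: nat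
    and A :: "('q::{t2_space, second_countable_topology}, 'b::euclidean_space) chart set"
    and Q :: "('q, 'b) chart \<Rightarrow> 'b \<Rightarrow> ('b \<Rightarrow> 'b) set"
    and G :: "('q, 'b) chart \<Rightarrow> 'b \<Rightarrow> 'b \<Rightarrow> 'b \<Rightarrow> real"
    and B :: "('p::{t2_space, second_countable_topology}, 'a::euclidean_space) chart set"
    and f :: "'p \<Rightarrow> 'q"
    and J :: "('q, 'b) chart \<Rightarrow> 'p \<Rightarrow> 'b \<Rightarrow> 'b"
  assumes "\<epsilon> \<in> {-1, 1}"
    and "pq_kaehler n A Q G"
    and "locally_symmetric A G"
    and "\<forall>d\<in>A. \<forall>y\<in>cimg d. reduced_scal n (G d) y \<noteq> 0"
    and "DIM('a) = 2 * n"
    and "eps_kaehler_submanifold \<epsilon> B A Q G f J"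
    and "n = 1 \<longrightarrow> parallel_section B A G f J"
    and "curvature_invariant B A G f"
  shows "\<forall>c\<in>B. \<forall>d\<in>A. \<forall>V J1 J2 J3.
    let \<phi> = local_rep f c d;
        g = induced_metric (G d) \<phi>;
        \<J> = restrict_endo \<phi> (\<lambda>x. J d (cinv c x));
        CC = shape_bracket (G d) \<phi> J2
    in open V \<and> V \<subseteq> local_dom f c d \<and>
       adapted_basis_on \<epsilon> V (\<lambda>x. Q d (\<phi> x)) (\<lambda>x. J d (cinv c x)) J1 J2 J3 \<longrightarrow>
       (\<forall>x\<in>V.
          (\<forall>X Y Z. CC x X Y Z = R_tan (G d) \<phi> x X Y Z - riemann g x X Y Z) \<and>
          CC x \<in> curvature_space (u_alg (g x) (\<J> x)) \<and>
          (\<forall>X Y Z W. cov_curv (levi_civita g) CC x Z X Y W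
                     + cov_curv (levi_civita g) CC x X Y Z W
                     + cov_curv (levi_civita g) CC x Y Z X W = 0))"
  unfolding Let_def
proof (intro ballI allI impI, elim conjE)
  fix c d V J1 J2 J3 x
  assume c: "c \<in> B" and d: "d \<in> A" and V: "open V" "V \<subseteq> local_dom f c d" and x: "x \<in> V"
    and ad: "adapted_basis_on \<epsilon> V (\<lambda>x. Q d (local_rep f c d x)) (\<lambda>x. J d (cinv c x)) J1 J2 J3"
  define \<phi> where "\<phi> = local_rep f c d"
  note pq = assms(2)[unfolded pq_kaehler_def]
  have atlas: "smooth_atlas A" "smooth_atlas B" and herm: "almost_eps_hermitian \<epsilon> B A Q G f J"
    and sub: "nondegenerate_submanifold B A G f"
    using pq assms(6) by (auto simp: eps_kaehler_submanifold_def almost_eps_hermitian_def nondegenerate_submanifold_def)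
  have \<phi>_in: "\<phi> y \<in> cimg d" if "y \<in> local_dom f c d" for y
    using that smooth_atlas_chart(2)[OF atlas(2) c] by (auto simp: \<phi>_def local_rep_def local_dom_def)
  have subc: "smooth_on (local_dom f c d) \<phi>"
    "\<And>y. y \<in> local_dom f c d \<Longrightarrow> inj (fder \<phi> y)" "\<And>y. y \<in> local_dom f c d \<Longrightarrow> nondegenerate (induced_metric (G d) \<phi> y)"
    using sub c d unfolding nondegenerate_submanifold_def \<phi>_def by blast+
  have J_range: "J d (cinv c y) ` range (fder \<phi> y) = range (fder \<phi> y)" if "y \<in> local_dom f c d" for y
    using herm c d that unfolding almost_eps_hermitian_def \<phi>_def by blast
  have adV: "smooth_on V (\<lambda>x. J1 x v)" "smooth_on V (\<lambda>x. J2 x v)" "smooth_on V (\<lambda>x. J3 x v)" for v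
    using ad unfolding adapted_basis_on_def by blast+
  have adx: "J1 y = J d (cinv c y)" "Q d (\<phi> y) = endo_span3 (J1 y) (J2 y) (J3 y)"
    "J1 y (J1 y v) = \<epsilon> *\<^sub>R v" "J2 y (J2 y v) = v" "J3 y v = J1 y (J2 y v)" "J3 y v = - J2 y (J1 y v)"
    if "y \<in> V" for y v
    using ad that unfolding adapted_basis_on_def \<phi>_def by blast+
  interpret pq_map "cimg d" "G d" V \<phi> "Q d"
  proof unfold_locales
    show "open (cimg d)" by (rule smooth_atlas_chart(1)[OF atlas(1) d])
    show "metric_on (cimg d) (G d)" using pq d by (auto simp: neutral_metric_def)
    show "open V" by (rule V(1))
    show "smooth_on V \<phi>" by (rule smooth_on_subset[OF subc(1) V(2)])
    show "y \<in> V \<Longrightarrow> \<phi> y \<in> cimg d" for y using \<phi>_in V(2) by blast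
    show "y \<in> cimg d \<Longrightarrow> Q d y \<subseteq> so_alg (G d y)" for y using pq d by blast
    show "bundle_parallel (cimg d) (G d) (Q d)" using pq d by blast
    show "\<exists>V J1 J2 J3 e1 e2 e3. open V \<and> y \<in> V \<and> V \<subseteq> cimg d \<and>
        (\<forall>v. smooth_on V (\<lambda>y. J1 y v) \<and> smooth_on V (\<lambda>y. J2 y v) \<and> smooth_on V (\<lambda>y. J3 y v)) \<and>
        (\<forall>y\<in>V. pq_basis e1 e2 e3 (Q d y) (J1 y) (J2 y) (J3 y))" if "y \<in> cimg d" for y
    proof -
      have "almost_pq_structure A Q" using pq by blast
      then have "\<forall>c\<in>A. \<forall>x\<in>cimg c. \<exists>V J1 J2 J3 e1 e2 e3. open V \<and> x \<in> V \<and> V \<subseteq> cimg c \<and>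
        (\<forall>v. smooth_on V (\<lambda>y. J1 y v) \<and> smooth_on V (\<lambda>y. J2 y v) \<and> smooth_on V (\<lambda>y. J3 y v)) \<and>
        (\<forall>y\<in>V. pq_basis e1 e2 e3 (Q c y) (J1 y) (J2 y) (J3 y))"
        unfolding almost_pq_structure_def by (rule conjunct1)
      from this[rule_format, OF d that] show ?thesis .
    qed
  qed
  \<comment> \<open>The two complex structures come from fields that agree on \<open>V\<close> only, hence so do they.\<close>
  have JJ_eq: "restrict_endo \<phi> J1 y = restrict_endo \<phi> (\<lambda>x. J d (cinv c x)) y" if "y \<in> V" for y
    using adx(1)[OF that] by (simp add: restrict_endo_def fun_eq_iff)
  interpret eps_submanifold "cimg d" "G d" V \<phi> "Q d" \<epsilon> J1 J2 J3 n
  proof unfold_locales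
    fix y assume y: "y \<in> V"
    then have yD: "y \<in> local_dom f c d" using V(2) by blast
    show "inj (fder \<phi> y)" "nondegenerate (induced_metric (G d) \<phi> y)" using subc(2,3)[OF yD] by auto
    show "Q d (\<phi> y) = endo_span3 (J1 y) (J2 y) (J3 y)" "J1 y (J1 y w) = \<epsilon> *\<^sub>R w" "J2 y (J2 y w) = w"
      "J3 y w = J1 y (J2 y w)" "J3 y w = - J2 y (J1 y w)" for w using adx[OF y] by blast+
    show "J1 y (fder \<phi> y u) \<in> range (fder \<phi> y)" for u
      using J_range[OF yD] unfolding adx(1)[OF y] by blast
    show "riemann (G d) (\<phi> y) (fder \<phi> y X) (fder \<phi> y Y) (fder \<phi> y Z) \<in> range (fder \<phi> y)" for X Y Z
      using assms(8) c d yD unfolding curvature_invariant_def Let_def \<phi>_def by blast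
    show "cov_form (levi_civita (induced_metric (G d) \<phi>))
        (\<lambda>x u v. induced_metric (G d) \<phi> x (restrict_endo \<phi> J1 x u) v) y X Y Z = 0" for X Y Z
    proof -
      have "cov_form (levi_civita (induced_metric (G d) \<phi>))
        (\<lambda>x u v. induced_metric (G d) \<phi> x (restrict_endo \<phi> (\<lambda>x. J d (cinv c x)) x u) v) y X Y Z = 0"
        using assms(6) c d yD unfolding eps_kaehler_submanifold_def Let_def \<phi>_def by blast
      moreover have "fder (\<lambda>x. induced_metric (G d) \<phi> x (restrict_endo \<phi> (\<lambda>x. J d (cinv c x)) x Y) Z) y X
          = fder (\<lambda>x. induced_metric (G d) \<phi> x (restrict_endo \<phi> J1 x Y) Z) y X"
        by (rule fder_cong[OF V(1) y]) (simp add: JJ_eq)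
      ultimately show ?thesis by (simp add: cov_form_def JJ_eq[OF y])
    qed
    show "DE J1 y u v = 0" if "n = 1" for u v
    proof -
      have "fder (\<lambda>y. J d (cinv c y) v) y u + levi_civita (G d) (\<phi> y) (fder \<phi> y u) (J d (cinv c y) v)
               - J d (cinv c y) (levi_civita (G d) (\<phi> y) (fder \<phi> y u) v) = 0"
        using assms(7) that c d yD unfolding parallel_section_def Let_def \<phi>_def by blast
      moreover have "fder (\<lambda>y. J1 y v) y u = fder (\<lambda>y. J d (cinv c y) v) y u"
        by (rule fder_cong[OF V(1) y]) (simp add: adx(1))
      ultimately show ?thesis by (simp add: DE_def adx(1)[OF y])
    qed
  next
    show "\<epsilon> \<in> {-1, 1}" "DIM('b) = 4 * n" "DIM('a) = 2 * n" using assms(1,5) pq by auto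
    show "smooth_on V (\<lambda>x. J1 x v)" "smooth_on V (\<lambda>x. J2 x v)" "smooth_on V (\<lambda>x. J3 x v)" for v by (rule adV)+
    show "scal (G d) y \<noteq> 0" if "y \<in> cimg d" for y
      using assms(4) d that by (auto simp: reduced_scal_def)
  qed
  show "(\<forall>X Y Z. shape_bracket (G d) (local_rep f c d) J2 x X Y Z
        = R_tan (G d) (local_rep f c d) x X Y Z - riemann (induced_metric (G d) (local_rep f c d)) x X Y Z) \<and>
      shape_bracket (G d) (local_rep f c d) J2 x \<in> curvature_space (u_alg (induced_metric (G d) (local_rep f c d) x)
        (restrict_endo (local_rep f c d) (\<lambda>x. J d (cinv c x)) x)) \<and>
      (\<forall>X Y Z W. cov_curv (levi_civita (induced_metric (G d) (local_rep f c d))) (shape_bracket (G d) (local_rep f c d) J2) x Z X Y W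
        + cov_curv (levi_civita (induced_metric (G d) (local_rep f c d))) (shape_bracket (G d) (local_rep f c d) J2) x X Y Z W
        + cov_curv (levi_civita (induced_metric (G d) (local_rep f c d))) (shape_bracket (G d) (local_rep f c d) J2) x Y Z X W = 0)"
    using bracket_eq_curvature_difference[OF x] bracket_curvature_space[OF x] bracket_bianchi[OF x]
    unfolding JJ_eq[OF x, unfolded \<phi>_def] \<phi>_def by blast
qed

end
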